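(* Let the data $(\ell_i)_{i}$, $\ell_*$, $(g_i)_i$, $g_*$ satisfy the standing assumptions listed in the context and assume in addition that $g_i\in C^1(\mathbb R_+)$ for all $i\in\{1,\dots,N\}$. Then for every $(x,t)\in\mathcal G\times[0,T]$ and every $y\in\Gamma_t^{\rm opt}[x]$, $y'$ belongs to $L^\infty(t,T;\mathbb R^N)$. Moreover, there exists a positive constant $V$, depending (for fixed data) only upon $|x|$ and $T-t$ (and which may blow up as $t\to T$), such that $\|y'\|_\infty\le V$.
   Context: Junction: $N>1$ is an integer, $(e_i)_{1\le i\le N}$ is the canonical basis of $\mathbb R^N$, $\mathbb R_+=[0,\infty)$, $J_i=\mathbb R_+e_i$ are the edges, $\mathcal G=\bigcup_{i=1}^N J_i\subset\mathbb R^N$, and the origin $0$ is the vertex. Fix $T>0$ and $p>1$. Trajectories: for $x\in\mathcal G$, $t\in[0,T]$, $\Gamma_t[x]$ is the set of $y\in C([t,T];\mathcal G)\cap W^{1,p}(t,T;\mathbb R^N)$ with $y(t)=x$. For such $y$ set $\bar y=|y|\in W^{1,p}(t,T)$; then for a.e. $s$, $y'(s)=\bar y'(s)e_i$ if $y(s)\in J_i\setminus\{0\}$ and $y'(s)=0$ if $y(s)=0$. Data: $g_*\in\mathbb R$; $g_i\in C_b(\mathbb R_+)$ (bounded continuous); $\ell_*\in C([0,T])$; $\ell_i\in C(\mathbb R_+\times\mathbb R\times[0,T])$, $(y,a,s)\mapsto\ell_i(y,a,s)$, differentiable in $(y,a)$ with $\partial_y\ell_i,\partial_a\ell_i$ continuous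 in $(y,a,s)$. Standing assumptions (for all $i$): (H1) there is $C_0>0$ with $\ell_i(y,a,s)\ge C_0(|a|^p-1)$ and $\ell_*(s)\ge -C_0$ for all $(y,a,s)\in\mathbb R_+\times\mathbb R\times[0,T]$; (H2) for any $r>0$ there is a modulus of continuity $\omega_r$ with $|\ell_i(y,a,t_1)-\ell_i(y,a,t_2)|\le(1+|a|^p)\omega_r(|t_1-t_2|)$ for $y\in[0,r]$, $a\in\mathbb R$, $t_1,t_2\in[0,T]$; (H3) for any $r>0$ there is $\tilde c(r)\ge0$ with $|\partial_y\ell_i(y,a,s)|\le\tilde c(r)(|a|^p+1)$ and $|\partial_a\ell_i(y,a,s)|\le\tilde c(r)(|a|^{p-1}+1)$ for $(y,a,s)\in[0,r]\times\mathbb R\times[0,T]$; (H4) $a\mapsto\ell_i(y,a,s)$ is strictly convex. Costs: $g(y)=\sum_i g_i(|y|)\mathbf 1_{y\in J_i\setminus\{0\}}+\min\{g_*,\min_i g_i(0)\}\mathbf 1_{y=0}$; $\ell_0(\tau)=\min\{\ell_*(\tau),\min_i\ell_i(0,0,\tau)\}$; $L(y(\tau),y'(\tau),\tau)=\sum_i\ell_i(\bar y(\tau),\bar y'(\tau),\tau)\mathbf 1_{y(\tau)\in J_i\setminus\{0\}}+\ell_0(\tau)\mathbf 1_{y(\tau)=0}$; $J_t(x;y)=\int_t^TL(y(\tau),y'(\tau),\tau)\,d\tau+g(y(T))$ for $y\in\Gamma_t[x]$. Optimal trajectories: $\Gamma_t^{\rm opt}[x]=\{y\in\Gamma_t[x]:J_t(x;y)=\inf_{\hat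 y\in\Gamma_t[x]}J_t(x;\hat y)\}$. *)

theory Defs
  imports "HOL-Analysis.Analysis" "HOL-Probability.Essential_Supremum"
begin

definition edge :: "'n::finite \<Rightarrow> (real ^ 'n) set" where
  "edge i = {r *\<^sub>R axis i 1 | r. 0 \<le> r}"

definition junction :: "(real ^ 'n::finite) set" where
  "junction = (\<Union>i. edge i)"


text \<open>
  One-dimensional Lebesgue and Sobolev spaces over a bounded interval \<open>(a, b)\<close>, empty when
  \<open>a = b\<close>.  Elements are functions, not classes modulo null sets.
\<close>

definition Lp :: "real \<Rightarrow> real \<Rightarrow> real \<Rightarrow> (real \<Rightarrow> 'a::euclidean_space) set" where
  "Lp p a b = {u. u \<in> borel_measurable (lebesgue_on {a<..<b}) \<and>
                  integrable (lebesgue_on {a<..<b}) (\<lambda>s. norm (u s) powr p)}"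

definition Linf_norm :: "real \<Rightarrow> real \<Rightarrow> (real \<Rightarrow> 'a::euclidean_space) \<Rightarrow> ennreal" where
  "Linf_norm a b u = esssup (lebesgue_on {a<..<b}) (\<lambda>s. ennreal (norm (u s)))"

definition Linf :: "real \<Rightarrow> real \<Rightarrow> (real \<Rightarrow> 'a::euclidean_space) set" where
  "Linf a b = {u. u \<in> borel_measurable (lebesgue_on {a<..<b}) \<and> Linf_norm a b u < \<infinity>}"

definition test_fun :: "real \<Rightarrow> real \<Rightarrow> (real \<Rightarrow> real) \<Rightarrow> bool" where
  "test_fun a b \<phi> \<longleftrightarrow> \<phi> C1_differentiable_on UNIV \<and>
     (\<exists>K. compact K \<and> K \<subseteq> {a<..<b} \<and> (\<forall>s. s \<notin> K \<longrightarrow> \<phi> s = 0))"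

text \<open>
  Distributional derivative on \<open>(a, b)\<close>.  Since \<open>(a, b)\<close> is bounded, requiring membership in
  \<open>L\<^sup>1(a, b)\<close> is no restriction for functions in \<open>L\<^sup>p(a, b)\<close>, \<open>p \<ge> 1\<close>; it also makes the
  two Bochner integrals meaningful.
\<close>

definition is_weak_deriv ::
  "real \<Rightarrow> real \<Rightarrow> (real \<Rightarrow> 'a::euclidean_space) \<Rightarrow> (real \<Rightarrow> 'a) \<Rightarrow> bool" where
  "is_weak_deriv a b u v \<longleftrightarrow> u \<in> Lp 1 a b \<and> v \<in> Lp 1 a b \<and>
     (\<forall>\<phi>. test_fun a b \<phi> \<longrightarrow>
        (LINT s|lebesgue_on {a<..<b}. deriv \<phi> s *\<^sub>R u s) =
        - (LINT s|lebesgue_on {a<..<b}. \<phi> s *\<^sub>R v s))"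

definition W1p :: "real \<Rightarrow> real \<Rightarrow> real \<Rightarrow> (real \<Rightarrow> 'a::euclidean_space) set" where
  "W1p p a b = {u. u \<in> Lp p a b \<and> (\<exists>v \<in> Lp p a b. is_weak_deriv a b u v)}"

text \<open>
  A representative of the weak derivative.  It is unique up to null sets, so integrals
  and essential suprema do not depend on the choice.
\<close>

definition weak_deriv ::
  "real \<Rightarrow> real \<Rightarrow> (real \<Rightarrow> 'a::euclidean_space) \<Rightarrow> real \<Rightarrow> 'a" where
  "weak_deriv a b u = (SOME v. is_weak_deriv a b u v)"


text \<open>Trajectories are total functions; their values outside \<open>[t, T]\<close> are irrelevant.\<close>

definition trajectories :: "real \<Rightarrow> real \<Rightarrow> real \<Rightarrow> real ^ 'n::finite \<Rightarrow> (real \<Rightarrow> real ^ 'n) set" where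
  "trajectories p T t x =
     {y. continuous_on {t..T} y \<and> (\<forall>s\<in>{t..T}. y s \<in> junction) \<and> y \<in> W1p p t T \<and> y t = x}"

definition terminal_cost :: "('n::finite \<Rightarrow> real \<Rightarrow> real) \<Rightarrow> real \<Rightarrow> real ^ 'n \<Rightarrow> real" where
  "terminal_cost g gstar z =
     (\<Sum>i\<in>UNIV. g i (norm z) * indicator (edge i - {0}) z) +
     min gstar (Min (range (\<lambda>i. g i 0))) * indicator {0} z"

definition vertex_cost ::
  "('n::finite \<Rightarrow> real \<Rightarrow> real \<Rightarrow> real \<Rightarrow> real) \<Rightarrow> (real \<Rightarrow> real) \<Rightarrow> real \<Rightarrow> real" where
  "vertex_cost l lstar \<tau> = min (lstar \<tau>) (Min (range (\<lambda>i. l i 0 0 \<tau>)))"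

text \<open>
  The velocity argument \<open>v\<close> is the derivative of the radial coordinate \<open>|y|\<close>, i.e.\ the signed
  velocity along the current edge.
\<close>

definition running_cost ::
  "('n::finite \<Rightarrow> real \<Rightarrow> real \<Rightarrow> real \<Rightarrow> real) \<Rightarrow> (real \<Rightarrow> real) \<Rightarrow> real ^ 'n \<Rightarrow> real \<Rightarrow> real \<Rightarrow> real" where
  "running_cost l lstar z v \<tau> =
     (\<Sum>i\<in>UNIV. l i (norm z) v \<tau> * indicator (edge i - {0}) z) +
     vertex_cost l lstar \<tau> * indicator {0} z"

definition cost ::
  "('n::finite \<Rightarrow> real \<Rightarrow> real \<Rightarrow> real \<Rightarrow> real) \<Rightarrow> (real \<Rightarrow> real) \<Rightarrow> ('n \<Rightarrow> real \<Rightarrow> real) \<Rightarrow> real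
     \<Rightarrow> real \<Rightarrow> real \<Rightarrow> (real \<Rightarrow> real ^ 'n) \<Rightarrow> real" where
  "cost l lstar g gstar T t y =
     (LINT \<tau>|lebesgue_on {t<..<T}.
        running_cost l lstar (y \<tau>) (weak_deriv t T (\<lambda>s. norm (y s)) \<tau>) \<tau>) +
     terminal_cost g gstar (y T)"

text \<open>
  Under the standing assumptions, the running cost is integrable along every trajectory (by the
  growth bounds on the derivatives) and the costs are bounded below (by coercivity), so the
  real-valued integral and infimum carry their usual meaning.
\<close>

definition optimal_trajectories ::
  "('n::finite \<Rightarrow> real \<Rightarrow> real \<Rightarrow> real \<Rightarrow> real) \<Rightarrow> (real \<Rightarrow> real) \<Rightarrow> ('n \<Rightarrow> real \<Rightarrow> real) \<Rightarrow> real
     \<Rightarrow> real \<Rightarrow> real \<Rightarrow> real \<Rightarrow> real ^ 'n \<Rightarrow> (real \<Rightarrow> real ^ 'n) set" where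
  "optimal_trajectories l lstar g gstar p T t x =
     {y \<in> trajectories p T t x.
        cost l lstar g gstar T t y = (INF z \<in> trajectories p T t x. cost l lstar g gstar T t z)}"


definition modulus_of_continuity :: "(real \<Rightarrow> real) \<Rightarrow> bool" where
  "modulus_of_continuity \<omega> \<longleftrightarrow>
     (\<forall>s\<ge>0. 0 \<le> \<omega> s) \<and> \<omega> 0 = 0 \<and> continuous (at 0 within {0..}) \<omega>"

definition strictly_convex :: "(real \<Rightarrow> real) \<Rightarrow> bool" where
  "strictly_convex f \<longleftrightarrow> (\<forall>a b u. a \<noteq> b \<longrightarrow> 0 < u \<longrightarrow> u < 1 \<longrightarrow>
     f ((1 - u) * a + u * b) < (1 - u) * f a + u * f b)"

text \<open>Continuously differentiable on the closed half-line, with one-sided derivative at 0.\<close>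

definition C1_halfline :: "(real \<Rightarrow> real) \<Rightarrow> bool" where
  "C1_halfline f \<longleftrightarrow> (\<exists>f'. (\<forall>y\<ge>0. (f has_real_derivative f' y) (at y within {0..})) \<and>
     continuous_on {0..} f')"

end

theory Submission
  imports Defs
begin

text \<open>
  On the junction \<open>|y|\<close> is the sum of the coordinates of \<open>y\<close>, so the radial coordinate
  \<open>u = |y|\<close> of an optimal trajectory is absolutely continuous with speed \<open>v\<close> linear in \<open>y'\<close>.
  Comparison with the constant trajectory and coercivity bound the integral of \<open>|v|\<^sup>p\<close> over
  \<open>{u > 0}\<close>.  On a component \<open>(a, b)\<close> of \<open>{u > 0}\<close> the trajectory stays in one edge \<open>i\<close> and
  can be varied freely; testing the first variation with
  \<open>\<psi> = 1\<^sub>B / |B| - 1\<^sub>A / |A|\<close> shows that the momentum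
  \<open>\<partial>\<^sub>a l\<^sub>i(u, v, s)\<close> oscillates at most by the integral of \<open>|\<partial>\<^sub>y l\<^sub>i|\<close>, which is controlled by
  the energy.  The momentum is bounded somewhere: if both ends of the component carry prescribed
  values, \<open>v\<close> cannot exceed its mean everywhere and \<open>\<partial>\<^sub>a l\<^sub>i\<close> is monotone in the speed; if
  \<open>b = T\<close> and \<open>u(T) > 0\<close>, the end point is free and \<open>g\<^sub>i'(u(T))\<close> takes over.  A bounded momentum
  gives a bounded speed by convexity and superlinearity.  Since \<open>u\<close> vanishes between components,
  the Lipschitz bound for \<open>u\<close> extends to \<open>[t, T]\<close>, and then to \<open>y\<close>.
\<close>

text \<open>The components of \<open>{u > 0}\<close> may be infinitely many and arbitrarily short,
  so no constant may contain 1/(b - a). This shapes two choices. The test functions are normalised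
  by the measures of A and B, so their primitives stay in [-1, 1] however small these sets are, and
  the term with the y-derivative costs at most a multiple of energy plus time. On a component that
  ends at the vertex the mean speed is zero if it also starts there; only the component that leaves
  x at time t can have nonzero mean, and its length is bounded below because finite energy cannot
  cover the distance |x| in a short time. The energy is controlled only off the vertex, because the
  cost at the vertex does not see the speed. Variations are confined to intervals on which u has a
  positive minimum, so that a small perturbation cannot reach the vertex, where the running cost may
  jump. The momentum bound then passes to the whole component by exhaustion. The final constant has
  no closed form: a bound is found for each pair (x, t), and the finitely many points of the
  junction with the same norm are then merged.\<close>

lemma powr_le_add_one:
  fixes b :: real
  assumes "0 \<le> a" "a \<le> b" "0 \<le> x"
  shows "x powr a \<le> x powr b + 1"
proof (cases "1 \<le> x")
  case True
  then show ?thesis using powr_mono[OF \<open>a \<le> b\<close> True] by simp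
next
  case False
  have "x powr a \<le> 1"
    using powr_le1[of a x] assms False by simp
  then show ?thesis by (simp add: add_increasing)
qed

lemma powr_add_le:
  fixes x y p :: real
  assumes "0 \<le> x" "0 \<le> y" "0 \<le> p"
  shows "(x + y) powr p \<le> 2 powr p * (x powr p + y powr p)"
proof -
  have "(x + y) powr p \<le> (2 * max x y) powr p"
    using assms by (intro powr_mono2) auto
  also have "\<dots> = 2 powr p * max x y powr p" using assms by (simp add: powr_mult)
  also have "\<dots> \<le> 2 powr p * (x powr p + y powr p)"
    by (intro mult_left_mono) (auto simp: max_def)
  finally show ?thesis .
qed

text \<open>A form of Young's inequality with a free weight: above the threshold
  \<open>\<eta>\<close> times |a| to the power p - 1 is at least 1, so the power absorbs |a|; below
  it the constant suffices. A small \<open>\<eta>\<close> trades energy against the length of a time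
  interval.\<close>

lemma young_powr:
  fixes a \<eta> p :: real
  assumes "0 < \<eta>" "1 < p"
  shows "\<bar>a\<bar> \<le> \<eta> * \<bar>a\<bar> powr p + (1 / \<eta>) powr (1 / (p - 1))"
proof (cases "\<bar>a\<bar> \<le> (1 / \<eta>) powr (1 / (p - 1))")
  case True
  then show ?thesis using assms by (simp add: add_increasing)
next
  case False
  have C: "0 < (1 / \<eta>) powr (1 / (p - 1))" using assms by simp
  have "((1 / \<eta>) powr (1 / (p - 1))) powr (p - 1) \<le> \<bar>a\<bar> powr (p - 1)"
    using False C assms by (intro powr_mono2) auto
  then have "1 / \<eta> \<le> \<bar>a\<bar> powr (p - 1)" using assms by (simp add: powr_powr)
  then have "1 \<le> \<eta> * \<bar>a\<bar> powr (p - 1)" using assms by (simp add: field_simps)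
  then have "1 * \<bar>a\<bar> \<le> (\<eta> * \<bar>a\<bar> powr (p - 1)) * \<bar>a\<bar>" by (rule mult_right_mono) simp
  also have "\<dots> = \<eta> * \<bar>a\<bar> powr p"
    using powr_mult_base[of "\<bar>a\<bar>" "p - 1"] by (simp add: algebra_simps)
  finally show ?thesis using C by linarith
qed

section \<open>Weak derivatives on an interval\<close>

text \<open>Lebesgue differentiation: at almost every x the averages of f over [x, x + h] converge
  to f x, and these averages are nonnegative by hypothesis.\<close>

lemma AE_nonneg_of_integrals:
  fixes f :: "real \<Rightarrow> real"
  assumes f: "integrable (lebesgue_on {a<..<b}) f"
    and pos: "\<And>s r. a \<le> s \<Longrightarrow> s \<le> r \<Longrightarrow> r \<le> b \<Longrightarrow> 0 \<le> integral {s..r} f"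
  shows "AE s in lebesgue_on {a<..<b}. 0 \<le> f s"
proof -
  \<comment> \<open>Extension by zero gives a function that is integrable on every compact interval,
    as the differentiation theorem asks; at interior points and for small h its averages are those
    of f.\<close>
  define g where "g = (\<lambda>x. if x \<in> {a<..<b} then f x else 0)"
  have "f integrable_on {a<..<b}"
    using integrable_on_lebesgue_on[OF f] by simp
  then have "g integrable_on UNIV"
    unfolding g_def by (simp only: Henstock_Kurzweil_Integration.integrable_restrict_UNIV)
  then have "g integrable_on cbox c d" for c d
    by (rule integrable_on_subcbox) auto
  then obtain N where N: "negligible N" and
    *: "\<And>x e. \<lbrakk>x \<notin> N; 0 < e\<rbrakk> \<Longrightarrow> \<exists>d>0. \<forall>h. 0 < h \<and> h < d \<longrightarrow>
         norm (integral (cbox x (x + h *\<^sub>R One)) g /\<^sub>R h ^ DIM(real) - g x) < e"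
    using integrable_ccontinuous_explicit[of g] by metis
  have "0 \<le> f x" if x: "x \<in> {a<..<b}" "x \<notin> N" for x
  proof (rule ccontr)
    assume "\<not> 0 \<le> f x"
    then obtain d where d: "d > 0" and
      dd: "\<And>h. 0 < h \<Longrightarrow> h < d \<Longrightarrow> norm (integral {x..x+h} g /\<^sub>R h - g x) < - f x"
      using *[OF x(2), of "- f x"] by auto
    define h where "h = min d (b - x) / 2"
    have h: "0 < h" "h < d" "x + h < b" using d x by (auto simp: h_def min_def field_simps)
    have "integral {x..x+h} g = integral {x..x+h} f"
      by (rule integral_cong) (use x h in \<open>auto simp: g_def\<close>)
    moreover have "0 \<le> integral {x..x+h} f" using pos[of x "x+h"] x h by auto
    ultimately have "0 \<le> integral {x..x+h} g /\<^sub>R h" using h by simp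
    then show False using dd[OF h(1,2)] x by (auto simp: g_def)
  qed
  moreover have "N \<in> null_sets lebesgue" using N by (simp add: negligible_iff_null_sets)
  ultimately show ?thesis
    by (auto simp: AE_restrict_space_iff intro!: AE_I'[of N])
qed

section \<open>Lebesgue spaces, test functions and integrals on a bounded interval\<close>

lemma Lp_1_iff: "u \<in> Lp 1 a b \<longleftrightarrow> integrable (lebesgue_on {a<..<b}) u"
  by (auto simp: Lp_def integrable_norm_iff)

lemma Lp_imp_integrable:
  assumes "u \<in> Lp p a b" "1 \<le> p"
  shows "integrable (lebesgue_on {a<..<b}) u"
proof (rule Bochner_Integration.integrable_bound)
  interpret finite_measure "lebesgue_on {a<..<b}" by (rule finite_measure_lebesgue_on) simp
  show "integrable (lebesgue_on {a<..<b}) (\<lambda>s. norm (u s) powr p + 1)"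
    using assms by (auto simp: Lp_def)
  show "AE s in lebesgue_on {a<..<b}. norm (u s) \<le> norm (norm (u s) powr p + 1)"
  proof (rule AE_I2)
    fix s
    have "norm (u s) \<le> norm (u s) powr p" if "1 \<le> norm (u s)"
      using powr_mono[OF \<open>1 \<le> p\<close> that] that by simp
    then show "norm (u s) \<le> norm (norm (u s) powr p + 1)"
      by (cases "1 \<le> norm (u s)") (auto simp: add_nonneg_nonneg intro: order_trans[of _ 1])
  qed
qed (use assms in \<open>auto simp: Lp_def\<close>)

lemma test_funD:
  assumes "test_fun a b \<phi>"
  shows "(\<phi> has_real_derivative deriv \<phi> s) (at s)"
    and "continuous_on UNIV (deriv \<phi>)"
    and "s \<notin> {a<..<b} \<Longrightarrow> \<phi> s = 0"
proof -
  obtain D where D: "\<And>x. (\<phi> has_vector_derivative D x) (at x)" "continuous_on UNIV D"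
    using assms unfolding test_fun_def C1_differentiable_on_def by auto
  then have d: "(\<phi> has_real_derivative D x) (at x)" for x
    by (simp add: has_real_derivative_iff_has_vector_derivative)
  then have "deriv \<phi> = D" by (auto intro: DERIV_imp_deriv)
  then show "(\<phi> has_real_derivative deriv \<phi> s) (at s)" "continuous_on UNIV (deriv \<phi>)"
    using d D by auto
  show "s \<notin> {a<..<b} \<Longrightarrow> \<phi> s = 0"
    using assms unfolding test_fun_def by blast
qed

lemma integrable_lebesgue_on_continuous:
  fixes u :: "real \<Rightarrow> 'a::euclidean_space"
  assumes "continuous_on {a..b} u"
  shows "integrable (lebesgue_on {a<..<b}) u"
proof -
  have "u absolutely_integrable_on {a<..<b}"
    by (rule set_integrable_subset[OF absolutely_integrable_continuous_real[OF assms]]) auto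
  then show ?thesis
    by (simp add: integrable_restrict_space set_integrable_def)
qed

text \<open>Bridge between the Bochner integrals over the open interval, in which costs and weak
  derivatives are stated, and the gauge integrals over closed subintervals, in which increments are
  computed.\<close>

lemma integral_lebesgue_on_indicator:
  fixes v :: "real \<Rightarrow> 'a::euclidean_space"
  assumes v: "integrable (lebesgue_on {a<..<b}) v" and "a \<le> s" "s \<le> r" "r \<le> b"
  shows "(LINT x|lebesgue_on {a<..<b}. indicator {s..r} x *\<^sub>R v x) = integral {s..r} v"
    and "v integrable_on {s..r}"
proof -
  have "v integrable_on {a<..<b}" using integrable_on_lebesgue_on[OF v] by simp
  then have i: "v integrable_on {a..b}" by (simp add: integrable_on_open_interval_real)
  then show "v integrable_on {s..r}"
    by (rule integrable_on_subinterval) (use assms in auto)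
  have "{a<..<b} \<inter> {s..r} \<in> sets (lebesgue_on {a<..<b})"
    by (simp add: sets_restrict_space_iff)
  then have "integrable (lebesgue_on {a<..<b}) (\<lambda>x. indicator ({a<..<b} \<inter> {s..r}) x *\<^sub>R v x)"
    by (rule integrable_mult_indicator[OF _ v])
  then have "integrable (lebesgue_on {a<..<b}) (\<lambda>x. indicator {s..r} x *\<^sub>R v x)"
    by (rule Bochner_Integration.integrable_cong[THEN iffD1, rotated 2]) (auto simp: indicator_def)
  then have "(LINT x|lebesgue_on {a<..<b}. indicator {s..r} x *\<^sub>R v x) =
      integral {a<..<b} (\<lambda>x. indicator {s..r} x *\<^sub>R v x)"
    by (rule lebesgue_integral_eq_integral) auto
  also have "\<dots> = integral {a..b} (\<lambda>x. indicator {s..r} x *\<^sub>R v x)"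
    by (simp add: integral_open_interval_real)
  also have "\<dots> = integral {a..b} (\<lambda>x. if x \<in> {s..r} then v x else 0)"
    by (rule integral_cong) (auto simp: indicator_def)
  also have "\<dots> = integral ({s..r} \<inter> {a..b}) v"
    using integral_restrict_Int[of "{a..b}" "{s..r}" v] by (simp add: Int_commute)
  also have "{s..r} \<inter> {a..b} = {s..r}" using assms by auto
  finally show "(LINT x|lebesgue_on {a<..<b}. indicator {s..r} x *\<^sub>R v x) = integral {s..r} v" .
qed


text \<open>Integration by parts through Fubini on the triangle r \<le> s: integrating the
  derivative of \<open>\<phi>\<close> from r to b leaves \<open>- \<phi> r\<close>, because
  \<open>\<phi>\<close> vanishes at b.\<close>

lemma is_weak_deriv_indefinite_integral:
  fixes u :: "real \<Rightarrow> 'a::euclidean_space"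
  assumes v: "integrable (lebesgue_on {a<..<b}) v"
    and u: "\<And>s. s \<in> {a..b} \<Longrightarrow> u s = c + integral {a..s} v"
  shows "is_weak_deriv a b u v"
proof -
  let ?M = "lebesgue_on {a<..<b}"
  interpret M: finite_measure ?M by (rule finite_measure_lebesgue_on) simp
  interpret MM: pair_sigma_finite ?M ?M ..
  have vi: "v integrable_on {a..b}"
    using integrable_on_lebesgue_on[OF v] by (simp add: integrable_on_open_interval_real)
  have "continuous_on {a..b} (\<lambda>s. c + integral {a..s} v)"
    by (intro continuous_intros indefinite_integral_continuous_1 vi)
  then have uc: "continuous_on {a..b} u"
    by (rule continuous_on_eq) (simp add: u)
  have "(LINT s|?M. deriv \<phi> s *\<^sub>R u s) = - (LINT s|?M. \<phi> s *\<^sub>R v s)" if \<phi>: "test_fun a b \<phi>" for \<phi>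
  proof (cases "a < b")
    case True
    note d = test_funD[OF \<phi>]
    have dc: "continuous_on A (deriv \<phi>)" for A
      using d(2) continuous_on_subset by blast
    have FTC: "(deriv \<phi> has_integral (\<phi> y - \<phi> x)) {x..y}" if "x \<le> y" for x y
      by (rule fundamental_theorem_of_calculus[OF that])
         (use d(1) in \<open>auto simp: has_real_derivative_iff_has_vector_derivative intro: has_vector_derivative_at_within\<close>)
    have di: "integrable ?M (deriv \<phi>)" by (intro integrable_lebesgue_on_continuous dc)
    have dm: "deriv \<phi> \<in> borel_measurable ?M" and vm: "v \<in> borel_measurable ?M"
      using di v by auto
    \<comment> \<open>The integrand on the triangle. Its inner integral over r gives the primitive
      of \<open>v\<close>, and the one over s gives the test function.\<close>
    define f where "f = (\<lambda>s r. (indicator {r..b} s * deriv \<phi> s) *\<^sub>R v r)"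
    have idm: "(\<lambda>x. x) \<in> ?M \<rightarrow>\<^sub>M borel"
      using id_borel_measurable_lebesgue_on[of "{a<..<b}"] by (simp add: id_def)
    have m1: "fst \<in> borel_measurable (?M \<Otimes>\<^sub>M ?M)"
      by (rule measurable_compose[OF measurable_fst idm])
    have m2: "snd \<in> borel_measurable (?M \<Otimes>\<^sub>M ?M)"
      by (rule measurable_compose[OF measurable_snd idm])
    have m3: "(\<lambda>z. deriv \<phi> (fst z)) \<in> borel_measurable (?M \<Otimes>\<^sub>M ?M)"
      by (rule measurable_compose[OF measurable_fst dm])
    have m4: "(\<lambda>z. v (snd z)) \<in> borel_measurable (?M \<Otimes>\<^sub>M ?M)"
      by (rule measurable_compose[OF measurable_snd vm])
    have fm: "case_prod f \<in> borel_measurable (?M \<Otimes>\<^sub>M ?M)"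
    proof -
      have "Measurable.pred (?M \<Otimes>\<^sub>M ?M) (\<lambda>z. snd z \<le> fst z \<and> fst z \<le> b)"
        using m1 m2 by measurable
      then have "(\<lambda>z. ((if snd z \<le> fst z \<and> fst z \<le> b then 1 else 0) * deriv \<phi> (fst z)) *\<^sub>R v (snd z))
          \<in> borel_measurable (?M \<Otimes>\<^sub>M ?M)"
        using m3 m4 by measurable
      then show ?thesis
        by (rule measurable_cong[THEN iffD1, rotated]) (auto simp: f_def indicator_def)
    qed
    have i4: "integrable (?M \<Otimes>\<^sub>M ?M) (\<lambda>z. v (snd z))"
      by (rule MM.Fubini_integrable[OF m4]) (use v in simp_all)
    have "compact (deriv \<phi> ` {a..b})"
      by (intro compact_continuous_image dc) simp
    then obtain B where B: "\<And>s. s \<in> {a..b} \<Longrightarrow> \<bar>deriv \<phi> s\<bar> \<le> B"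
      by (fastforce dest: compact_imp_bounded simp: bounded_real)
    have fi: "integrable (?M \<Otimes>\<^sub>M ?M) (case_prod f)"
    proof (rule Bochner_Integration.integrable_bound[OF _ fm])
      show "integrable (?M \<Otimes>\<^sub>M ?M) (\<lambda>z. B * norm (v (snd z)))"
        using i4 by simp
      have B0: "0 \<le> B" using B[of a] True by auto
      show "AE z in ?M \<Otimes>\<^sub>M ?M. norm (case_prod f z) \<le> norm (B * norm (v (snd z)))"
        by (rule AE_I2) (use B B0 in \<open>auto simp: f_def indicator_def space_pair_measure abs_mult intro!: mult_right_mono\<close>)
    qed
    have f1: "(LINT r|?M. f s r) = deriv \<phi> s *\<^sub>R integral {a..s} v" if s: "s \<in> {a<..<b}" for s
    proof -
      have "(LINT r|?M. f s r) = (LINT r|?M. deriv \<phi> s *\<^sub>R (indicator {a..s} r *\<^sub>R v r))"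
        by (rule Bochner_Integration.integral_cong) (use s in \<open>auto simp: f_def indicator_def\<close>)
      also have "\<dots> = deriv \<phi> s *\<^sub>R integral {a..s} v"
        using integral_lebesgue_on_indicator(1)[OF v, of a s] s by (simp del: scaleR_scaleR)
      finally show ?thesis .
    qed
    have f2: "(LINT s|?M. f s r) = - \<phi> r *\<^sub>R v r" if r: "r \<in> {a<..<b}" for r
    proof -
      have "(LINT s|?M. f s r) = (LINT s|?M. (indicator {r..b} s *\<^sub>R deriv \<phi> s) *\<^sub>R v r)"
        by (simp add: f_def)
      also have "\<dots> = (LINT s|?M. indicator {r..b} s *\<^sub>R deriv \<phi> s) *\<^sub>R v r"
        by (rule Bochner_Integration.integral_scaleR_left)
           (rule integrable_mult_indicator[OF _ di, of "{r..b} \<inter> {a<..<b}", THEN Bochner_Integration.integrable_cong[THEN iffD1, rotated 2]],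
             auto simp: sets_restrict_space_iff indicator_def)
      also have "(LINT s|?M. indicator {r..b} s *\<^sub>R deriv \<phi> s) = integral {r..b} (deriv \<phi>)"
        using integral_lebesgue_on_indicator(1)[OF di, of r b] r by simp
      also have "\<dots> = \<phi> b - \<phi> r" using FTC[of r b] r by (auto intro: integral_unique)
      finally show ?thesis using d(3)[of b] by simp
    qed
    have F: "(LINT s|?M. deriv \<phi> s *\<^sub>R integral {a..s} v) = - (LINT r|?M. \<phi> r *\<^sub>R v r)"
    proof -
      have "(LINT s|?M. deriv \<phi> s *\<^sub>R integral {a..s} v) = (LINT s|?M. LINT r|?M. f s r)"
        by (rule Bochner_Integration.integral_cong) (use f1 in auto)
      also have "\<dots> = (LINT r|?M. LINT s|?M. f s r)"
        using MM.Fubini_integral[OF fi] by simp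
      also have "\<dots> = (LINT r|?M. - (\<phi> r *\<^sub>R v r))"
        by (rule Bochner_Integration.integral_cong) (use f2 in auto)
      finally show ?thesis by simp
    qed
    have ic: "continuous_on {a..b} (\<lambda>s. integral {a..s} v)"
      by (intro indefinite_integral_continuous_1 vi)
    \<comment> \<open>The constant \<open>c\<close> drops out, since the derivative of a test
      function has integral zero.\<close>
    have "(LINT s|?M. deriv \<phi> s *\<^sub>R u s) =
        (LINT s|?M. deriv \<phi> s *\<^sub>R c + deriv \<phi> s *\<^sub>R integral {a..s} v)"
      by (rule Bochner_Integration.integral_cong) (auto simp: u scaleR_add_right)
    also have "\<dots> = (LINT s|?M. deriv \<phi> s *\<^sub>R c) + (LINT s|?M. deriv \<phi> s *\<^sub>R integral {a..s} v)"
      by (rule Bochner_Integration.integral_add)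
         (intro integrable_lebesgue_on_continuous continuous_intros dc ic)+
    also have "(LINT s|?M. deriv \<phi> s *\<^sub>R c) = (LINT s|?M. deriv \<phi> s) *\<^sub>R c"
      using di by simp
    also have "(LINT s|?M. deriv \<phi> s) = integral {a..b} (deriv \<phi>)"
      using lebesgue_integral_eq_integral[OF di] by (simp add: integral_open_interval_real)
    also have "\<dots> = 0"
      using FTC[of a b] True d(3)[of a] d(3)[of b] by (auto intro: integral_unique)
    finally show ?thesis using F by simp
  qed (simp add: not_less)
  then show ?thesis
    using v integrable_lebesgue_on_continuous[OF uc] by (simp add: is_weak_deriv_def Lp_1_iff)
qed


text \<open>The du Bois-Reymond lemma: the difference of u and the primitive w of v has weak
  derivative zero. If it took two different values, a test function whose derivative is a positive
  bump at one point and a negative bump at the other would detect it. So it is constant on the open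
  interval, and by continuity up to the end points.\<close>

lemma is_weak_deriv_imp_indefinite_integral:
  fixes u :: "real \<Rightarrow> 'a::euclidean_space"
  assumes u: "continuous_on {a..b} u" and v: "is_weak_deriv a b u v" and s: "s \<in> {a..b}"
  shows "u s = u a + integral {a..s} v"
proof -
  let ?M = "lebesgue_on {a<..<b}"
  have vi: "integrable ?M v" using v by (simp add: is_weak_deriv_def Lp_1_iff)
  have vi': "v integrable_on {a..b}"
    using integrable_on_lebesgue_on[OF vi] by (simp add: integrable_on_open_interval_real)
  define w where "w = (\<lambda>s. integral {a..s} v)"
  have wc: "continuous_on {a..b} w"
    unfolding w_def by (intro indefinite_integral_continuous_1 vi')
  \<comment> \<open>Any constant vector may be subtracted, because c + w has the same weak
    derivative as w.\<close>
  have z: "(LINT s|?M. deriv \<phi> s *\<^sub>R (u s - w s - c)) = 0" if \<phi>: "test_fun a b \<phi>" for \<phi> c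
  proof -
    have dc: "continuous_on A (deriv \<phi>)" for A
      using test_funD(2)[OF \<phi>] continuous_on_subset by blast
    have "is_weak_deriv a b (\<lambda>s. c + w s) v"
      by (rule is_weak_deriv_indefinite_integral[OF vi, of _ c]) (simp add: w_def)
    then have "(LINT s|?M. deriv \<phi> s *\<^sub>R u s) = (LINT s|?M. deriv \<phi> s *\<^sub>R (c + w s))"
      using v \<phi> by (simp add: is_weak_deriv_def)
    moreover have "(LINT s|?M. deriv \<phi> s *\<^sub>R u s - deriv \<phi> s *\<^sub>R (c + w s)) =
        (LINT s|?M. deriv \<phi> s *\<^sub>R u s) - (LINT s|?M. deriv \<phi> s *\<^sub>R (c + w s))"
      by (rule Bochner_Integration.integral_diff)
         (intro integrable_lebesgue_on_continuous continuous_intros dc wc u)+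
    ultimately show ?thesis by (simp add: algebra_simps)
  qed
  have *: "\<not> (u r1 - w r1) \<bullet> e < (u r2 - w r2) \<bullet> e"
    if r: "r1 \<in> {a<..<b}" "r2 \<in> {a<..<b}" and e: "e \<in> Basis" for r1 r2 e
  proof
    assume less: "(u r1 - w r1) \<bullet> e < (u r2 - w r2) \<bullet> e"
    \<comment> \<open>The midpoint of the two values: subtracting it makes y negative near r1 and
      positive near r2, so that both bumps contribute to the integral with the same sign.\<close>
    define m where "m = ((u r1 - w r1) \<bullet> e + (u r2 - w r2) \<bullet> e) / 2"
    define y where "y = (\<lambda>s. (u s - w s) \<bullet> e - m)"
    have yc: "continuous_on {a..b} y"
      unfolding y_def by (intro continuous_intros u wc)
    have y12: "y r1 < 0" "0 < y r2" using less by (auto simp: y_def m_def field_simps)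
    have yo: "continuous_on {a<..<b} y" by (rule continuous_on_subset[OF yc]) auto
    have "isCont y r1" "isCont y r2"
      using yo r by (simp_all add: continuous_on_eq_continuous_at)
    then have "\<forall>\<^sub>F s in nhds r1. y s < 0" "\<forall>\<^sub>F s in nhds r2. 0 < y s"
      using y12 by (auto simp: continuous_at tendsto_at_iff_tendsto_nhds dest: order_tendstoD)
    then obtain h1 h2 where h12: "h1 > 0" "\<And>s. \<bar>s - r1\<bar> < h1 \<Longrightarrow> y s < 0"
        "h2 > 0" "\<And>s. \<bar>s - r2\<bar> < h2 \<Longrightarrow> 0 < y s"
      unfolding eventually_nhds_metric dist_real_def by blast
    \<comment> \<open>The halves make the distances to a and b strict, so that the supports of both
      bumps are compact in the open interval.\<close>
    define h where "h = Min {h1, h2, (r1 - a) / 2, (b - r1) / 2, (r2 - a) / 2, (b - r2) / 2}"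
    have h0: "0 < h" using r h12 by (simp add: h_def)
    have hle: "h \<le> h1" "h \<le> h2" "h < r1 - a" "h < b - r1" "h < r2 - a" "h < b - r2"
    proof -
      have "h \<le> x" if "x \<in> {h1, h2, (r1 - a) / 2, (b - r1) / 2, (r2 - a) / 2, (b - r2) / 2}" for x
        unfolding h_def by (rule Min_le) (use that in auto)
      from this[of h1] this[of h2] this[of "(r1 - a) / 2"] this[of "(b - r1) / 2"]
        this[of "(r2 - a) / 2"] this[of "(b - r2) / 2"]
      show "h \<le> h1" "h \<le> h2" "h < r1 - a" "h < b - r1" "h < r2 - a" "h < b - r2"
        using r by simp_all
    qed
    \<comment> \<open>\<open>k\<close> below is the hat function with support [-h, h] and height h,
      written by positive parts; H is its primitive, equal to 0 left of -h and to
      \<open>h\<^sup>2\<close> right of h. Test functions need only be continuously differentiable,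
      so a piecewise quadratic one will do.\<close>
    define H where "H = (\<lambda>s::real. ((max 0 (s + h))\<^sup>2 - 2 * (max 0 s)\<^sup>2 + (max 0 (s - h))\<^sup>2) / 2)"
    define k where "k = (\<lambda>s::real. max 0 (s + h) - 2 * max 0 s + max 0 (s - h))"
    have sq: "((\<lambda>s. (max 0 (s + c))\<^sup>2) has_real_derivative 2 * max 0 (s + c)) (at s)" for s c :: real
    proof -
      have "((\<lambda>x. (max 0 x)\<^sup>2) has_real_derivative 2 * max 0 x) (at x)" for x :: real
      proof (cases "x = 0")
        case True
        have "((\<lambda>h. (max 0 h)\<^sup>2 / h) \<longlongrightarrow> 0) (at (0::real))"
          by (rule Lim_null_comparison[of _ "\<lambda>h. \<bar>h\<bar>"])
             (auto intro!: eventuallyI tendsto_eq_intros simp: max_def power2_eq_square)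
        then show ?thesis using True by (simp add: DERIV_def)
      next
        case False
        then consider "x > 0" | "x < 0" by linarith
        then show ?thesis
        proof cases
          case 1
          have "((\<lambda>x. x\<^sup>2) has_real_derivative 2 * max 0 x) (at x)"
            using 1 by (auto intro!: derivative_eq_intros)
          moreover have "\<forall>\<^sub>F s in nhds x. s \<in> {0<..}"
            using 1 by (intro eventually_nhds_in_open) auto
          ultimately show ?thesis
            by (subst DERIV_cong_ev[OF refl _ refl, of _ "\<lambda>x. x\<^sup>2"]) (auto elim!: eventually_mono)
        next
          case 2
          have "((\<lambda>x. 0) has_real_derivative 2 * max 0 x) (at x)"
            using 2 by (auto intro!: derivative_eq_intros)
          moreover have "\<forall>\<^sub>F s in nhds x. s \<in> {..<0}"
            using 2 by (intro eventually_nhds_in_open) auto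
          ultimately show ?thesis
            by (subst DERIV_cong_ev[OF refl _ refl, of _ "\<lambda>x. 0"]) (auto elim!: eventually_mono)
        qed
      qed
      moreover have "((\<lambda>s. s + c) has_real_derivative 1) (at s)"
        by (auto intro!: derivative_eq_intros)
      ultimately show ?thesis using DERIV_chain2 by fastforce
    qed
    have H: "(H has_real_derivative k s) (at s)" for s
      unfolding H_def k_def
      using DERIV_cdivide[OF DERIV_add[OF DERIV_diff[OF sq[of h s] DERIV_cmult[OF sq[of 0 s]]] sq[of "-h" s]], of 2 2]
      by (simp add: add_divide_distrib diff_divide_distrib)
    have k0: "k s = 0" if "h \<le> \<bar>s\<bar>" for s
      using that h0 by (auto simp: k_def max_def abs_if split: if_splits)
    have k1: "0 \<le> k s" for s
      using h0 by (auto simp: k_def max_def)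
    have H0: "H s = 0" if "s \<le> - h" for s
      using that h0 by (auto simp: H_def max_def)
    have H1: "H s = h\<^sup>2" if "h \<le> s" for s
      using that h0 by (auto simp: H_def max_def power2_eq_square algebra_simps)
    \<comment> \<open>Both shifted primitives reach the same value \<open>h\<^sup>2\<close>, so
      their difference has compact support.\<close>
    define \<phi> where "\<phi> = (\<lambda>s. H (s - r1) - H (s - r2))"
    have d\<phi>: "(\<phi> has_real_derivative k (s - r1) - k (s - r2)) (at s)" for s
    proof -
      have "((\<lambda>s. H (s - r)) has_real_derivative k (s - r)) (at s)" for r
        using DERIV_chain2[OF H DERIV_diff[OF DERIV_ident DERIV_const]] by simp
      then show ?thesis unfolding \<phi>_def by (intro DERIV_diff)
    qed
    then have d\<phi>': "deriv \<phi> s = k (s - r1) - k (s - r2)" for s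
      by (rule DERIV_imp_deriv)
    have kc: "continuous_on A (\<lambda>s. k (s - r1) - k (s - r2))" for A
      unfolding k_def by (intro continuous_intros)
    have "test_fun a b \<phi>"
      unfolding test_fun_def
    proof
      show "\<phi> C1_differentiable_on UNIV"
        unfolding C1_differentiable_on_def
        using d\<phi> kc
        by (intro exI[of _ "\<lambda>s. k (s - r1) - k (s - r2)"])
           (auto simp: has_real_derivative_iff_has_vector_derivative)
      have "\<phi> s = 0" if "s \<notin> {min r1 r2 - h..max r1 r2 + h}" for s
        using that H0[of "s - r1"] H0[of "s - r2"] H1[of "s - r1"] H1[of "s - r2"]
        by (auto simp: \<phi>_def not_le)
      moreover have "{min r1 r2 - h..max r1 r2 + h} \<subseteq> {a<..<b}"
        using hle by auto
      ultimately show "\<exists>K. compact K \<and> K \<subseteq> {a<..<b} \<and> (\<forall>s. s \<notin> K \<longrightarrow> \<phi> s = 0)"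
        by blast
    qed
    from z[OF this, of "m *\<^sub>R e"]
    have "(LINT s|?M. deriv \<phi> s *\<^sub>R (u s - w s - m *\<^sub>R e)) \<bullet> e = 0" by simp
    moreover have "(LINT s|?M. deriv \<phi> s *\<^sub>R (u s - w s - m *\<^sub>R e)) \<bullet> e =
        (LINT s|?M. (deriv \<phi> s *\<^sub>R (u s - w s - m *\<^sub>R e)) \<bullet> e)"
      by (rule integral_inner_left[symmetric])
         (unfold d\<phi>', intro integrable_lebesgue_on_continuous continuous_intros kc wc u)
    moreover have "(deriv \<phi> s *\<^sub>R (u s - w s - m *\<^sub>R e)) \<bullet> e = (k (s - r1) - k (s - r2)) * y s" for s
      using e by (simp add: d\<phi>' y_def inner_diff_left algebra_simps)
    ultimately have "(LINT s|?M. (k (s - r1) - k (s - r2)) * y s) = 0" by simp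
    moreover have "(LINT s|?M. (k (s - r1) - k (s - r2)) * y s) = integral {a..b} (\<lambda>s. (k (s - r1) - k (s - r2)) * y s)"
      by (subst lebesgue_integral_eq_integral)
         (auto simp: integral_open_interval_real intro!: integrable_lebesgue_on_continuous continuous_intros kc yc)
    ultimately have "integral {a..b} (\<lambda>s. - ((k (s - r1) - k (s - r2)) * y s)) = 0" by simp
    moreover have sg: "k (s - r1) * y s \<le> 0" "0 \<le> k (s - r2) * y s" for s
    proof -
      show "k (s - r1) * y s \<le> 0"
        using k0[of "s - r1"] k1[of "s - r1"] h12(2)[of s] hle(1)
        by (cases "h \<le> \<bar>s - r1\<bar>") (auto intro: mult_nonneg_nonpos)
      show "0 \<le> k (s - r2) * y s"
        using k0[of "s - r2"] k1[of "s - r2"] h12(4)[of s] hle(2)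
        by (cases "h \<le> \<bar>s - r2\<bar>") auto
    qed
    \<comment> \<open>A continuous nonnegative integrand with zero integral vanishes everywhere; at
      r1, the peak of the first hat, this is impossible.\<close>
    ultimately have "\<forall>s\<in>{a..b}. - ((k (s - r1) - k (s - r2)) * y s) = 0"
    proof (subst (asm) integral_eq_0_iff)
      show "continuous_on {a..b} (\<lambda>s. - ((k (s - r1) - k (s - r2)) * y s))"
        by (intro continuous_on_minus continuous_on_mult kc yc)
      show "0 \<le> - ((k (s - r1) - k (s - r2)) * y s)" for s
        using sg[of s] by (simp add: left_diff_distrib)
    qed (use r in auto)
    then have "(k 0 - k (r1 - r2)) * y r1 = 0" using r by force
    moreover have "k 0 * y r1 < 0"
      using h0 y12 by (auto simp: k_def mult_less_0_iff)
    ultimately show False using sg(2)[of r1] by (simp only: left_diff_distrib)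
  qed
  have eq: "u r1 - w r1 = u r2 - w r2" if r: "r1 \<in> {a<..<b}" "r2 \<in> {a<..<b}" for r1 r2
    by (rule euclidean_eqI) (use *[OF r] *[OF r(2,1)] in \<open>force simp: not_less\<close>)
  show ?thesis
  proof (cases "a < b")
    case True
    define c where "c = u ((a + b) / 2) - w ((a + b) / 2)"
    have "u s - w s = c" if "s \<in> {a..b}" for s
    proof (rule continuous_constant_on_closure[of "{a<..<b}"])
      show "continuous_on (closure {a<..<b}) (\<lambda>s. u s - w s)"
        using True by (auto intro!: continuous_intros u wc)
      show "u x - w x = c" if "x \<in> {a<..<b}" for x
        unfolding c_def by (rule eq) (use True that in auto)
      show "s \<in> closure {a<..<b}" using True that by simp
    qed
    from this[OF s] this[of a] show ?thesis using True by (simp add: w_def algebra_simps)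
  next
    case False
    then have "s = a" using s by auto
    then show ?thesis by simp
  qed
qed

text \<open>The integrals agree on every subinterval, so the nonnegativity criterion applies to each
  coordinate of the difference with both signs.\<close>

lemma AE_eq_of_integrals:
  fixes f g :: "real \<Rightarrow> 'a::euclidean_space"
  assumes f: "integrable (lebesgue_on {a<..<b}) f" and g: "integrable (lebesgue_on {a<..<b}) g"
    and eq: "\<And>s. s \<in> {a..b} \<Longrightarrow> integral {a..s} f = integral {a..s} g"
  shows "AE s in lebesgue_on {a<..<b}. f s = g s"
proof -
  have *: "AE s in lebesgue_on {a<..<b}. 0 \<le> (f s - g s) \<bullet> e" for e
  proof (rule AE_nonneg_of_integrals)
    show "integrable (lebesgue_on {a<..<b}) (\<lambda>s. (f s - g s) \<bullet> e)"
      using f g by (intro integrable_inner_left Bochner_Integration.integrable_diff)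
    fix s r assume sr: "a \<le> s" "s \<le> r" "r \<le> b"
    note ii = integral_lebesgue_on_indicator(2)[OF f] integral_lebesgue_on_indicator(2)[OF g]
    have "integral {s..r} h = integral {a..r} h - integral {a..s} h"
      if "h integrable_on {a..r}" for h :: "real \<Rightarrow> 'a"
      using Henstock_Kurzweil_Integration.integral_combine[OF sr(1,2) that] by (simp add: algebra_simps)
    then have "integral {s..r} f = integral {s..r} g"
      using sr eq[of s] eq[of r] by (simp add: ii)
    then have "integral {s..r} (\<lambda>s. f s - g s) = 0"
      using sr by (simp add: ii Henstock_Kurzweil_Integration.integral_diff)
    then have "((\<lambda>s. f s - g s) has_integral 0) {s..r}"
      using sr ii by (metis integrable_diff integrable_integral)
    from has_integral_linear[OF this bounded_linear_inner_left[of e]]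
    have "((\<lambda>s. (f s - g s) \<bullet> e) has_integral 0) {s..r}"
      by (simp add: o_def)
    then show "0 \<le> integral {s..r} (\<lambda>s. (f s - g s) \<bullet> e)" by (simp add: integral_unique)
  qed
  have "AE s in lebesgue_on {a<..<b}. \<forall>e\<in>Basis. 0 \<le> (f s - g s) \<bullet> e \<and> 0 \<le> (f s - g s) \<bullet> (- e)"
    by (intro AE_finite_allI finite_Basis AE_conjI *)
  then show ?thesis
    by eventually_elim (auto intro!: euclidean_eqI[of "f _"] simp: inner_diff_left)
qed

text \<open>\<open>weak_deriv\<close> is an arbitrary choice, so it can be identified with v only
  almost everywhere. The choice is legitimate because v is a witness, and any two witnesses have the
  same primitive.\<close>

lemma weak_deriv_indefinite_integral:
  fixes u :: "real \<Rightarrow> 'a::euclidean_space"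
  assumes v: "integrable (lebesgue_on {a<..<b}) v"
    and u: "\<And>s. s \<in> {a..b} \<Longrightarrow> u s = u a + integral {a..s} v"
  shows "integrable (lebesgue_on {a<..<b}) (weak_deriv a b u)"
    and "AE s in lebesgue_on {a<..<b}. weak_deriv a b u s = v s"
    and "s \<in> {a..b} \<Longrightarrow> u s = u a + integral {a..s} (weak_deriv a b u)"
proof -
  have "v integrable_on {a..b}"
    using integrable_on_lebesgue_on[OF v] by (simp add: integrable_on_open_interval_real)
  then have "continuous_on {a..b} (\<lambda>s. u a + integral {a..s} v)"
    by (intro continuous_intros indefinite_integral_continuous_1)
  then have uc: "continuous_on {a..b} u"
    by (rule continuous_on_eq) (simp add: u[symmetric])
  have "is_weak_deriv a b u v"
    by (rule is_weak_deriv_indefinite_integral[OF v u])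
  then have w: "is_weak_deriv a b u (weak_deriv a b u)"
    unfolding weak_deriv_def by (rule someI[of "is_weak_deriv a b u"])
  then show wi: "integrable (lebesgue_on {a<..<b}) (weak_deriv a b u)"
    by (simp add: is_weak_deriv_def Lp_1_iff)
  show wu: "u s = u a + integral {a..s} (weak_deriv a b u)" if "s \<in> {a..b}" for s
    by (rule is_weak_deriv_imp_indefinite_integral[OF uc w that])
  show "AE s in lebesgue_on {a<..<b}. weak_deriv a b u s = v s"
  proof (rule AE_eq_of_integrals[OF wi v])
    fix s assume s: "s \<in> {a..b}"
    then show "integral {a..s} (weak_deriv a b u) = integral {a..s} v"
      using u[OF s] wu[OF s] by (metis add_left_cancel)
  qed
qed

lemma W1p_imp_indefinite_integral:
  assumes "continuous_on {a..b} u" "u \<in> W1p p a b"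
  obtains v where "v \<in> Lp p a b" "\<And>s. s \<in> {a..b} \<Longrightarrow> u s = u a + integral {a..s} v"
  using assms is_weak_deriv_imp_indefinite_integral unfolding W1p_def by blast

lemma continuous_on_imp_Lp:
  fixes u :: "real \<Rightarrow> 'a::euclidean_space"
  assumes u: "continuous_on {a..b} u" and "0 < p"
  shows "u \<in> Lp p a b"
  unfolding Lp_def
proof (intro CollectI conjI)
  show "u \<in> borel_measurable (lebesgue_on {a<..<b})"
    using integrable_lebesgue_on_continuous[OF u] by simp
  have "continuous_on {a..b} (\<lambda>s. norm (u s) powr p)"
    by (intro continuous_on_powr' continuous_intros u) (use \<open>0 < p\<close> in auto)
  then show "integrable (lebesgue_on {a<..<b}) (\<lambda>s. norm (u s) powr p)"
    by (rule integrable_lebesgue_on_continuous)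
qed

lemma indefinite_integral_in_W1p:
  fixes u :: "real \<Rightarrow> 'a::euclidean_space"
  assumes v: "v \<in> Lp p a b" and p: "1 \<le> p"
    and u: "\<And>s. s \<in> {a..b} \<Longrightarrow> u s = u a + integral {a..s} v"
  shows "u \<in> W1p p a b" "continuous_on {a..b} u"
proof -
  note vi = Lp_imp_integrable[OF v p]
  have "v integrable_on {a..b}"
    using integrable_on_lebesgue_on[OF vi] by (simp add: integrable_on_open_interval_real)
  then have "continuous_on {a..b} (\<lambda>s. u a + integral {a..s} v)"
    by (intro continuous_intros indefinite_integral_continuous_1)
  then show uc: "continuous_on {a..b} u"
    by (rule continuous_on_eq) (simp add: u[symmetric])
  have "is_weak_deriv a b u v"
    by (rule is_weak_deriv_indefinite_integral[OF vi u])
  then show "u \<in> W1p p a b"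
    using v continuous_on_imp_Lp[OF uc, of p] p by (auto simp: W1p_def)
qed

section \<open>Comparison of integrals and measures on subintervals\<close>

lemma Lp_cong_AE:
  assumes "v \<in> Lp p a b" "w \<in> borel_measurable (lebesgue_on {a<..<b})"
    "AE s in lebesgue_on {a<..<b}. w s = v s"
  shows "w \<in> Lp p a b"
proof -
  have "integrable (lebesgue_on {a<..<b}) (\<lambda>s. norm (w s) powr p) \<longleftrightarrow>
      integrable (lebesgue_on {a<..<b}) (\<lambda>s. norm (v s) powr p)"
    by (rule integrable_cong_AE) (use assms in \<open>auto simp: Lp_def elim: eventually_mono\<close>)
  then show ?thesis using assms by (auto simp: Lp_def)
qed

text \<open>The additive constant d is harmless because the interval is bounded; this covers
  velocities changed by a bounded perturbation.\<close>

lemma Lp_norm_bound: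
  fixes v :: "real \<Rightarrow> 'a::euclidean_space" and w :: "real \<Rightarrow> 'b::euclidean_space"
  assumes v: "v \<in> Lp p a b" and w: "w \<in> borel_measurable (lebesgue_on {a<..<b})" and "0 \<le> p"
    and le: "\<And>s. s \<in> {a<..<b} \<Longrightarrow> norm (w s) \<le> c * (norm (v s) + d)" and c: "0 \<le> c" and d: "0 \<le> d"
  shows "w \<in> Lp p a b"
proof -
  interpret finite_measure "lebesgue_on {a<..<b}" by (rule finite_measure_lebesgue_on) simp
  have [measurable]: "w \<in> borel_measurable (lebesgue_on {a<..<b})" by (rule w)
  have "integrable (lebesgue_on {a<..<b}) (\<lambda>s. norm (w s) powr p)"
  proof (rule Bochner_Integration.integrable_bound)
    show "integrable (lebesgue_on {a<..<b}) (\<lambda>s. c powr p * (2 powr p * (norm (v s) powr p + d powr p)))"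
      using v by (auto simp: Lp_def)
    show "(\<lambda>s. norm (w s) powr p) \<in> borel_measurable (lebesgue_on {a<..<b})" by measurable
    show "AE s in lebesgue_on {a<..<b}. norm (norm (w s) powr p) \<le>
        norm (c powr p * (2 powr p * (norm (v s) powr p + d powr p)))"
    proof (rule AE_I2)
      fix s assume "s \<in> space (lebesgue_on {a<..<b})"
      then have "norm (w s) powr p \<le> (c * (norm (v s) + d)) powr p"
        using le[of s] \<open>0 \<le> p\<close> by (intro powr_mono2) auto
      also have "\<dots> = c powr p * (norm (v s) + d) powr p" using c d by (simp add: powr_mult)
      also have "\<dots> \<le> c powr p * (2 powr p * (norm (v s) powr p + d powr p))"
        using \<open>0 \<le> p\<close> d by (intro mult_left_mono powr_add_le) auto
      finally show "norm (norm (w s) powr p) \<le> norm (c powr p * (2 powr p * (norm (v s) powr p + d powr p)))"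
        by simp
    qed
  qed
  then show ?thesis using w by (simp add: Lp_def)
qed

text \<open>The bound is asked for in the open interval only, since momentum and speed are
  controlled inside a component; the two end points form a null set.\<close>

lemma integral_le_of_AE_le:
  fixes f :: "real \<Rightarrow> real"
  assumes f: "integrable (lebesgue_on {t<..<T}) f" and ab: "t \<le> a" "a \<le> b" "b \<le> T"
    and le: "AE s in lebesgue_on {t<..<T}. s \<in> {a<..<b} \<longrightarrow> f s \<le> c"
  shows "integral {a..b} f \<le> c * (b - a)"
proof -
  let ?M = "lebesgue_on {t<..<T}"
  interpret finite_measure ?M by (rule finite_measure_lebesgue_on) simp
  have S: "{a..b} \<inter> {t<..<T} \<in> sets ?M" by (simp add: sets_restrict_space_iff)
  have i: "integrable ?M (\<lambda>s. indicator {a..b} s *\<^sub>R h s)" if "integrable ?M h" for h :: "real \<Rightarrow> real"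
    using integrable_mult_indicator[OF S that]
    by (rule Bochner_Integration.integrable_cong[THEN iffD1, rotated 2]) (auto simp: indicator_def)
  have N: "{a, b} \<in> null_sets lebesgue"
    by (simp add: negligible_iff_null_sets[symmetric])
  have "AE s in lebesgue. s \<notin> {a, b}" by (rule AE_not_in[OF N])
  then have ne: "AE s in ?M. s \<notin> {a, b}"
    by (auto simp: AE_restrict_space_iff elim: eventually_mono)
  have "(LINT s|?M. indicator {a..b} s *\<^sub>R f s) \<le> (LINT s|?M. indicator {a..b} s *\<^sub>R c)"
  proof (rule integral_mono_AE)
    show "AE s in ?M. indicator {a..b} s *\<^sub>R f s \<le> indicator {a..b} s *\<^sub>R c"
      using le ne by eventually_elim (auto simp: indicator_def)
  qed (intro i f integrable_const)+
  then show ?thesis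
    using integral_lebesgue_on_indicator(1)[OF f ab] integral_lebesgue_on_indicator(1)[of t T "\<lambda>s. c" a b, OF _ ab] ab
    by (auto simp: mult.commute)
qed

text \<open>Continuity of the measure from below. It moves a set of positive measure from an open
  component into an interval that keeps away from the end points, where variations are
  admissible.\<close>

lemma measure_Int_shrinking_interval_pos:
  assumes S: "S \<in> sets (lebesgue_on {t<..<T})" and sub: "S \<subseteq> {a<..<b}"
    and pos: "0 < measure (lebesgue_on {t<..<T}) S"
  shows "\<forall>\<^sub>F n in sequentially. 0 < measure (lebesgue_on {t<..<T}) (S \<inter> {a + 1 / (real n + 1)<..<b - 1 / (real n + 1)})"
proof -
  let ?M = "lebesgue_on {t<..<T}"
  interpret finite_measure ?M by (rule finite_measure_lebesgue_on) simp
  let ?I = "\<lambda>n. {a + 1 / (real n + 1)<..<b - 1 / (real n + 1)}"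
  have I: "S \<inter> ?I n \<in> sets ?M" for n
  proof -
    have "S \<inter> ({t<..<T} \<inter> ?I n) \<in> sets ?M" by (rule sets.Int[OF S]) (auto simp: sets_restrict_space_iff)
    moreover have "S \<subseteq> {t<..<T}" using sets.sets_into_space[OF S] by simp
    moreover have "S \<inter> ({t<..<T} \<inter> ?I n) = S \<inter> ?I n" using calculation(2) by auto
    ultimately show ?thesis by metis
  qed
  have inc: "incseq (\<lambda>n. S \<inter> ?I n)"
  proof (rule incseq_SucI)
    fix n
    have "1 / (real (Suc n) + 1) \<le> 1 / (real n + 1)" by (intro divide_left_mono) auto
    then show "S \<inter> ?I n \<subseteq> S \<inter> ?I (Suc n)" by auto
  qed
  have U: "(\<Union>n. S \<inter> ?I n) = S"
  proof (intro equalityI subsetI)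
    fix s assume s: "s \<in> S"
    then have "0 < min (s - a) (b - s)" using sub by auto
    then obtain n where "inverse (real (Suc n)) < min (s - a) (b - s)" using reals_Archimedean by blast
    then have "s \<in> ?I n" by (auto simp: inverse_eq_divide algebra_simps)
    then show "s \<in> (\<Union>n. S \<inter> ?I n)" using s by auto
  qed auto
  have "(\<lambda>n. measure ?M (S \<inter> ?I n)) \<longlonglongrightarrow> measure ?M (\<Union>n. S \<inter> ?I n)"
    by (rule finite_Lim_measure_incseq) (use I inc in auto)
  then show ?thesis using pos unfolding U by (rule order_tendstoD(1))
qed

section \<open>The junction\<close>

lemma edge_eq: "x \<in> edge i \<Longrightarrow> x = norm x *\<^sub>R axis i 1"
  by (auto simp: edge_def)

lemma edge_subset_junction: "edge i \<subseteq> junction"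
  by (auto simp: junction_def)

lemma scaleR_axis_in_edge: "0 \<le> r \<Longrightarrow> r *\<^sub>R axis i 1 \<in> edge i"
  by (auto simp: edge_def)

lemma junction_cases:
  assumes "x \<in> junction"
  obtains "x = 0" | i where "x \<in> edge i - {0}"
  using assms by (auto simp: junction_def)

lemma edge_nth: "x \<in> edge i \<Longrightarrow> x $ j = (if j = i then norm x else 0)"
  by (subst edge_eq[of x i]) (auto simp: axis_def)

lemma edge_unique: "x \<in> edge i - {0} \<Longrightarrow> x \<in> edge j - {0} \<Longrightarrow> i = j"
  using edge_nth[of x i j] edge_nth[of x j j] by (auto split: if_splits)

lemma closed_edge: "closed (edge i :: (real ^ 'n::finite) set)"
proof -
  have "edge i = {x :: real ^ 'n. x = norm x *\<^sub>R axis i 1}"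
    using edge_eq scaleR_axis_in_edge by (metis (mono_tags, lifting) Collect_cong Collect_mem_eq norm_ge_zero)
  also have "closed \<dots>" by (intro closed_Collect_eq continuous_intros)
  finally show ?thesis .
qed

lemma edge_Diff_0_borel: "edge i - {0 :: real ^ 'n::finite} \<in> sets borel"
  using closed_edge[of i] by auto

lemma norm_junction_eq_inner:
  fixes x :: "real ^ 'n::finite"
  assumes "x \<in> junction"
  shows "norm x = x \<bullet> (\<Sum>i\<in>UNIV. axis i 1)"
proof -
  obtain i where i: "x \<in> edge i" using assms by (auto simp: junction_def)
  have "x \<bullet> (\<Sum>j\<in>UNIV. axis j 1) = (\<Sum>j\<in>UNIV. x $ j)"
    by (simp add: inner_sum_right inner_axis)
  also have "\<dots> = norm x" using edge_nth[OF i] by simp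
  finally show ?thesis by simp
qed

lemma
  assumes "x \<in> edge i - {0}"
  shows running_cost_edge: "running_cost l lstar x v \<tau> = l i (norm x) v \<tau>"
    and terminal_cost_edge: "terminal_cost g gstar x = g i (norm x)"
proof -
  have *: "f j * indicator (edge j - {0}) x = (if j = i then f j else 0)" for j and f :: "'a \<Rightarrow> real"
  proof (cases "j = i")
    case True
    then show ?thesis using assms by (simp only: indicator_simps) simp
  next
    case False
    then have "x \<notin> edge j - {0}" using edge_unique[OF assms, of j] by auto
    then show ?thesis using False by (simp only: indicator_simps) simp
  qed
  have **: "(\<Sum>j\<in>UNIV. f j * indicator (edge j - {0}) x) = f i" for f :: "'a \<Rightarrow> real"
    unfolding * by simp
  have 0: "indicator {0} x = (0::real)" using assms by simp
  show "running_cost l lstar x v \<tau> = l i (norm x) v \<tau>"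
    unfolding running_cost_def ** 0 by simp
  show "terminal_cost g gstar x = g i (norm x)"
    unfolding terminal_cost_def ** 0 by simp
qed

lemma running_cost_0: "running_cost l lstar 0 v \<tau> = vertex_cost l lstar \<tau>"
  by (simp add: running_cost_def)

text \<open>Off the vertex the continuous function \<open>2 * y s $ i - norm (y s)\<close> equals
  |y| on edge i and -|y| on the others. It has no zero there, so by the intermediate value theorem
  it keeps its sign.\<close>

lemma same_edge_on_interval:
  fixes y :: "real \<Rightarrow> real ^ 'n::finite"
  assumes y: "continuous_on {\<alpha>..\<beta>} y" and J: "\<And>s. s \<in> {\<alpha>..\<beta>} \<Longrightarrow> y s \<in> junction"
    and nz: "\<And>s. s \<in> {\<alpha>..\<beta>} \<Longrightarrow> y s \<noteq> 0" and "\<alpha> \<le> \<beta>"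
  obtains i where "\<And>s. s \<in> {\<alpha>..\<beta>} \<Longrightarrow> y s \<in> edge i - {0}"
proof -
  obtain i where i: "y \<alpha> \<in> edge i - {0}"
    using junction_cases[OF J[of \<alpha>]] nz[of \<alpha>] \<open>\<alpha> \<le> \<beta>\<close> by auto
  have dich: "y s \<in> edge i - {0} \<and> y s $ i = norm (y s) \<or> y s $ i = 0" if s: "s \<in> {\<alpha>..\<beta>}" for s
  proof -
    obtain j where "y s \<in> edge j - {0}" using junction_cases[OF J[OF s]] nz[OF s] by auto
    then show ?thesis using edge_nth[of "y s" j i] by (cases "i = j") auto
  qed
  have "y s \<in> edge i - {0}" if s: "s \<in> {\<alpha>..\<beta>}" for s
  proof (rule ccontr)
    assume "y s \<notin> edge i - {0}"
    then have "y s $ i = 0" using dich[OF s] by auto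
    then have "2 * y s $ i - norm (y s) \<le> 0" by simp
    moreover have "0 \<le> 2 * y \<alpha> $ i - norm (y \<alpha>)" using edge_nth[of "y \<alpha>" i i] i by simp
    moreover have "continuous_on {\<alpha>..s} (\<lambda>s. 2 * y s $ i - norm (y s))"
      by (intro continuous_intros continuous_on_subset[OF y]) (use s in auto)
    ultimately obtain r where r: "\<alpha> \<le> r" "r \<le> s" "2 * y r $ i - norm (y r) = 0"
      using IVT2'[of "\<lambda>s. 2 * y s $ i - norm (y s)" s 0 \<alpha>] s by auto
    then show False using dich[of r] nz[of r] s by auto
  qed
  then show ?thesis by (rule that)
qed

lemma norm_diff_edge:
  assumes "x \<in> edge i" "y \<in> edge i"
  shows "norm (x - y) = \<bar>norm x - norm y\<bar>"
proof -
  have "x - y = (norm x - norm y) *\<^sub>R axis i 1"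
    using edge_eq[OF assms(1)] edge_eq[OF assms(2)] by (metis scaleR_diff_left)
  then show ?thesis by simp
qed

text \<open>If the path meets the vertex, the triangle inequality through that point adds two radial
  increments over adjacent intervals; otherwise it stays in one edge, where distances are
  radial.\<close>

lemma norm_diff_junction_le:
  fixes y :: "real \<Rightarrow> real ^ 'n::finite"
  assumes y: "continuous_on {a..b} y" and J: "\<And>s. s \<in> {a..b} \<Longrightarrow> y s \<in> junction"
    and V: "\<And>s r. a \<le> s \<Longrightarrow> s \<le> r \<Longrightarrow> r \<le> b \<Longrightarrow> \<bar>norm (y r) - norm (y s)\<bar> \<le> V * (r - s)"
    and sr: "a \<le> s" "s \<le> r" "r \<le> b"
  shows "norm (y r - y s) \<le> V * (r - s)"
proof (cases "\<exists>x\<in>{s..r}. y x = 0")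
  case True
  then obtain x where x: "s \<le> x" "x \<le> r" "y x = 0" by auto
  have "norm (y r - y s) \<le> norm (y r) + norm (y s)" by (rule norm_triangle_ineq4)
  also have "\<dots> \<le> V * (r - x) + V * (x - s)"
    using V[of x r] V[of s x] x sr by (intro add_mono) auto
  finally show ?thesis by (simp add: algebra_simps)
next
  case False
  obtain i where "\<And>x. x \<in> {s..r} \<Longrightarrow> y x \<in> edge i - {0}"
    by (rule same_edge_on_interval[of s r y])
      (use False sr J in \<open>auto intro: continuous_on_subset[OF y]\<close>)
  then show ?thesis using norm_diff_edge[of "y r" i "y s"] V[of s r] sr by auto
qed

section \<open>Zeros and positivity intervals of a nonnegative function\<close>

lemma compact_zero_set:
  fixes u :: "real \<Rightarrow> real"
  assumes "continuous_on {a..b} u"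
  shows "compact {x \<in> {a..b}. u x = 0}"
proof -
  have "closed {x \<in> {a..b}. u x = 0}"
    by (rule continuous_closed_preimage_constant[OF assms]) simp
  moreover have "bounded {x \<in> {a..b}. u x = 0}"
    by (rule bounded_subset[of "{a..b}"]) auto
  ultimately show ?thesis by (simp add: compact_eq_bounded_closed)
qed

text \<open>If u has zeros in [s, r], the hypothesis up to the first zero bounds u s, and from the
  last zero on it bounds u r. Since u is nonnegative, the difference is at most the larger of the
  two values, so the constant V is not doubled.\<close>

lemma lipschitz_from_positive_parts:
  fixes u :: "real \<Rightarrow> real"
  assumes u: "continuous_on {a..b} u" and nn: "\<And>s. s \<in> {a..b} \<Longrightarrow> 0 \<le> u s" and V: "0 \<le> V"
    and *: "\<And>s r. a \<le> s \<Longrightarrow> s < r \<Longrightarrow> r \<le> b \<Longrightarrow> (\<And>x. x \<in> {s<..<r} \<Longrightarrow> 0 < u x) \<Longrightarrow> \<bar>u r - u s\<bar> \<le> V * (r - s)"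
    and sr: "a \<le> s" "s \<le> r" "r \<le> b"
  shows "\<bar>u r - u s\<bar> \<le> V * (r - s)"
proof (cases "\<exists>x\<in>{s..r}. u x = 0")
  case True
  define Z where "Z = {x \<in> {s..r}. u x = 0}"
  have Z: "compact Z" "Z \<noteq> {}"
    using True compact_zero_set[OF continuous_on_subset[OF u, of "{s..r}"]] sr by (auto simp: Z_def)
  obtain p where p: "p \<in> Z" "\<And>x. x \<in> Z \<Longrightarrow> p \<le> x" using compact_attains_inf[OF Z] by auto
  obtain q where q: "q \<in> Z" "\<And>x. x \<in> Z \<Longrightarrow> x \<le> q" using compact_attains_sup[OF Z] by auto
  have pos: "0 < u x" if "x \<in> {s..r}" "x \<notin> Z" for x
    using that nn[of x] sr by (cases "u x = 0") (auto simp: Z_def less_le)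
  have "u s \<le> V * (p - s)"
  proof (cases "s < p")
    case True
    have "\<bar>u p - u s\<bar> \<le> V * (p - s)"
    proof (rule *)
      fix x assume "x \<in> {s<..<p}"
      then have "x \<in> {s..r}" "x \<notin> Z" using p(1) p(2)[of x] by (auto simp: Z_def)
      then show "0 < u x" by (rule pos)
    qed (use p sr True in \<open>auto simp: Z_def\<close>)
    then show ?thesis using p by (auto simp: Z_def)
  qed (use p in \<open>auto simp: Z_def\<close>)
  moreover have "u r \<le> V * (r - q)"
  proof (cases "q < r")
    case True
    have "\<bar>u r - u q\<bar> \<le> V * (r - q)"
    proof (rule *)
      fix x assume "x \<in> {q<..<r}"
      then have "x \<in> {s..r}" "x \<notin> Z" using q(1) q(2)[of x] by (auto simp: Z_def)
      then show "0 < u x" by (rule pos)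
    qed (use q sr True in \<open>auto simp: Z_def\<close>)
    then show ?thesis using q by (auto simp: Z_def)
  qed (use q in \<open>auto simp: Z_def\<close>)
  moreover have "V * (p - s) \<le> V * (r - s)" "V * (r - q) \<le> V * (r - s)"
    using V p(1) q(1) by (auto simp: Z_def intro!: mult_left_mono)
  ultimately show ?thesis using nn[of s] nn[of r] sr by auto
next
  case False
  show ?thesis
  proof (cases "s = r")
    case False
    show ?thesis
    proof (rule *)
      fix x assume "x \<in> {s<..<r}"
      then show "0 < u x" using nn[of x] sr \<open>\<not> (\<exists>x\<in>{s..r}. u x = 0)\<close> by (cases "u x = 0") (auto simp: less_le)
    qed (use sr False in auto)
  qed simp
qed

lemma maximal_positive_interval:
  fixes u :: "real \<Rightarrow> real"
  assumes u: "continuous_on {a..b} u" and nn: "\<And>s. s \<in> {a..b} \<Longrightarrow> 0 \<le> u s"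
    and sr: "a \<le> s" "s < r" "r \<le> b" and pos: "\<And>x. x \<in> {s<..<r} \<Longrightarrow> 0 < u x"
  obtains \<alpha> \<beta> where "a \<le> \<alpha>" "\<alpha> \<le> s" "r \<le> \<beta>" "\<beta> \<le> b" "\<And>x. x \<in> {\<alpha><..<\<beta>} \<Longrightarrow> 0 < u x"
    "\<alpha> = a \<or> u \<alpha> = 0" "\<beta> = b \<or> u \<beta> = 0"
proof -
  \<comment> \<open>An anchor at which u is certainly positive, while s and r themselves may be
    zeros. The interval reaches from the last zero before m to the first zero after m, or to the
    ends of the domain.\<close>
  define m where "m = (s + r) / 2"
  have m: "s < m" "m < r" using sr by (auto simp: m_def)
  have um: "0 < u x" if "m \<le> x" "x < r" for x using pos that m by auto
  have um': "0 < u x" if "s < x" "x \<le> m" for x using pos that m by auto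
  have "\<exists>\<alpha>. a \<le> \<alpha> \<and> \<alpha> \<le> s \<and> (\<forall>x. \<alpha> < x \<and> x \<le> m \<longrightarrow> 0 < u x) \<and> (\<alpha> = a \<or> u \<alpha> = 0)"
  proof (cases "\<exists>x\<in>{a..m}. u x = 0")
    case True
    define Z where "Z = {x \<in> {a..m}. u x = 0}"
    have Z: "compact Z" "Z \<noteq> {}"
      using True compact_zero_set[OF continuous_on_subset[OF u, of "{a..m}"]] sr m by (auto simp: Z_def)
    obtain q where q: "q \<in> Z" "\<And>x. x \<in> Z \<Longrightarrow> x \<le> q" using compact_attains_sup[OF Z] by auto
    have "q \<le> s" using q(1) um'[of q] by (force simp: Z_def)
    moreover have "0 < u x" if "q < x" "x \<le> m" for x
      using q(2)[of x] nn[of x] that q(1) sr m by (cases "u x = 0") (auto simp: Z_def less_le)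
    ultimately show ?thesis using q(1) by (auto simp: Z_def)
  next
    case False
    then have "0 < u x" if "a < x" "x \<le> m" for x
      using nn[of x] that sr m by (cases "u x = 0") (auto simp: less_le)
    then show ?thesis using sr by auto
  qed
  then obtain \<alpha> where \<alpha>: "a \<le> \<alpha>" "\<alpha> \<le> s" "\<And>x. \<alpha> < x \<Longrightarrow> x \<le> m \<Longrightarrow> 0 < u x" "\<alpha> = a \<or> u \<alpha> = 0"
    by blast
  have "\<exists>\<beta>. r \<le> \<beta> \<and> \<beta> \<le> b \<and> (\<forall>x. m \<le> x \<and> x < \<beta> \<longrightarrow> 0 < u x) \<and> (\<beta> = b \<or> u \<beta> = 0)"
  proof (cases "\<exists>x\<in>{m..b}. u x = 0")
    case True
    define Z where "Z = {x \<in> {m..b}. u x = 0}"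
    have Z: "compact Z" "Z \<noteq> {}"
      using True compact_zero_set[OF continuous_on_subset[OF u, of "{m..b}"]] sr m by (auto simp: Z_def)
    obtain q where q: "q \<in> Z" "\<And>x. x \<in> Z \<Longrightarrow> q \<le> x" using compact_attains_inf[OF Z] by auto
    have "r \<le> q" using q(1) um[of q] by (force simp: Z_def)
    moreover have "0 < u x" if "m \<le> x" "x < q" for x
      using q(2)[of x] nn[of x] that q(1) sr m by (cases "u x = 0") (auto simp: Z_def less_le)
    ultimately show ?thesis using q(1) by (auto simp: Z_def)
  next
    case False
    then have "0 < u x" if "m \<le> x" "x < b" for x
      using nn[of x] that sr m by (cases "u x = 0") (auto simp: less_le)
    then show ?thesis using sr by auto
  qed
  then obtain \<beta> where \<beta>: "r \<le> \<beta>" "\<beta> \<le> b" "\<And>x. m \<le> x \<Longrightarrow> x < \<beta> \<Longrightarrow> 0 < u x" "\<beta> = b \<or> u \<beta> = 0"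
    by blast
  have "0 < u x" if "x \<in> {\<alpha><..<\<beta>}" for x
    using \<alpha>(3)[of x] \<beta>(3)[of x] that by (cases "x \<le> m") auto
  then show ?thesis using that[of \<alpha> \<beta>] \<alpha> \<beta> by blast
qed

text \<open>Every point off the vertex is joined to the midpoint by a compact interval free of
  zeros. The right end point is included when it is not the vertex, which serves the free end at the
  final time.\<close>

lemma same_edge_on_open_interval:
  fixes y :: "real \<Rightarrow> real ^ 'n::finite"
  assumes y: "continuous_on {a..b} y" and J: "\<And>s. s \<in> {a..b} \<Longrightarrow> y s \<in> junction"
    and nz: "\<And>s. s \<in> {a<..<b} \<Longrightarrow> y s \<noteq> 0" and "a < b"
  obtains i where "\<And>s. s \<in> {a<..<b} \<Longrightarrow> y s \<in> edge i - {0}" "y b \<noteq> 0 \<Longrightarrow> y b \<in> edge i - {0}"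
proof -
  define c where "c = (a + b) / 2"
  have c: "a < c" "c < b" using \<open>a < b\<close> by (auto simp: c_def)
  obtain i where i: "y c \<in> edge i - {0}"
    using junction_cases[OF J[of c]] nz[of c] c by auto
  have *: "y s \<in> edge i - {0}" if s: "s \<in> {a<..b}" "y s \<noteq> 0" for s
  proof -
    obtain j where j: "\<And>r. r \<in> {min s c..max s c} \<Longrightarrow> y r \<in> edge j - {0}"
    proof (rule same_edge_on_interval[of "min s c" "max s c" y])
      show "continuous_on {min s c..max s c} y"
        by (rule continuous_on_subset[OF y]) (use s c in auto)
      show "y r \<in> junction" if "r \<in> {min s c..max s c}" for r
        by (rule J) (use that s c in auto)
      show "y r \<noteq> 0" if "r \<in> {min s c..max s c}" for r
        using that s c nz[of r] by (cases "r = s") (auto simp: min_def max_def split: if_splits)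
    qed auto
    then show ?thesis using edge_unique[OF i, of j] by (metis atLeastAtMost_iff max.cobounded1 max.cobounded2 min.cobounded1 min.cobounded2)
  qed
  show ?thesis by (rule that[of i]) (use * nz \<open>a < b\<close> in auto)
qed

section \<open>Estimates on the Lagrangians\<close>

text \<open>Clamping the position and time arguments is a continuous retraction onto the slab;
  composing F with it gives a globally continuous, hence Borel, function with the same values along
  the given paths.\<close>

lemma borel_measurable_continuous_on_slab:
  fixes F :: "real \<times> real \<times> real \<Rightarrow> 'a::topological_space"
  assumes F: "continuous_on ({0..} \<times> UNIV \<times> {0..T}) F" and "0 \<le> T"
    and [measurable]: "u \<in> borel_measurable M" "v \<in> borel_measurable M" "w \<in> borel_measurable M"
    and uw: "\<And>x. x \<in> space M \<Longrightarrow> 0 \<le> u x \<and> w x \<in> {0..T}"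
  shows "(\<lambda>x. F (u x, v x, w x)) \<in> borel_measurable M"
proof -
  define G where "G = (\<lambda>(y, a, s). F (max 0 y, a, min T (max 0 s)))"
  have "continuous_on UNIV (\<lambda>z. F (max 0 (fst z), fst (snd z), min T (max 0 (snd (snd z)))))"
    by (rule continuous_on_compose2[OF F]) (use \<open>0 \<le> T\<close> in \<open>auto intro!: continuous_intros\<close>)
  then have "G \<in> borel_measurable borel"
    by (intro borel_measurable_continuous_onI) (simp add: G_def case_prod_unfold)
  moreover have "(\<lambda>x. (u x, v x, w x)) \<in> borel_measurable M" by measurable
  ultimately have "(\<lambda>x. G (u x, v x, w x)) \<in> borel_measurable M" by (rule measurable_compose[rotated])
  then show ?thesis
    by (rule measurable_cong[THEN iffD1, rotated]) (use uw in \<open>force simp: G_def max_absorb2 min_absorb2\<close>)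
qed

text \<open>A derivative \<open>dg\<close> of the terminal cost is fixed together with the other
  data, so that the momentum at a free end can be named in the estimates.\<close>

locale junction_problem =
  fixes l dyl dal :: "'n::finite \<Rightarrow> real \<Rightarrow> real \<Rightarrow> real \<Rightarrow> real"
    and lstar :: "real \<Rightarrow> real"
    and g dg :: "'n \<Rightarrow> real \<Rightarrow> real"
    and gstar T p :: real
  assumes T: "0 < T" and p: "1 < p"
    and g_bdd: "\<And>i. bounded (g i ` {0..})"
    and lstar_cont: "continuous_on {0..T} lstar"
    and l_cont: "\<And>i. continuous_on ({0..} \<times> UNIV \<times> {0..T}) (\<lambda>(y, a, s). l i y a s)"
    and l_deriv: "\<And>i y a s. 0 \<le> y \<Longrightarrow> s \<in> {0..T} \<Longrightarrow>
        ((\<lambda>(y, a). l i y a s) has_derivative (\<lambda>(h, k). dyl i y a s * h + dal i y a s * k))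
          (at (y, a) within {0..} \<times> UNIV)"
    and dyl_cont: "\<And>i. continuous_on ({0..} \<times> UNIV \<times> {0..T}) (\<lambda>(y, a, s). dyl i y a s)"
    and dal_cont: "\<And>i. continuous_on ({0..} \<times> UNIV \<times> {0..T}) (\<lambda>(y, a, s). dal i y a s)"
    and H1: "\<And>i. \<exists>C0>0. (\<forall>y\<ge>0. \<forall>a. \<forall>s\<in>{0..T}. C0 * (\<bar>a\<bar> powr p - 1) \<le> l i y a s) \<and>
                        (\<forall>s\<in>{0..T}. - C0 \<le> lstar s)"
    and H3: "\<And>i r. 0 < r \<Longrightarrow> \<exists>c\<ge>0. \<forall>y\<in>{0..r}. \<forall>a. \<forall>s\<in>{0..T}.
        \<bar>dyl i y a s\<bar> \<le> c * (\<bar>a\<bar> powr p + 1) \<and>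
        \<bar>dal i y a s\<bar> \<le> c * (\<bar>a\<bar> powr (p - 1) + 1)"
    and H4: "\<And>i y s. 0 \<le> y \<Longrightarrow> s \<in> {0..T} \<Longrightarrow> strictly_convex (\<lambda>a. l i y a s)"
    and g_deriv: "\<And>i y. 0 \<le> y \<Longrightarrow> (g i has_real_derivative dg i y) (at y within {0..})"
    and dg_cont: "\<And>i. continuous_on {0..} (dg i)"
begin

lemma coercive:
  obtains c C where "0 < c" "0 \<le> C"
    "\<And>i y a s. 0 \<le> y \<Longrightarrow> s \<in> {0..T} \<Longrightarrow> c * \<bar>a\<bar> powr p - C \<le> l i y a s"
    "\<And>s. s \<in> {0..T} \<Longrightarrow> - C \<le> lstar s"
proof -
  obtain C0 where C0: "\<And>i. C0 i > 0"
      "\<And>i y a s. 0 \<le> y \<Longrightarrow> s \<in> {0..T} \<Longrightarrow> C0 i * (\<bar>a\<bar> powr p - 1) \<le> l i y a s"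
      "\<And>i s. s \<in> {0..T} \<Longrightarrow> - C0 i \<le> lstar s"
    using H1 by metis
  define c where "c = Min (range C0)"
  define C where "C = Max (range C0)"
  have le: "c \<le> C0 i" "C0 i \<le> C" for i by (auto simp: c_def C_def)
  have "0 < c" using C0(1) by (simp add: c_def)
  \<comment> \<open>\<open>undefined\<close> stands for an arbitrary edge; it is used because the
    bound on \<open>lstar\<close> is attached to an edge index.\<close>
  moreover have "0 \<le> C" using le[of undefined] C0(1)[of undefined] by linarith
  moreover have "c * \<bar>a\<bar> powr p - C \<le> l i y a s" if "0 \<le> y" "s \<in> {0..T}" for i y a s
  proof -
    have "c * \<bar>a\<bar> powr p \<le> C0 i * \<bar>a\<bar> powr p" by (intro mult_right_mono le) simp
    then show ?thesis using C0(2)[OF that, of i a] le(2)[of i] by (simp add: algebra_simps)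
  qed
  moreover have "- C \<le> lstar s" if "s \<in> {0..T}" for s
    using C0(3)[OF that, of undefined] le(2)[of undefined] by linarith
  ultimately show ?thesis by (rule that)
qed

text \<open>The Lagrangians are differentiable only relative to y \<ge> 0. If both ends of the
  segment have nonnegative position, so has every point between, and the chain rule gives a
  derivative within the parameter interval.\<close>

lemma l_derivative_along:
  assumes "0 \<le> y" "0 \<le> y + e0 * \<phi>" "s \<in> {0..T}" "e \<in> {0..e0}"
  shows "((\<lambda>e. l i (y + e * \<phi>) (a + e * \<psi>) s) has_real_derivative
      (dyl i (y + e * \<phi>) (a + e * \<psi>) s * \<phi> + dal i (y + e * \<phi>) (a + e * \<psi>) s * \<psi>)) (at e within {0..e0})"
proof -
  have nn: "0 \<le> y + e * \<phi>" if "e \<in> {0..e0}" for e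
  proof (cases "0 \<le> \<phi>")
    case False
    then have "e0 * \<phi> \<le> e * \<phi>" using that by (intro mult_right_mono_neg) auto
    then show ?thesis using assms by linarith
  qed (use assms that in auto)
  have 1: "((\<lambda>e. (y + e * \<phi>, a + e * \<psi>)) has_derivative (\<lambda>h. (h * \<phi>, h * \<psi>))) (at e within {0..e0})"
    by (auto intro!: derivative_eq_intros)
  have 2: "((\<lambda>(y, a). l i y a s) has_derivative
      (\<lambda>(h, k). dyl i (y + e * \<phi>) (a + e * \<psi>) s * h + dal i (y + e * \<phi>) (a + e * \<psi>) s * k))
      (at (y + e * \<phi>, a + e * \<psi>) within (\<lambda>e. (y + e * \<phi>, a + e * \<psi>)) ` {0..e0})"
  proof (rule has_derivative_subset[OF l_deriv])
    show "(\<lambda>e. (y + e * \<phi>, a + e * \<psi>)) ` {0..e0} \<subseteq> {0..} \<times> UNIV"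
      using nn by auto
  qed (use nn[OF assms(4)] assms(3) in simp_all)
  show ?thesis
    unfolding has_field_derivative_def
    by (rule has_derivative_eq_rhs[OF has_derivative_in_compose[OF 1 2, unfolded split_conv]])
       (simp add: fun_eq_iff algebra_simps)
qed

lemma l_has_derivative_dal:
  assumes "0 \<le> y" "s \<in> {0..T}"
  shows "((\<lambda>a. l i y a s) has_real_derivative dal i y a s) (at a)"
proof -
  have 1: "((\<lambda>a. (y, a)) has_derivative (\<lambda>k. (0, k))) (at a)"
    by (auto intro!: derivative_eq_intros)
  have 2: "((\<lambda>(y, a). l i y a s) has_derivative (\<lambda>(h, k). dyl i y a s * h + dal i y a s * k))
      (at (y, a) within range (\<lambda>a. (y, a)))"
    by (rule has_derivative_subset[OF l_deriv]) (use assms in auto)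
  from has_derivative_in_compose[OF 1 2] show ?thesis
    by (simp add: has_field_derivative_def mult_commute_abs)
qed

section \<open>Convexity and growth of the Lagrangians\<close>

lemma l_gradient_inequality:
  assumes "0 \<le> y" "s \<in> {0..T}"
  shows "dal i y a s * (b - a) \<le> l i y b s - l i y a s"
proof -
  have "convex_on UNIV (\<lambda>a. l i y a s)"
  proof (rule convex_onI)
    fix u x z :: real assume "0 < u" "u < 1"
    then show "l i y ((1 - u) *\<^sub>R x + u *\<^sub>R z) s \<le> (1 - u) * l i y x s + u * l i y z s"
      using H4[OF assms, of i] unfolding strictly_convex_def
      by (cases "x = z") (auto simp: left_diff_distrib less_imp_le)
  qed simp
  from convex_on_imp_above_tangent[OF this, of a b "dal i y a s"] show ?thesis
    using l_has_derivative_dal[OF assms] by simp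
qed

lemma dal_mono:
  assumes "0 \<le> y" "s \<in> {0..T}" "a \<le> b"
  shows "dal i y a s \<le> dal i y b s"
proof (cases "a = b")
  case False
  have "(dal i y a s - dal i y b s) * (b - a) \<le> 0"
    using l_gradient_inequality[OF assms(1,2), of i a b] l_gradient_inequality[OF assms(1,2), of i b a]
    by (simp add: algebra_simps)
  then show ?thesis using False assms(3) by (auto simp: mult_le_0_iff)
qed simp

text \<open>The growth of l follows from that of its a-derivative by the mean value theorem between
  0 and a: |a| times the power p - 1 of |a| is the power p, and \<open>l i y 0 s\<close> is bounded
  on a compact set.\<close>

lemma l_growth:
  obtains K where "0 \<le> K"
    "\<And>i y a s. y \<in> {0..r} \<Longrightarrow> s \<in> {0..T} \<Longrightarrow> \<bar>l i y a s\<bar> \<le> K * (\<bar>a\<bar> powr p + 1)"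
    "\<And>i y a s. y \<in> {0..r} \<Longrightarrow> s \<in> {0..T} \<Longrightarrow> \<bar>dyl i y a s\<bar> \<le> K * (\<bar>a\<bar> powr p + 1)"
    "\<And>i y a s. y \<in> {0..r} \<Longrightarrow> s \<in> {0..T} \<Longrightarrow> \<bar>dal i y a s\<bar> \<le> K * (\<bar>a\<bar> powr (p - 1) + 1)"
proof -
  have "\<exists>K\<ge>0. \<forall>y\<in>{0..r}. \<forall>a. \<forall>s\<in>{0..T}. \<bar>l i y a s\<bar> \<le> K * (\<bar>a\<bar> powr p + 1) \<and>
      \<bar>dyl i y a s\<bar> \<le> K * (\<bar>a\<bar> powr p + 1) \<and> \<bar>dal i y a s\<bar> \<le> K * (\<bar>a\<bar> powr (p - 1) + 1)" for i
  proof -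
    obtain c where c: "c \<ge> 0"
        "\<And>y a s. y \<in> {0..r} \<Longrightarrow> s \<in> {0..T} \<Longrightarrow> \<bar>dyl i y a s\<bar> \<le> c * (\<bar>a\<bar> powr p + 1)"
        "\<And>y a s. y \<in> {0..r} \<Longrightarrow> s \<in> {0..T} \<Longrightarrow> \<bar>dal i y a s\<bar> \<le> c * (\<bar>a\<bar> powr (p - 1) + 1)"
    proof -
      \<comment> \<open>The maximum with 1 supplies the positive radius that the growth hypothesis
        asks for, whatever r is.\<close>
      obtain c where "c \<ge> 0" and c: "\<forall>y\<in>{0..max r 1}. \<forall>a. \<forall>s\<in>{0..T}.
          \<bar>dyl i y a s\<bar> \<le> c * (\<bar>a\<bar> powr p + 1) \<and> \<bar>dal i y a s\<bar> \<le> c * (\<bar>a\<bar> powr (p - 1) + 1)"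
        using H3[of "max r 1" i] by (metis less_max_iff_disj zero_less_one)
      moreover have "{0..r} \<subseteq> {0..max r 1}" by auto
      ultimately show thesis by (intro that[of c]) blast+
    qed
    have "continuous_on ({0..r} \<times> {0..T}) (\<lambda>z. (\<lambda>(y, a, s). l i y a s) (fst z, 0, snd z))"
      by (rule continuous_on_compose2[OF l_cont]) (auto intro!: continuous_intros)
    then have "compact ((\<lambda>z. l i (fst z) 0 (snd z)) ` ({0..r} \<times> {0..T}))"
      by (intro compact_continuous_image) (auto intro: compact_Times)
    then obtain A where A: "\<And>z. z \<in> {0..r} \<times> {0..T} \<Longrightarrow> \<bar>l i (fst z) 0 (snd z)\<bar> \<le> A"
      unfolding compact_eq_bounded_closed bounded_real by blast
    have A0: "\<bar>l i y 0 s\<bar> \<le> \<bar>A\<bar>" if "y \<in> {0..r}" "s \<in> {0..T}" for y s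
      using A[of "(y, s)"] that by auto
    have l: "\<bar>l i y a s\<bar> \<le> (\<bar>A\<bar> + 2 * c) * (\<bar>a\<bar> powr p + 1)" if ys: "y \<in> {0..r}" "s \<in> {0..T}" for y a s
    proof -
      have "\<exists>z. \<bar>z\<bar> \<le> \<bar>a\<bar> \<and> l i y a s - l i y 0 s = a * dal i y z s"
      proof -
        have D: "\<And>x. ((\<lambda>a. l i y a s) has_real_derivative dal i y x s) (at x)"
          using l_has_derivative_dal ys by auto
        consider "a = 0" | "0 < a" | "a < 0" by linarith
        then show ?thesis
        proof cases
          case 2
          then obtain z where "0 < z" "z < a" "l i y a s - l i y 0 s = (a - 0) * dal i y z s"
            using MVT2[of 0 a "\<lambda>a. l i y a s" "\<lambda>z. dal i y z s"] D by blast
          then show ?thesis by (intro exI[of _ z]) auto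
        next
          case 3
          then obtain z where "a < z" "z < 0" "l i y 0 s - l i y a s = (0 - a) * dal i y z s"
            using MVT2[of a 0 "\<lambda>a. l i y a s" "\<lambda>z. dal i y z s"] D by blast
          then show ?thesis by (intro exI[of _ z]) auto
        qed (auto intro: exI[of _ 0])
      qed
      then obtain z where z: "\<bar>z\<bar> \<le> \<bar>a\<bar>" "l i y a s - l i y 0 s = a * dal i y z s" by auto
      have "\<bar>a * dal i y z s\<bar> \<le> \<bar>a\<bar> * (c * (\<bar>z\<bar> powr (p - 1) + 1))"
        using c(3)[OF ys] by (auto simp: abs_mult intro!: mult_left_mono)
      also have "\<dots> \<le> \<bar>a\<bar> * (c * (\<bar>a\<bar> powr (p - 1) + 1))"
        using z p c(1) by (intro mult_left_mono add_right_mono powr_mono2) auto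
      also have "\<dots> = c * (\<bar>a\<bar> powr p + \<bar>a\<bar>)"
        using powr_mult_base[of "\<bar>a\<bar>" "p - 1"] by (simp add: algebra_simps)
      also have "\<dots> \<le> c * (\<bar>a\<bar> powr p + (\<bar>a\<bar> powr p + 1))"
        using powr_le_add_one[of 1 p "\<bar>a\<bar>"] p c(1) by (intro mult_left_mono) auto
      finally have "\<bar>l i y a s - l i y 0 s\<bar> \<le> c * (2 * \<bar>a\<bar> powr p + 1)" by (simp add: z(2))
      moreover have "0 \<le> \<bar>A\<bar> * \<bar>a\<bar> powr p" by simp
      ultimately show ?thesis
        using A0[OF ys] c(1) unfolding distrib_left distrib_right by linarith
    qed
    have m: "c * x \<le> (\<bar>A\<bar> + 2 * c) * x" if "0 \<le> x" for x
      by (rule mult_right_mono[OF _ that]) (use c(1) in simp)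
    show ?thesis
      using l c(1) order_trans[OF c(2) m] order_trans[OF c(3) m]
      by (intro exI[of _ "\<bar>A\<bar> + 2 * c"]) auto
  qed
  then obtain K where K: "\<And>i. 0 \<le> K i"
    "\<And>i y a s. y \<in> {0..r} \<Longrightarrow> s \<in> {0..T} \<Longrightarrow> \<bar>l i y a s\<bar> \<le> K i * (\<bar>a\<bar> powr p + 1)"
    "\<And>i y a s. y \<in> {0..r} \<Longrightarrow> s \<in> {0..T} \<Longrightarrow> \<bar>dyl i y a s\<bar> \<le> K i * (\<bar>a\<bar> powr p + 1)"
    "\<And>i y a s. y \<in> {0..r} \<Longrightarrow> s \<in> {0..T} \<Longrightarrow> \<bar>dal i y a s\<bar> \<le> K i * (\<bar>a\<bar> powr (p - 1) + 1)"
    by metis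
  have "K i * x \<le> sum K UNIV * x" if "0 \<le> x" for i x
    by (intro mult_right_mono[OF _ that] member_le_sum K) auto
  note m = this[OF add_nonneg_nonneg[OF powr_ge_zero zero_le_one]]
  show ?thesis
    by (rule that[of "sum K UNIV", OF _ order_trans[OF K(2) m] order_trans[OF K(3) m] order_trans[OF K(4) m]])
       (use K(1) in \<open>auto intro: sum_nonneg\<close>)
qed

text \<open>The tangent at a lies below the graph at speed 0, so l grows from 0 to a by at most M
  |a|, while coercivity forces a growth of order p > 1.\<close>

lemma velocity_bound:
  obtains V where "0 \<le> V"
    "\<And>i y a s. y \<in> {0..r} \<Longrightarrow> s \<in> {0..T} \<Longrightarrow> \<bar>dal i y a s\<bar> \<le> M \<Longrightarrow> \<bar>a\<bar> \<le> V"
proof -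
  obtain c C where cC: "0 < c" "0 \<le> C"
    "\<And>i y a s. 0 \<le> y \<Longrightarrow> s \<in> {0..T} \<Longrightarrow> c * \<bar>a\<bar> powr p - C \<le> l i y a s"
    using coercive by metis
  obtain K where K: "0 \<le> K"
    "\<And>i y a s. y \<in> {0..r} \<Longrightarrow> s \<in> {0..T} \<Longrightarrow> \<bar>l i y a s\<bar> \<le> K * (\<bar>a\<bar> powr p + 1)"
    using l_growth by metis
  \<comment> \<open>For |a| > 1 the constants C and K are at most C |a| and K |a|; dividing the
    resulting inequality by c |a| leaves this bound for the power p - 1 of |a|.\<close>
  define B where "B = (\<bar>M\<bar> + C + K) / c"
  have B: "0 \<le> B" using cC K by (simp add: B_def)
  define V where "V = max 1 (B powr (1 / (p - 1)))"
  have "\<bar>a\<bar> \<le> V" if ys: "y \<in> {0..r}" "s \<in> {0..T}" and M: "\<bar>dal i y a s\<bar> \<le> M" for i y a s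
  proof (rule ccontr)
    assume "\<not> \<bar>a\<bar> \<le> V"
    then have a: "1 < \<bar>a\<bar>" "B powr (1 / (p - 1)) < \<bar>a\<bar>" by (auto simp: V_def)
    have "l i y a s - l i y 0 s \<le> dal i y a s * a"
      using l_gradient_inequality[of y s i a 0] ys by (simp add: algebra_simps)
    also have "\<dots> \<le> \<bar>dal i y a s\<bar> * \<bar>a\<bar>" by (simp add: abs_mult[symmetric])
    also have "\<dots> \<le> \<bar>M\<bar> * \<bar>a\<bar>" using M by (intro mult_right_mono) auto
    finally have "c * \<bar>a\<bar> powr p \<le> \<bar>M\<bar> * \<bar>a\<bar> + C + K"
      using cC(3)[of y s a i] K(2)[OF ys, of i 0] ys by auto
    also have "\<dots> \<le> \<bar>M\<bar> * \<bar>a\<bar> + C * \<bar>a\<bar> + K * \<bar>a\<bar>"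
      using a cC K by (intro add_mono) (auto simp: mult_le_cancel_left1)
    also have "\<dots> = c * (B * \<bar>a\<bar>)" using cC by (simp add: B_def field_simps)
    finally have "\<bar>a\<bar> powr p \<le> B * \<bar>a\<bar>" using cC(1) by simp
    moreover have "\<bar>a\<bar> powr p = \<bar>a\<bar> powr (p - 1) * \<bar>a\<bar>"
      using powr_mult_base[of "\<bar>a\<bar>" "p - 1"] by (simp add: algebra_simps)
    ultimately have "\<bar>a\<bar> powr (p - 1) \<le> B"
      using a mult_right_le_imp_le[of "\<bar>a\<bar> powr (p - 1)" "\<bar>a\<bar>" B] by linarith
    moreover have "B < \<bar>a\<bar> powr (p - 1)"
    proof -
      have "(B powr (1 / (p - 1))) powr (p - 1) < \<bar>a\<bar> powr (p - 1)"
        using a p by (intro powr_less_mono2) auto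
      then show ?thesis using p B by (simp add: powr_powr)
    qed
    ultimately show False by simp
  qed
  moreover have "0 \<le> V" by (simp add: V_def)
  ultimately show ?thesis by (rule that[rotated])
qed

text \<open>Mean value theorem along the segment. The right-hand side is free of e and, for a speed
  in \<open>Lp\<close>, integrable: it dominates the difference quotients of the first
  variation.\<close>

lemma l_increment_bound:
  assumes K: "0 \<le> K"
    "\<And>y a s. y \<in> {0..r} \<Longrightarrow> s \<in> {0..T} \<Longrightarrow> \<bar>dyl i y a s\<bar> \<le> K * (\<bar>a\<bar> powr p + 1)"
    "\<And>y a s. y \<in> {0..r} \<Longrightarrow> s \<in> {0..T} \<Longrightarrow> \<bar>dal i y a s\<bar> \<le> K * (\<bar>a\<bar> powr (p - 1) + 1)"
    and e: "0 < e" "e \<le> 1" and y: "y \<in> {0..r}" "y + e * \<phi> \<in> {0..r}" and s: "s \<in> {0..T}"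
    and b: "\<bar>\<phi>\<bar> \<le> B" "\<bar>\<psi>\<bar> \<le> B"
  shows "\<bar>(l i (y + e * \<phi>) (a + e * \<psi>) s - l i y a s) / e\<bar> \<le> 2 * B * K * ((\<bar>a\<bar> + B) powr p + 2)"
proof -
  have "\<exists>x\<in>{0<..<e}. l i (y + e * \<phi>) (a + e * \<psi>) s - l i (y + 0 * \<phi>) (a + 0 * \<psi>) s =
      (\<lambda>h. (dyl i (y + x * \<phi>) (a + x * \<psi>) s * \<phi> + dal i (y + x * \<phi>) (a + x * \<psi>) s * \<psi>) * h) (e - 0)"
    by (rule mvt_simple[OF e(1)])
       (use l_derivative_along[of y e \<phi> s _ i a \<psi>] y s in \<open>auto simp: has_field_derivative_def\<close>)
  then obtain x where x: "x \<in> {0<..<e}" and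
    eq: "l i (y + e * \<phi>) (a + e * \<psi>) s - l i y a s =
      (dyl i (y + x * \<phi>) (a + x * \<psi>) s * \<phi> + dal i (y + x * \<phi>) (a + x * \<psi>) s * \<psi>) * e"
    by auto
  define a' where "a' = a + x * \<psi>"
  have "y + x * \<phi> = (1 - x / e) * y + (x / e) * (y + e * \<phi>)" using e by (simp add: field_simps)
  also have "\<dots> \<in> {0..r}"
    using convexD[of "{0..r}" y "y + e * \<phi>" "1 - x / e" "x / e"] y x e by auto
  finally have yx: "y + x * \<phi> \<in> {0..r}" .
  have "\<bar>a'\<bar> \<le> \<bar>a\<bar> + x * \<bar>\<psi>\<bar>" using x by (auto simp: a'_def abs_mult intro: order_trans[OF abs_triangle_ineq])
  also have "x * \<bar>\<psi>\<bar> \<le> 1 * B" using x e b by (intro mult_mono) auto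
  finally have a': "\<bar>a'\<bar> \<le> \<bar>a\<bar> + B" by simp
  \<comment> \<open>The 2 comes from bounding the power p - 1 by the power p plus 1, so that Q
    serves both partial derivatives.\<close>
  define Q where "Q = (\<bar>a\<bar> + B) powr p + 2"
  have q: "\<bar>a'\<bar> powr p \<le> (\<bar>a\<bar> + B) powr p" using a' p by (intro powr_mono2) auto
  have "\<bar>dyl i (y + x * \<phi>) a' s\<bar> \<le> K * Q"
    by (rule order_trans[OF K(2)[OF yx s] mult_left_mono[OF _ K(1)]]) (use q in \<open>simp add: Q_def\<close>)
  moreover have "\<bar>dal i (y + x * \<phi>) a' s\<bar> \<le> K * Q"
  proof -
    have "\<bar>a'\<bar> powr (p - 1) \<le> \<bar>a'\<bar> powr p + 1" using p by (intro powr_le_add_one) auto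
    then show ?thesis
      by (intro order_trans[OF K(3)[OF yx s] mult_left_mono[OF _ K(1)]]) (use q in \<open>simp add: Q_def\<close>)
  qed
  moreover have "\<bar>d1 * \<phi> + d2 * \<psi>\<bar> \<le> 2 * B * K * Q" if "\<bar>d1\<bar> \<le> K * Q" "\<bar>d2\<bar> \<le> K * Q" for d1 d2
  proof -
    have KQ: "0 \<le> K * Q" using that by linarith
    have "\<bar>d1 * \<phi> + d2 * \<psi>\<bar> \<le> \<bar>d1\<bar> * \<bar>\<phi>\<bar> + \<bar>d2\<bar> * \<bar>\<psi>\<bar>" by (metis abs_mult abs_triangle_ineq)
    also have "\<dots> \<le> (K * Q) * B + (K * Q) * B" using that b KQ by (intro add_mono mult_mono) auto
    finally show ?thesis by (simp add: algebra_simps)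
  qed
  ultimately show ?thesis using eq e by (simp add: a'_def Q_def)
qed

section \<open>Costs and energy\<close>

abbreviation speed :: "real \<Rightarrow> (real \<Rightarrow> real ^ 'n) \<Rightarrow> real \<Rightarrow> real" where
  "speed t y \<equiv> weak_deriv t T (\<lambda>s. norm (y s))"

abbreviation opt :: "real \<Rightarrow> real ^ 'n \<Rightarrow> (real \<Rightarrow> real ^ 'n) set" where
  "opt t x \<equiv> optimal_trajectories l lstar g gstar p T t x"

lemma trajectory_velocity:
  assumes y: "y \<in> trajectories p T t x"
  obtains w where "w \<in> Lp p t T" "\<And>s. s \<in> {t..T} \<Longrightarrow> y s = x + integral {t..s} w"
proof -
  obtain w where "w \<in> Lp p t T" "\<And>s. s \<in> {t..T} \<Longrightarrow> y s = y t + integral {t..s} w"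
    using W1p_imp_indefinite_integral[of t T y p] y unfolding trajectories_def by blast
  moreover have "y t = x" using y by (simp add: trajectories_def)
  ultimately show ?thesis by (intro that[of w]) simp_all
qed

text \<open>Any primitive of an \<open>Lp\<close> velocity that stays in the junction is admissible;
  this produces the constant path and all competitors. Its radial speed is the coordinate sum of the
  velocity, only almost everywhere because \<open>speed\<close> is a chosen representative.\<close>

lemma
  assumes w: "w \<in> Lp p t T" and t: "t \<le> T"
    and y: "\<And>s. s \<in> {t..T} \<Longrightarrow> y s = x + integral {t..s} w"
    and J: "\<And>s. s \<in> {t..T} \<Longrightarrow> y s \<in> junction"
  shows trajectoryI: "y \<in> trajectories p T t x"
    and speed_AE_eq: "AE s in lebesgue_on {t<..<T}. speed t y s = w s \<bullet> (\<Sum>i\<in>UNIV. axis i 1)"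
    and norm_eq_integral_speed: "s \<in> {t..T} \<Longrightarrow> norm (y s) = norm x + integral {t..s} (speed t y)"
    and speed_Lp: "speed t y \<in> Lp p t T"
proof -
  let ?e = "\<Sum>i\<in>UNIV. axis i 1 :: real ^ 'n"
  have yt: "y t = x" using y[of t] t by simp
  have y': "\<And>s. s \<in> {t..T} \<Longrightarrow> y s = y t + integral {t..s} w" using y yt by simp
  show tr: "y \<in> trajectories p T t x"
    using indefinite_integral_in_W1p[OF w _ y'] J yt p by (simp add: trajectories_def)
  have wi: "integrable (lebesgue_on {t<..<T}) w" by (rule Lp_imp_integrable[OF w]) (use p in simp)
  have wi': "w integrable_on {t..s}" if "s \<in> {t..T}" for s
    by (rule integral_lebesgue_on_indicator(2)[OF wi]) (use that in auto)
  have vi: "integrable (lebesgue_on {t<..<T}) (\<lambda>s. w s \<bullet> ?e)"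
    using wi by (intro integrable_inner_left)
  have u: "norm (y s) = norm (y t) + integral {t..s} (\<lambda>s. w s \<bullet> ?e)" if s: "s \<in> {t..T}" for s
  proof -
    have "integral {t..s} (\<lambda>s. w s \<bullet> ?e) = integral {t..s} w \<bullet> ?e"
      using integral_linear[OF wi'[OF s] bounded_linear_inner_left[of ?e]] by (simp add: o_def)
    then show ?thesis
      using norm_junction_eq_inner[OF J[OF s]] norm_junction_eq_inner[OF J[of t]] y'[OF s] t
      by (simp add: inner_add_left)
  qed
  note W = weak_deriv_indefinite_integral[OF vi u]
  show AE: "AE s in lebesgue_on {t<..<T}. speed t y s = w s \<bullet> ?e" by (rule W(2)) simp
  show "norm (y s) = norm x + integral {t..s} (speed t y)" if "s \<in> {t..T}" for s
    using W(3)[OF _ that] yt by simp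
  have "(\<lambda>s. w s \<bullet> ?e) \<in> Lp p t T"
    by (rule Lp_norm_bound[OF w, of _ "norm ?e" 0])
       (use vi p in \<open>auto simp: mult.commute[of "norm ?e"] intro: Cauchy_Schwarz_ineq2\<close>)
  then show "speed t y \<in> Lp p t T"
    by (rule Lp_cong_AE[OF _ _ AE]) (use W(1) in auto)
qed

lemma
  assumes y: "y \<in> trajectories p T t x" and t: "t \<le> T"
  shows trajectory_norm: "s \<in> {t..T} \<Longrightarrow> norm (y s) = norm x + integral {t..s} (speed t y)"
    and trajectory_speed_Lp: "speed t y \<in> Lp p t T"
proof -
  obtain w where w: "w \<in> Lp p t T" "\<And>s. s \<in> {t..T} \<Longrightarrow> y s = x + integral {t..s} w"
    using trajectory_velocity[OF y] by blast
  have J: "\<And>s. s \<in> {t..T} \<Longrightarrow> y s \<in> junction" using y by (simp add: trajectories_def)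
  show "s \<in> {t..T} \<Longrightarrow> norm (y s) = norm x + integral {t..s} (speed t y)"
    by (rule norm_eq_integral_speed[OF w(1) t w(2) J])
  show "speed t y \<in> Lp p t T"
    by (rule speed_Lp[OF w(1) t w(2) J])
qed

lemma constant_trajectory:
  fixes x :: "real ^ 'n"
  assumes "x \<in> junction" "t \<le> T"
  shows "(\<lambda>s. x) \<in> trajectories p T t x"
  by (rule trajectoryI[of "\<lambda>s. 0", OF _ assms(2)]) (use assms(1) p in \<open>auto simp: Lp_def\<close>)

section \<open>Bounds on the costs\<close>

lemma vertex_cost_bounds:
  obtains B where "\<And>s. s \<in> {0..T} \<Longrightarrow> \<bar>vertex_cost l lstar s\<bar> \<le> B"
proof -
  obtain c C where C: "\<And>i y a s. 0 \<le> y \<Longrightarrow> s \<in> {0..T} \<Longrightarrow> c * \<bar>a\<bar> powr p - C \<le> l i y a s"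
    "\<And>s. s \<in> {0..T} \<Longrightarrow> - C \<le> lstar s"
    using coercive by metis
  have "compact (lstar ` {0..T})" by (intro compact_continuous_image lstar_cont) simp
  then obtain A where A: "\<And>s. s \<in> {0..T} \<Longrightarrow> \<bar>lstar s\<bar> \<le> A"
    unfolding compact_eq_bounded_closed bounded_real by blast
  have "\<bar>vertex_cost l lstar s\<bar> \<le> max A C" if s: "s \<in> {0..T}" for s
  proof -
    have "- C \<le> l i 0 0 s" for i using C(1)[of 0 s 0 i] s by simp
    then have "- C \<le> vertex_cost l lstar s" using C(2)[OF s] by (simp add: vertex_cost_def)
    moreover have "vertex_cost l lstar s \<le> A" using A[OF s] by (simp add: vertex_cost_def)
    ultimately show ?thesis by linarith
  qed
  then show ?thesis by (rule that)
qed

text \<open>The indicator is essential: at the vertex the running cost is independent of the speed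
  argument, so coercivity holds only off it.\<close>

lemma running_cost_lower_bound:
  obtains c C where "0 < c" "0 \<le> C"
    "\<And>z a s. z \<in> junction \<Longrightarrow> s \<in> {0..T} \<Longrightarrow>
      c * (indicator (- {0}) z * \<bar>a\<bar> powr p) - C \<le> running_cost l lstar z a s"
proof -
  obtain c C where c: "0 < c" "0 \<le> C" and l: "\<And>i y a s. 0 \<le> y \<Longrightarrow> s \<in> {0..T} \<Longrightarrow> c * \<bar>a\<bar> powr p - C \<le> l i y a s"
    using coercive by metis
  obtain B where B: "\<And>s. s \<in> {0..T} \<Longrightarrow> \<bar>vertex_cost l lstar s\<bar> \<le> B"
    using vertex_cost_bounds by blast
  have "c * (indicator (- {0}) z * \<bar>a\<bar> powr p) - max B C \<le> running_cost l lstar z a s"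
    if "z \<in> junction" "s \<in> {0..T}" for z a s
    using that(1)
  proof (cases rule: junction_cases)
    case 1
    then show ?thesis using B[OF that(2)] unfolding 1 running_cost_0 by (simp add: abs_le_iff) linarith
  next
    case (2 i)
    then show ?thesis using l[of "norm z" s a i] that(2) by (auto simp: running_cost_edge[OF 2])
  qed
  moreover have "0 \<le> max B C" using c by simp
  ultimately show ?thesis by (rule that[OF c(1), rotated])
qed

lemma terminal_cost_bounded:
  obtains B where "0 \<le> B" "\<And>z. z \<in> junction \<Longrightarrow> \<bar>terminal_cost g gstar z\<bar> \<le> B"
proof -
  have "\<exists>B. \<forall>y\<ge>0. \<bar>g i y\<bar> \<le> B" for i
    using g_bdd[of i] by (auto simp: bounded_real)
  then obtain B where B: "\<And>i y. 0 \<le> y \<Longrightarrow> \<bar>g i y\<bar> \<le> B i" by metis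
  define b where "b = \<bar>terminal_cost g gstar 0\<bar> + (\<Sum>i\<in>UNIV. \<bar>B i\<bar>)"
  have "\<bar>terminal_cost g gstar z\<bar> \<le> b" if "z \<in> junction" for z
    using that
  proof (cases rule: junction_cases)
    case 1
    then show ?thesis by (simp add: b_def sum_nonneg)
  next
    case (2 i)
    have "\<bar>B i\<bar> \<le> (\<Sum>i\<in>UNIV. \<bar>B i\<bar>)" by (rule member_le_sum) auto
    then show ?thesis using B[of "norm z" i] by (simp add: terminal_cost_edge[OF 2] b_def)
  qed
  moreover have "0 \<le> b" by (simp add: b_def sum_nonneg)
  ultimately show ?thesis by (rule that[rotated])
qed

lemma running_cost_integrable:
  assumes y: "continuous_on {t..T} y" and J: "\<And>s. s \<in> {t..T} \<Longrightarrow> y s \<in> junction"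
    and v: "v \<in> Lp p t T" and t: "0 \<le> t" "t \<le> T"
  shows "integrable (lebesgue_on {t<..<T}) (\<lambda>s. running_cost l lstar (y s) (v s) s)"
proof -
  let ?M = "lebesgue_on {t<..<T}"
  interpret finite_measure ?M by (rule finite_measure_lebesgue_on) simp
  have "continuous_on {t..T} (\<lambda>s. norm (y s))" by (intro continuous_intros y)
  then have "compact ((\<lambda>s. norm (y s)) ` {t..T})" by (rule compact_continuous_image) simp
  then obtain r where r: "\<And>s. s \<in> {t..T} \<Longrightarrow> \<bar>norm (y s)\<bar> \<le> r"
    unfolding compact_eq_bounded_closed bounded_real by blast
  obtain K where K: "0 \<le> K" "\<And>i y a s. y \<in> {0..r} \<Longrightarrow> s \<in> {0..T} \<Longrightarrow> \<bar>l i y a s\<bar> \<le> K * (\<bar>a\<bar> powr p + 1)"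
    using l_growth by metis
  obtain B where B: "\<And>s. s \<in> {0..T} \<Longrightarrow> \<bar>vertex_cost l lstar s\<bar> \<le> B"
    using vertex_cost_bounds by blast
  have ym[measurable]: "y \<in> borel_measurable ?M" using integrable_lebesgue_on_continuous[OF y] by simp
  have vm[measurable]: "v \<in> borel_measurable ?M" using v by (simp add: Lp_def)
  have idm[measurable]: "(\<lambda>s. s) \<in> borel_measurable ?M"
    using integrable_lebesgue_on_continuous[of t T "\<lambda>s. s"] by (auto intro: continuous_intros)
  have [measurable]: "(\<lambda>s. l i (norm (y s)) (v s) s) \<in> borel_measurable ?M" for i
    using borel_measurable_continuous_on_slab[OF l_cont, of "\<lambda>s. norm (y s)" ?M v "\<lambda>s. s" i] T t by simp
  have [measurable]: "(\<lambda>s. l i 0 0 s) \<in> borel_measurable ?M" for i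
    using borel_measurable_continuous_on_slab[OF l_cont, of "\<lambda>s. 0" ?M "\<lambda>s. 0" "\<lambda>s. s" i] T t by simp
  have [measurable]: "lstar \<in> borel_measurable ?M"
    using integrable_lebesgue_on_continuous[OF continuous_on_subset[OF lstar_cont, of "{t..T}"]] t by auto
  have [measurable]: "(\<lambda>s. indicator (edge i - {0}) (y s) :: real) \<in> borel_measurable ?M" for i
    by (rule measurable_compose[OF ym borel_measurable_indicator[OF edge_Diff_0_borel]])
  have [measurable]: "(\<lambda>s. indicator {0} (y s) :: real) \<in> borel_measurable ?M"
    by (rule measurable_compose[OF ym borel_measurable_indicator]) simp
  have [measurable]: "(\<lambda>s. Min (range (\<lambda>i. l i 0 0 s))) \<in> borel_measurable ?M"
    by (rule borel_measurable_Min) auto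
  have rm: "(\<lambda>s. running_cost l lstar (y s) (v s) s) \<in> borel_measurable ?M"
    unfolding running_cost_def vertex_cost_def by measurable
  have Ki: "integrable ?M (\<lambda>s. K * (\<bar>v s\<bar> powr p + 1) + \<bar>B\<bar>)"
    using v by (auto simp: Lp_def)
  show ?thesis
  proof (rule Bochner_Integration.integrable_bound[OF Ki rm], rule AE_I2)
    fix s assume "s \<in> space ?M"
    then have s: "s \<in> {t..T}" "s \<in> {0..T}" using t by auto
    have K0: "0 \<le> K * (\<bar>v s\<bar> powr p + 1)" using K(1) by simp
    from J[OF s(1)] have "\<bar>running_cost l lstar (y s) (v s) s\<bar> \<le> K * (\<bar>v s\<bar> powr p + 1) + \<bar>B\<bar>"
    proof (cases rule: junction_cases)
      case 1
      then show ?thesis using B[OF s(2)] K0 by (simp add: running_cost_0)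
    next
      case (2 i)
      then show ?thesis using K(2)[of "norm (y s)" s i "v s"] s r[OF s(1)] by (simp add: running_cost_edge[OF 2])
    qed
    then show "norm (running_cost l lstar (y s) (v s) s) \<le> norm (K * (\<bar>v s\<bar> powr p + 1) + \<bar>B\<bar>)"
      using K0 by simp
  qed
qed

lemma trajectory_running_cost_integrable:
  assumes y: "y \<in> trajectories p T t x" and t: "0 \<le> t" "t \<le> T"
  shows "integrable (lebesgue_on {t<..<T}) (\<lambda>s. running_cost l lstar (y s) (speed t y s) s)"
  by (rule running_cost_integrable[OF _ _ trajectory_speed_Lp[OF y t(2)] t])
     (use y in \<open>simp_all add: trajectories_def\<close>)

text \<open>A real infimum is a lower bound only when the set is bounded below; with this,
  optimality becomes a comparison with each competitor.\<close>

lemma cost_bdd_below: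
  assumes t: "0 \<le> t" "t \<le> T"
  shows "bdd_below (cost l lstar g gstar T t ` trajectories p T t x)"
proof -
  let ?M = "lebesgue_on {t<..<T}"
  interpret finite_measure ?M by (rule finite_measure_lebesgue_on) simp
  obtain c C where c: "0 < c" "0 \<le> C" and rc: "\<And>z a s. z \<in> junction \<Longrightarrow> s \<in> {0..T} \<Longrightarrow>
      c * (indicator (- {0}) z * \<bar>a\<bar> powr p) - C \<le> running_cost l lstar z a s"
    using running_cost_lower_bound by blast
  obtain B where B: "\<And>z. z \<in> junction \<Longrightarrow> \<bar>terminal_cost g gstar z\<bar> \<le> B"
    using terminal_cost_bounded by blast
  have "(LINT s|?M. - C) - B \<le> cost l lstar g gstar T t y" if y: "y \<in> trajectories p T t x" for y
  proof -
    have J: "\<And>s. s \<in> {t..T} \<Longrightarrow> y s \<in> junction" using y by (simp add: trajectories_def)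
    have "(LINT s|?M. - C) \<le> (LINT s|?M. running_cost l lstar (y s) (speed t y s) s)"
    proof (rule integral_mono)
      fix s assume "s \<in> space ?M"
      then have s: "y s \<in> junction" "s \<in> {0..T}" using J t by auto
      have "0 \<le> c * (indicator (- {0}) (y s) * \<bar>speed t y s\<bar> powr p)" using c by simp
      then show "- C \<le> running_cost l lstar (y s) (speed t y s) s" using rc[OF s, of "speed t y s"] by linarith
    qed (use trajectory_running_cost_integrable[OF y t] in simp_all)
    moreover have "- B \<le> terminal_cost g gstar (y T)" using B[OF J[of T]] t by auto
    ultimately show ?thesis by (simp add: cost_def)
  qed
  then show ?thesis by (intro bdd_belowI2)
qed

lemma optimal_le:
  assumes "y \<in> opt t x" "z \<in> trajectories p T t x" "0 \<le> t" "t \<le> T"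
  shows "cost l lstar g gstar T t y \<le> cost l lstar g gstar T t z"
  using assms cINF_lower[OF cost_bdd_below[OF assms(3,4), of x] assms(2)]
  by (simp add: optimal_trajectories_def)

text \<open>The bound may depend on \<open>x\<close> and \<open>t\<close> in an arbitrary way, so it is read off from the
  comparison with the constant trajectory.\<close>

lemma energy_bound:
  assumes x: "x \<in> junction" and t: "0 \<le> t" "t \<le> T"
  obtains E where "0 \<le> E"
    "\<And>y. y \<in> opt t x \<Longrightarrow> integrable (lebesgue_on {t<..<T}) (\<lambda>s. indicator (- {0}) (y s) * \<bar>speed t y s\<bar> powr p)"
    "\<And>y. y \<in> opt t x \<Longrightarrow> (LINT s|lebesgue_on {t<..<T}. indicator (- {0}) (y s) * \<bar>speed t y s\<bar> powr p) \<le> E"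
proof -
  let ?M = "lebesgue_on {t<..<T}"
  interpret finite_measure ?M by (rule finite_measure_lebesgue_on) simp
  obtain c C where c: "0 < c" "0 \<le> C" and rc: "\<And>z a s. z \<in> junction \<Longrightarrow> s \<in> {0..T} \<Longrightarrow>
      c * (indicator (- {0}) z * \<bar>a\<bar> powr p) - C \<le> running_cost l lstar z a s"
    using running_cost_lower_bound by blast
  obtain B where B: "\<And>z. z \<in> junction \<Longrightarrow> \<bar>terminal_cost g gstar z\<bar> \<le> B"
    using terminal_cost_bounded by blast
  \<comment> \<open>Obtained by solving c times the energy minus the integral of C \<le> cost of the
    constant path + B, where B absorbs the terminal cost.\<close>
  define E where "E = (cost l lstar g gstar T t (\<lambda>s. x) + B + (LINT s|?M. C)) / c"
  have i: "integrable ?M (\<lambda>s. indicator (- {0}) (y s) * \<bar>speed t y s\<bar> powr p)"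
    and le: "(LINT s|?M. indicator (- {0}) (y s) * \<bar>speed t y s\<bar> powr p) \<le> E" if y: "y \<in> opt t x" for y
  proof -
    have tr: "y \<in> trajectories p T t x" using y by (simp add: optimal_trajectories_def)
    then have J: "\<And>s. s \<in> {t..T} \<Longrightarrow> y s \<in> junction" and yc: "continuous_on {t..T} y"
      by (simp_all add: trajectories_def)
    have ym[measurable]: "y \<in> borel_measurable ?M" using integrable_lebesgue_on_continuous[OF yc] by simp
    have vi: "speed t y \<in> borel_measurable ?M" "integrable ?M (\<lambda>s. \<bar>speed t y s\<bar> powr p)"
      using trajectory_speed_Lp[OF tr t(2)] by (simp_all add: Lp_def)
    have [measurable]: "(\<lambda>s. indicator (- {0}) (y s) :: real) \<in> borel_measurable ?M"
      by (rule measurable_compose[OF ym borel_measurable_indicator]) simp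
    show i: "integrable ?M (\<lambda>s. indicator (- {0}) (y s) * \<bar>speed t y s\<bar> powr p)"
    proof (rule Bochner_Integration.integrable_bound[OF vi(2)])
      show "(\<lambda>s. indicator (- {0}) (y s) * \<bar>speed t y s\<bar> powr p) \<in> borel_measurable ?M"
        using vi(1) by measurable
    qed (auto simp: indicator_def)
    have "c * (LINT s|?M. indicator (- {0}) (y s) * \<bar>speed t y s\<bar> powr p) - (LINT s|?M. C) =
        (LINT s|?M. c * (indicator (- {0}) (y s) * \<bar>speed t y s\<bar> powr p) - C)"
      using i by (subst Bochner_Integration.integral_diff) auto
    also have "\<dots> \<le> (LINT s|?M. running_cost l lstar (y s) (speed t y s) s)"
    proof (rule integral_mono)
      fix s assume "s \<in> space ?M"
      then have s: "y s \<in> junction" "s \<in> {0..T}" using J t by auto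
      then show "c * (indicator (- {0}) (y s) * \<bar>speed t y s\<bar> powr p) - C \<le> running_cost l lstar (y s) (speed t y s) s"
        by (rule rc)
    qed (use i trajectory_running_cost_integrable[OF tr t] in simp_all)
    also have "\<dots> \<le> cost l lstar g gstar T t y + B"
      using B[OF J[of T]] t by (auto simp: cost_def)
    also have "\<dots> \<le> cost l lstar g gstar T t (\<lambda>s. x) + B"
      using optimal_le[OF y constant_trajectory[OF x t(2)] t] by simp
    finally show "(LINT s|?M. indicator (- {0}) (y s) * \<bar>speed t y s\<bar> powr p) \<le> E"
      using c by (simp add: E_def field_simps)
  qed
  \<comment> \<open>The maximum with 0 makes the bound nonnegative also when there is no optimal
    trajectory to read the sign from.\<close>
  show ?thesis
    by (rule that[of "max E 0"]) (use i le in \<open>auto simp: le_max_iff_disj\<close>)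
qed

section \<open>First variation\<close>

text \<open>\<open>\<psi>\<close> perturbs the speed and its primitive \<open>\<phi>\<close> the
  radius, on a closed interval where the path lies in one edge off the vertex. If \<beta> < T,
  \<open>final\<close> makes the perturbed path rejoin the old one at \<beta>; if \<beta> = T the
  end point is free.\<close>

context
  fixes t x y \<alpha> \<beta> i \<psi> B and \<phi> u v :: "real \<Rightarrow> real"
  assumes y: "y \<in> trajectories p T t x" and t: "0 \<le> t" "t \<le> \<alpha>" "\<alpha> \<le> \<beta>" "\<beta> \<le> T"
    and edge: "\<And>s. s \<in> {\<alpha>..\<beta>} \<Longrightarrow> y s \<in> edge i - {0}"
    and \<psi>: "\<psi> \<in> borel_measurable (lebesgue_on {t<..<T})" "\<And>s. \<bar>\<psi> s\<bar> \<le> B"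
      "\<And>s. s \<notin> {\<alpha><..<\<beta>} \<Longrightarrow> \<psi> s = 0"
    and final: "\<beta> < T \<Longrightarrow> integral {t..\<beta>} \<psi> = 0"
    and \<phi>_def: "\<phi> = (\<lambda>s. integral {t..s} \<psi>)"
    and u_def: "u = (\<lambda>s. norm (y s))"
    and v_def: "v = speed t y"
begin

lemma u_nonneg: "0 \<le> u s"
  by (simp add: u_def)

lemma variation_integrable: "integrable (lebesgue_on {t<..<T}) \<psi>"
proof -
  interpret finite_measure "lebesgue_on {t<..<T}" by (rule finite_measure_lebesgue_on) simp
  show ?thesis by (rule integrable_const_bound[of _ B]) (use \<psi> in auto)
qed

lemma variation_integrable_on: "s \<in> {t..T} \<Longrightarrow> \<psi> integrable_on {t..s}"
  by (rule integral_lebesgue_on_indicator(2)[OF variation_integrable]) auto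

lemma variation_outside:
  assumes "s \<in> {t..T}" "s \<notin> {\<alpha>..\<beta>}"
  shows "\<phi> s = 0"
proof (cases "s < \<alpha>")
  case True
  have "integral {t..s} \<psi> = integral {t..s} (\<lambda>s. 0)"
    by (rule integral_cong) (use True \<psi>(3) in auto)
  then show ?thesis by (simp add: \<phi>_def)
next
  case False
  then have s: "\<beta> < s" using assms by auto
  have "integral {\<beta>..s} \<psi> = integral {\<beta>..s} (\<lambda>s. 0)"
    by (rule integral_cong) (use \<psi>(3) in auto)
  moreover have "integral {t..\<beta>} \<psi> + integral {\<beta>..s} \<psi> = integral {t..s} \<psi>"
    by (rule Henstock_Kurzweil_Integration.integral_combine) (use t s assms variation_integrable_on in auto)
  ultimately show ?thesis using final s assms by (simp add: \<phi>_def)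
qed

lemma variation_continuous: "continuous_on {t..T} \<phi>"
  unfolding \<phi>_def by (intro indefinite_integral_continuous_1 variation_integrable_on) (use t in auto)

lemma radius_continuous: "continuous_on {t..T} u"
  using y by (auto simp: u_def trajectories_def intro: continuous_intros)

text \<open>The path is shifted along its own edge by the radial amount \<open>e * \<phi> s\<close>.
  Positivity keeps it off the vertex, so both running costs are given by \<open>l i\<close>;
  elsewhere the paths coincide, and only this interval and the terminal cost contribute.\<close>

lemma
  fixes e :: real
  defines "z \<equiv> (\<lambda>s. y s + (e * \<phi> s) *\<^sub>R axis i 1)"
  assumes pos: "\<And>s. s \<in> {\<alpha>..\<beta>} \<Longrightarrow> 0 < u s + e * \<phi> s"
  shows competitor_edge: "s \<in> {\<alpha>..\<beta>} \<Longrightarrow> z s \<in> edge i - {0} \<and> norm (z s) = u s + e * \<phi> s"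
    and competitor_trajectory: "z \<in> trajectories p T t x"
    and competitor_cost: "cost l lstar g gstar T t z - cost l lstar g gstar T t y =
      (LINT s|lebesgue_on {t<..<T}. indicator {\<alpha>..\<beta>} s *
        (l i (u s + e * \<phi> s) (v s + e * \<psi> s) s - l i (u s) (v s) s)) +
      (terminal_cost g gstar (z T) - terminal_cost g gstar (y T))"
proof -
  let ?M = "lebesgue_on {t<..<T}"
  let ?e = "\<Sum>i\<in>UNIV. axis i 1 :: real ^ 'n"
  have tT: "t \<le> T" using t by linarith
  show zedge: "z s \<in> edge i - {0} \<and> norm (z s) = u s + e * \<phi> s" if s: "s \<in> {\<alpha>..\<beta>}" for s
  proof -
    have "y s = u s *\<^sub>R axis i 1" using edge_eq[of "y s" i] edge[OF s] by (simp add: u_def)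
    then have "z s = (u s + e * \<phi> s) *\<^sub>R axis i 1" by (simp add: z_def scaleR_add_left)
    then show ?thesis using pos[OF s] scaleR_axis_in_edge[of "u s + e * \<phi> s" i] by auto
  qed
  have zout: "z s = y s" if "s \<in> {t..T}" "s \<notin> {\<alpha>..\<beta>}" for s
    using variation_outside[OF that] by (simp add: z_def)
  have J: "\<And>s. s \<in> {t..T} \<Longrightarrow> y s \<in> junction" using y by (simp add: trajectories_def)
  have zJ: "z s \<in> junction" if "s \<in> {t..T}" for s
    using zedge[of s] zout[OF that] J[OF that] edge_subset_junction[of i] by (cases "s \<in> {\<alpha>..\<beta>}") auto
  obtain w where w: "w \<in> Lp p t T" and yw: "\<And>s. s \<in> {t..T} \<Longrightarrow> y s = x + integral {t..s} w"
    using trajectory_velocity[OF y] by blast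
  have wi: "integrable ?M w" by (rule Lp_imp_integrable[OF w]) (use p in simp)
  define wz where "wz = (\<lambda>s. w s + (e * \<psi> s) *\<^sub>R axis i (1::real))"
  have "wz \<in> Lp p t T"
  proof (rule Lp_norm_bound[OF w, where c = 1 and d = "\<bar>e\<bar> * \<bar>B\<bar>"])
    show "wz \<in> borel_measurable ?M" unfolding wz_def using wi \<psi>(1) by measurable
    fix s
    have "norm (wz s) \<le> norm (w s) + \<bar>e\<bar> * \<bar>\<psi> s\<bar>"
      unfolding wz_def by (rule order_trans[OF norm_triangle_ineq]) (simp add: abs_mult)
    also have "\<bar>e\<bar> * \<bar>\<psi> s\<bar> \<le> \<bar>e\<bar> * \<bar>B\<bar>"
      using \<psi>(2)[of s] by (intro mult_left_mono) linarith+
    finally show "norm (wz s) \<le> 1 * (norm (w s) + \<bar>e\<bar> * \<bar>B\<bar>)" by simp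
  qed (use p in auto)
  note wzL = this
  have zw: "z s = x + integral {t..s} wz" if s: "s \<in> {t..T}" for s
  proof -
    have bl: "bounded_linear (\<lambda>r. (e * r) *\<^sub>R axis i (1::real) :: real ^ 'n)"
      by (intro bounded_linear_scaleR_const bounded_linear_mult_right)
    have "(\<psi> has_integral \<phi> s) {t..s}"
      using variation_integrable_on[OF s] by (simp add: \<phi>_def integrable_integral)
    from has_integral_linear[OF this bl]
    have 1: "((\<lambda>r. (e * \<psi> r) *\<^sub>R axis i (1::real)) has_integral ((e * \<phi> s) *\<^sub>R axis i 1)) {t..s}"
      by (simp add: o_def)
    have 2: "(w has_integral integral {t..s} w) {t..s}"
      by (intro integrable_integral integral_lebesgue_on_indicator(2)[OF wi]) (use s in auto)
    have "integral {t..s} wz = integral {t..s} w + (e * \<phi> s) *\<^sub>R axis i 1"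
      unfolding wz_def by (rule integral_unique[OF has_integral_add[OF 2 1]])
    then show ?thesis using yw[OF s] by (simp add: z_def)
  qed
  have tz: "z \<in> trajectories p T t x"
    by (rule trajectoryI[OF wzL tT zw zJ])
  have sz: "AE s in ?M. speed t z s = wz s \<bullet> ?e"
    by (rule speed_AE_eq[OF wzL tT zw zJ])
  show "z \<in> trajectories p T t x" by (rule tz)
  have sy: "AE s in ?M. speed t y s = w s \<bullet> ?e" by (rule speed_AE_eq[OF w tT yw J])
  \<comment> \<open>This turns the vector perturbation of the velocity into exactly
    \<open>e * \<psi> s\<close> for the radial speed.\<close>
  have ax: "axis i 1 \<bullet> ?e = 1"
    using norm_junction_eq_inner[of "axis i (1::real)"] scaleR_axis_in_edge[of 1 i] edge_subset_junction[of i] by auto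
  have sp: "AE s in ?M. speed t z s = v s + e * \<psi> s"
    using sz sy by eventually_elim (simp add: wz_def v_def inner_add_left ax)
  have un: "0 \<le> u s + e * \<phi> s" if "s \<in> {t..T}" for s
    using pos[of s] variation_outside[OF that] by (cases "s \<in> {\<alpha>..\<beta>}") (auto simp: u_def less_imp_le)
  have um[measurable]: "u \<in> borel_measurable ?M" and \<phi>m[measurable]: "\<phi> \<in> borel_measurable ?M"
    using integrable_lebesgue_on_continuous radius_continuous variation_continuous by blast+
  have vm[measurable]: "v \<in> borel_measurable ?M"
    using trajectory_speed_Lp[OF y tT] by (simp add: v_def Lp_def)
  have idm[measurable]: "(\<lambda>s. s) \<in> borel_measurable ?M"
    using integrable_lebesgue_on_continuous[of t T "\<lambda>s. s"] by (auto intro: continuous_intros)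
  note \<psi>(1)[measurable]
  have [measurable]: "(\<lambda>s. l i (u s + e * \<phi> s) (v s + e * \<psi> s) s) \<in> borel_measurable ?M"
    using borel_measurable_continuous_on_slab[OF l_cont, of "\<lambda>s. u s + e * \<phi> s" ?M "\<lambda>s. v s + e * \<psi> s" "\<lambda>s. s" i] T t un
    by simp
  have [measurable]: "(\<lambda>s. l i (u s) (v s) s) \<in> borel_measurable ?M"
    using borel_measurable_continuous_on_slab[OF l_cont, of u ?M v "\<lambda>s. s" i] T t u_nonneg by simp
  have [measurable]: "(\<lambda>s. indicator {\<alpha>..\<beta>} s :: real) \<in> borel_measurable ?M"
    by (rule measurable_compose[OF idm borel_measurable_indicator]) simp
  note iz = trajectory_running_cost_integrable[OF tz t(1) tT]
  note iy = trajectory_running_cost_integrable[OF y t(1) tT]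
  have "(LINT s|?M. running_cost l lstar (z s) (speed t z s) s) - (LINT s|?M. running_cost l lstar (y s) (speed t y s) s) =
    (LINT s|?M. running_cost l lstar (z s) (speed t z s) s - running_cost l lstar (y s) (speed t y s) s)"
    using Bochner_Integration.integral_diff[OF iz iy] by simp
  also have "\<dots> = (LINT s|?M. indicator {\<alpha>..\<beta>} s *
        (l i (u s + e * \<phi> s) (v s + e * \<psi> s) s - l i (u s) (v s) s))"
  proof (rule integral_cong_AE)
    show "AE s in ?M. running_cost l lstar (z s) (speed t z s) s - running_cost l lstar (y s) (speed t y s) s =
      indicator {\<alpha>..\<beta>} s * (l i (u s + e * \<phi> s) (v s + e * \<psi> s) s - l i (u s) (v s) s)"
      using sp AE_space
    proof eventually_elim
      case (elim s)
      then have s: "s \<in> {t..T}" by simp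
      show ?case
      proof (cases "s \<in> {\<alpha>..\<beta>}")
        case True
        then show ?thesis
          using elim zedge[OF True] running_cost_edge[of "z s" i] running_cost_edge[OF edge[OF True]]
          by (simp add: u_def v_def)
      next
        case False
        then have "\<psi> s = 0" using \<psi>(3)[of s] by auto
        then show ?thesis using False elim zout[OF s False] by (simp add: v_def)
      qed
    qed
  qed (use iz iy in measurable)
  finally show "cost l lstar g gstar T t z - cost l lstar g gstar T t y =
      (LINT s|?M. indicator {\<alpha>..\<beta>} s *
        (l i (u s + e * \<phi> s) (v s + e * \<psi> s) s - l i (u s) (v s) s)) +
      (terminal_cost g gstar (z T) - terminal_cost g gstar (y T))"
    by (simp add: cost_def)
qed

text \<open>Difference quotients of the cost along e decreasing to 0 are nonnegative by optimality
  and converge by dominated convergence. One sign of e is enough, since \<open>\<psi>\<close> may be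
  replaced by its negative.\<close>

lemma first_variation:
  assumes opt: "y \<in> opt t x"
  shows "integrable (lebesgue_on {t<..<T}) (\<lambda>s. indicator {\<alpha>..\<beta>} s *
        (dyl i (u s) (v s) s * \<phi> s + dal i (u s) (v s) s * \<psi> s))"
    and "0 \<le> (LINT s|lebesgue_on {t<..<T}. indicator {\<alpha>..\<beta>} s *
        (dyl i (u s) (v s) s * \<phi> s + dal i (u s) (v s) s * \<psi> s)) +
        (if \<beta> = T then dg i (u T) * \<phi> T else 0)"
proof -
  let ?M = "lebesgue_on {t<..<T}"
  interpret finite_measure ?M by (rule finite_measure_lebesgue_on) simp
  have tT: "t \<le> T" using t by linarith
  have sub: "{\<alpha>..\<beta>} \<subseteq> {t..T}" using t by auto
  obtain m where m: "m \<in> {\<alpha>..\<beta>}" "\<And>s. s \<in> {\<alpha>..\<beta>} \<Longrightarrow> u m \<le> u s"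
    using continuous_attains_inf[OF _ _ continuous_on_subset[OF radius_continuous sub]] t by auto
  have um0: "0 < u m" using edge[OF m(1)] by (simp add: u_def)
  obtain R where R: "\<And>s. s \<in> {t..T} \<Longrightarrow> u s \<le> R"
    using continuous_attains_sup[OF _ _ radius_continuous] tT by (metis atLeastatMost_empty_iff2 compact_Icc not_le)
  have "compact (\<phi> ` {t..T})" by (intro compact_continuous_image variation_continuous) simp
  then obtain P' where P': "\<And>s. s \<in> {t..T} \<Longrightarrow> \<bar>\<phi> s\<bar> \<le> P'"
    unfolding compact_eq_bounded_closed bounded_real by blast
  define P where "P = max (max P' B) 1"
  have P: "\<And>s. s \<in> {t..T} \<Longrightarrow> \<bar>\<phi> s\<bar> \<le> P" "\<And>s. \<bar>\<psi> s\<bar> \<le> P" "1 \<le> P"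
    using P' \<psi>(2) by (fastforce simp: P_def le_max_iff_disj)+
  \<comment> \<open>With this choice the radius changes by at most half of its minimum over the
    interval; the 1 is what the increment bound asks for.\<close>
  define e0 where "e0 = min 1 (u m / (2 * P))"
  have e0: "0 < e0" "e0 \<le> 1" "e0 * P \<le> u m / 2"
    using um0 P(3) by (auto simp: e0_def min_def field_simps)
  define E where "E = (\<lambda>n. e0 / (real n + 1))"
  have E: "0 < E n" "E n \<le> e0" "E n \<in> {0..e0}" for n
    using e0 by (auto simp: E_def divide_le_eq mult_le_cancel_left1 mult_le_cancel_left2)
  have E0: "E \<longlonglongrightarrow> 0"
    unfolding E_def by real_asymp
  have bnd: "0 < u s + e * \<phi> s" "u s + e * \<phi> s \<le> R + P" if s: "s \<in> {\<alpha>..\<beta>}" and e: "e \<in> {0..e0}" for e s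
  proof -
    have s': "s \<in> {t..T}" using s sub by auto
    have "\<bar>e * \<phi> s\<bar> \<le> e0 * P"
      using P(1)[OF s'] e e0 by (auto simp: abs_mult intro!: mult_mono)
    then show "0 < u s + e * \<phi> s" using m(2)[OF s] e0(3) um0 by (simp add: abs_le_iff)
    have "e0 * P \<le> 1 * P" using e0 P(3) by (intro mult_right_mono) auto
    then show "u s + e * \<phi> s \<le> R + P" using R[OF s'] \<open>\<bar>e * \<phi> s\<bar> \<le> e0 * P\<close> by (simp add: abs_le_iff)
  qed
  obtain K where K: "0 \<le> K"
    "\<And>i y a s. y \<in> {0..R + P} \<Longrightarrow> s \<in> {0..T} \<Longrightarrow> \<bar>dyl i y a s\<bar> \<le> K * (\<bar>a\<bar> powr p + 1)"
    "\<And>i y a s. y \<in> {0..R + P} \<Longrightarrow> s \<in> {0..T} \<Longrightarrow> \<bar>dal i y a s\<bar> \<le> K * (\<bar>a\<bar> powr (p - 1) + 1)"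
    using l_growth[of "R + P"] by metis
  have um[measurable]: "u \<in> borel_measurable ?M" and \<phi>m[measurable]: "\<phi> \<in> borel_measurable ?M"
    using integrable_lebesgue_on_continuous radius_continuous variation_continuous by blast+
  have vL: "v \<in> Lp p t T" using trajectory_speed_Lp[OF y tT] by (simp add: v_def)
  then have vm[measurable]: "v \<in> borel_measurable ?M" by (simp add: Lp_def)
  have idm[measurable]: "(\<lambda>s. s) \<in> borel_measurable ?M"
    using integrable_lebesgue_on_continuous[of t T "\<lambda>s. s"] by (auto intro: continuous_intros)
  note \<psi>(1)[measurable]
  have [measurable]: "(\<lambda>s. indicator {\<alpha>..\<beta>} s :: real) \<in> borel_measurable ?M"
    by (rule measurable_compose[OF idm borel_measurable_indicator]) simp
  have [measurable]: "(\<lambda>s. dyl i (u s) (v s) s) \<in> borel_measurable ?M"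
    using borel_measurable_continuous_on_slab[OF dyl_cont, of u ?M v "\<lambda>s. s" i] T t u_nonneg by simp
  have [measurable]: "(\<lambda>s. dal i (u s) (v s) s) \<in> borel_measurable ?M"
    using borel_measurable_continuous_on_slab[OF dal_cont, of u ?M v "\<lambda>s. s" i] T t u_nonneg by simp
  have [measurable]: "(\<lambda>s. l i (u s) (v s) s) \<in> borel_measurable ?M"
    using borel_measurable_continuous_on_slab[OF l_cont, of u ?M v "\<lambda>s. s" i] T t u_nonneg by simp
  have un: "0 \<le> u s + E n * \<phi> s" if "s \<in> {t..T}" for s n
    using bnd(1)[OF _ E(3)[of n], of s] variation_outside[OF that]
    by (cases "s \<in> {\<alpha>..\<beta>}") (auto simp: u_def less_imp_le)
  have [measurable]: "(\<lambda>s. l i (u s + E n * \<phi> s) (v s + E n * \<psi> s) s) \<in> borel_measurable ?M" for n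
    using borel_measurable_continuous_on_slab[OF l_cont, of "\<lambda>s. u s + E n * \<phi> s" ?M "\<lambda>s. v s + E n * \<psi> s" "\<lambda>s. s" i] T t un
    by simp
  define F where "F = (\<lambda>n s. indicator {\<alpha>..\<beta>} s * ((l i (u s + E n * \<phi> s) (v s + E n * \<psi> s) s - l i (u s) (v s) s) / E n))"
  define F' where "F' = (\<lambda>s. indicator {\<alpha>..\<beta>} s * (dyl i (u s) (v s) s * \<phi> s + dal i (u s) (v s) s * \<psi> s))"
  have F'm: "F' \<in> borel_measurable ?M" unfolding F'_def by measurable
  have Fm: "F n \<in> borel_measurable ?M" for n unfolding F_def by measurable
  have lim: "AE s in ?M. (\<lambda>n. F n s) \<longlonglongrightarrow> F' s"
  proof (rule AE_I2)
    fix s assume "s \<in> space ?M"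
    then have s0: "s \<in> {0..T}" using t by simp
    show "(\<lambda>n. F n s) \<longlonglongrightarrow> F' s"
    proof (cases "s \<in> {\<alpha>..\<beta>}")
      case True
      have "((\<lambda>e. l i (u s + e * \<phi> s) (v s + e * \<psi> s) s) has_real_derivative
          (dyl i (u s + 0 * \<phi> s) (v s + 0 * \<psi> s) s * \<phi> s + dal i (u s + 0 * \<phi> s) (v s + 0 * \<psi> s) s * \<psi> s)) (at 0 within {0..e0})"
        by (rule l_derivative_along) (use bnd(1)[OF True, of 0] bnd(1)[OF True, of e0] e0 s0 in auto)
      then have "((\<lambda>e. (l i (u s + e * \<phi> s) (v s + e * \<psi> s) s - l i (u s) (v s) s) / e) \<longlongrightarrow>
          (dyl i (u s) (v s) s * \<phi> s + dal i (u s) (v s) s * \<psi> s)) (at 0 within {0..e0})"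
        by (simp add: has_field_derivative_iff)
      moreover have "filterlim E (at 0 within {0..e0}) sequentially"
        unfolding filterlim_at using E0 E(1,3) by (auto intro!: always_eventually simp: less_imp_neq[THEN not_sym])
      ultimately have "(\<lambda>n. (l i (u s + E n * \<phi> s) (v s + E n * \<psi> s) s - l i (u s) (v s) s) / E n) \<longlonglongrightarrow>
          (dyl i (u s) (v s) s * \<phi> s + dal i (u s) (v s) s * \<psi> s)"
        by (rule filterlim_compose)
      then show ?thesis using True by (simp add: F_def F'_def)
    qed (simp add: F_def F'_def)
  qed
  define Q where "Q = (\<lambda>s. 2 * P * K * ((\<bar>v s\<bar> + P) powr p + 2))"
  have Qi: "integrable ?M Q"
  proof -
    have "(\<lambda>s. \<bar>v s\<bar> + P) \<in> Lp p t T"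
      by (rule Lp_norm_bound[OF vL, of _ 1 P]) (use vm P(3) p in auto)
    then show ?thesis using P(3) by (simp add: Q_def Lp_def)
  qed
  have Fb: "AE s in ?M. norm (F n s) \<le> Q s" for n
  proof (rule AE_I2)
    fix s assume "s \<in> space ?M"
    then have s0: "s \<in> {0..T}" "s \<in> {t..T}" using t by auto
    have "0 \<le> Q s" using P(3) K(1) by (simp add: Q_def)
    moreover have "\<bar>(l i (u s + E n * \<phi> s) (v s + E n * \<psi> s) s - l i (u s) (v s) s) / E n\<bar> \<le> Q s"
      if s: "s \<in> {\<alpha>..\<beta>}"
      unfolding Q_def
    proof (rule l_increment_bound[where r = "R + P"])
      show "u s \<in> {0..R + P}" using bnd[OF s, of 0] e0 by auto
      show "u s + E n * \<phi> s \<in> {0..R + P}" using bnd[OF s E(3)] by (simp add: less_imp_le)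
      show "E n \<le> 1" using E(2)[of n] e0 by simp
    qed (use K E P s0 in auto)
    ultimately show "norm (F n s) \<le> Q s"
      by (cases "s \<in> {\<alpha>..\<beta>}") (auto simp: F_def abs_mult)
  qed
  show F'i: "integrable ?M F'"
    by (rule integrable_dominated_convergence[OF F'm Fm Qi lim Fb])
  have IF: "(\<lambda>n. LINT s|?M. F n s) \<longlonglongrightarrow> (LINT s|?M. F' s)"
    by (rule integral_dominated_convergence[OF F'm Fm Qi lim Fb])
  define z where "z = (\<lambda>n s. y s + (E n * \<phi> s) *\<^sub>R axis i 1)"
  define G where "G = (\<lambda>n. (terminal_cost g gstar (z n T) - terminal_cost g gstar (y T)) / E n)"
  have G: "G \<longlonglongrightarrow> (if \<beta> = T then dg i (u T) * \<phi> T else 0)"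
  proof (cases "\<beta> = T")
    case True
    have T': "T \<in> {\<alpha>..\<beta>}" using t True by auto
    have uT: "0 < u T" using edge[OF T'] by (simp add: u_def)
    \<comment> \<open>The end point lies off the vertex, so the derivative of \<open>g i\<close> is
      two-sided there.\<close>
    have "at (u T) within {0..} = at (u T)" by (rule at_within_interior) (use uT in simp)
    then have "(g i has_real_derivative dg i (u T)) (at (u T + 0 * \<phi> T))"
      using g_deriv[of "u T" i] uT by simp
    moreover have "((\<lambda>e. u T + e * \<phi> T) has_real_derivative \<phi> T) (at 0)"
      by (auto intro!: derivative_eq_intros)
    ultimately have "((\<lambda>e. g i (u T + e * \<phi> T)) has_real_derivative dg i (u T) * \<phi> T) (at 0)"
      by (rule DERIV_chain2)
    then have "((\<lambda>e. (g i (u T + e * \<phi> T) - g i (u T)) / e) \<longlongrightarrow> dg i (u T) * \<phi> T) (at 0)"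
      by (simp add: has_field_derivative_iff)
    moreover have "filterlim E (at 0) sequentially"
      unfolding filterlim_at using E0 E(1) by (auto intro!: always_eventually simp: less_imp_neq[THEN not_sym])
    ultimately have "(\<lambda>n. (g i (u T + E n * \<phi> T) - g i (u T)) / E n) \<longlonglongrightarrow> dg i (u T) * \<phi> T"
      by (rule filterlim_compose)
    moreover have "terminal_cost g gstar (z n T) = g i (u T + E n * \<phi> T)" for n
      using competitor_edge[of "E n" T, OF bnd(1)[OF _ E(3)] T'] terminal_cost_edge[of "z n T" i]
      by (simp add: z_def)
    moreover have "terminal_cost g gstar (y T) = g i (u T)"
      using terminal_cost_edge[OF edge[OF T']] by (simp add: u_def)
    ultimately show ?thesis using True by (simp add: G_def)
  next
    case False
    then have "\<phi> T = 0" using variation_outside[of T] t by auto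
    then show ?thesis using False by (simp add: G_def z_def)
  qed
  have "0 \<le> (LINT s|?M. F n s) + G n" for n
  proof -
    note pos = bnd(1)[OF _ E(3)[of n]]
    have "0 \<le> cost l lstar g gstar T t (z n) - cost l lstar g gstar T t y"
      using optimal_le[OF opt competitor_trajectory[OF pos] t(1) tT] by (simp add: z_def)
    also have "\<dots> = (LINT s|?M. indicator {\<alpha>..\<beta>} s *
        (l i (u s + E n * \<phi> s) (v s + E n * \<psi> s) s - l i (u s) (v s) s)) +
      (terminal_cost g gstar (z n T) - terminal_cost g gstar (y T))"
      unfolding z_def by (rule competitor_cost[OF pos])
    finally have "0 \<le> \<dots> / E n" using E(1)[of n] by (simp add: less_imp_le)
    also have "\<dots> = (LINT s|?M. F n s) + G n"
      unfolding F_def G_def add_divide_distrib times_divide_eq_right[symmetric] by simp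
    finally show ?thesis .
  qed
  with tendsto_add[OF IF G] show "0 \<le> (LINT s|?M. F' s) + (if \<beta> = T then dg i (u T) * \<phi> T else 0)"
    by (intro LIMSEQ_le_const) auto
qed

end

section \<open>Momentum and speed bounds\<close>

context
  fixes t x y E and u v :: "real \<Rightarrow> real"
  assumes opt: "y \<in> opt t x" and t: "0 \<le> t" "t \<le> T"
    and E0: "0 \<le> E"
    and Ei: "integrable (lebesgue_on {t<..<T}) (\<lambda>s. indicator (- {0}) (y s) * \<bar>speed t y s\<bar> powr p)"
    and E: "(LINT s|lebesgue_on {t<..<T}. indicator (- {0}) (y s) * \<bar>speed t y s\<bar> powr p) \<le> E"
    and u_def: "u = (\<lambda>s. norm (y s))"
    and v_def: "v = speed t y"
begin

lemma opt_trajectory: "y \<in> trajectories p T t x"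
  using opt by (simp add: optimal_trajectories_def)

text \<open>If the momentum exceeds m by more than \<open>K * (E + T)\<close> on A, this
  \<open>\<psi>\<close> makes the first variation at most K(E + T) + m - (m + K(E + T) + 1) = -1,
  against optimality. The value m is the average over B or, when B is empty, the bound for the
  terminal term. The sign \<open>\<sigma>\<close> gives bounds from both sides.\<close>

lemma momentum_test_pair:
  assumes \<alpha>\<beta>: "t \<le> \<alpha>" "\<alpha> \<le> \<beta>" "\<beta> \<le> T"
    and edge: "\<And>s. s \<in> {\<alpha>..\<beta>} \<Longrightarrow> y s \<in> edge i - {0}"
    and \<sigma>: "\<bar>\<sigma>\<bar> = 1"
    and A: "A \<in> sets (lebesgue_on {t<..<T})" "A \<subseteq> {\<alpha><..<\<beta>}" "0 < measure (lebesgue_on {t<..<T}) A"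
    and B: "B \<in> sets (lebesgue_on {t<..<T})" "B \<subseteq> {\<alpha><..<\<beta>}"
    and K: "0 \<le> K" "\<And>s. s \<in> {\<alpha>..\<beta>} \<Longrightarrow> \<bar>dyl i (u s) (v s) s\<bar> \<le> K * (\<bar>v s\<bar> powr p + 1)"
    and m: "0 \<le> m"
    and alt: "0 < measure (lebesgue_on {t<..<T}) B \<and> (\<forall>s\<in>B. \<sigma> * dal i (u s) (v s) s \<le> m) \<or>
      B = {} \<and> \<beta> = T \<and> \<bar>dg i (u T)\<bar> \<le> m"
    and large: "\<And>s. s \<in> A \<Longrightarrow> m + K * (E + T) + 1 \<le> \<sigma> * dal i (u s) (v s) s"
  shows False
proof -
  let ?M = "lebesgue_on {t<..<T}"
  interpret finite_measure ?M by (rule finite_measure_lebesgue_on) simp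
  \<comment> \<open>For empty B the first quotient is 0 / 0 = 0: only the term with A remains, and
    the end point moves by \<open>- \<sigma>\<close>.\<close>
  define \<psi> where "\<psi> = (\<lambda>s. \<sigma> * (indicator B s / measure ?M B - indicator A s / measure ?M A))"
  define \<phi> where "\<phi> = (\<lambda>s. integral {t..s} \<psi>)"
  have ind: "integrable ?M (indicator A :: _ \<Rightarrow> real)" "integrable ?M (indicator B :: _ \<Rightarrow> real)"
    using A(1) B(1) by (simp_all add: emeasure_eq_measure)
  then have \<psi>i: "integrable ?M \<psi>" by (simp add: \<psi>_def)
  have \<phi>: "\<phi> s = \<sigma> * (measure ?M (B \<inter> {t..s}) / measure ?M B - measure ?M (A \<inter> {t..s}) / measure ?M A)"
    and IntM: "B \<inter> {t..s} \<in> sets ?M" "A \<inter> {t..s} \<in> sets ?M" if s: "s \<in> {t..T}" for s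
  proof -
    have "C \<inter> ({t<..<T} \<inter> {t..s}) \<in> sets ?M" if "C \<in> sets ?M" for C
      by (rule sets.Int[OF that]) (auto simp: sets_restrict_space_iff)
    moreover have "C \<inter> ({t<..<T} \<inter> {t..s}) = C \<inter> {t..s}" if "C \<in> sets ?M" for C
      using sets.sets_into_space[OF that] by auto
    ultimately show CM: "B \<inter> {t..s} \<in> sets ?M" "A \<inter> {t..s} \<in> sets ?M"
      using A(1) B(1) by metis+
    have sp: "B \<inter> {t..s} \<inter> {t<..<T} = B \<inter> {t..s}" "A \<inter> {t..s} \<inter> {t<..<T} = A \<inter> {t..s}"
      using sets.sets_into_space[OF CM(1)] sets.sets_into_space[OF CM(2)] by auto
    have "\<phi> s = (LINT r|?M. indicator {t..s} r *\<^sub>R \<psi> r)"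
      unfolding \<phi>_def by (rule integral_lebesgue_on_indicator(1)[OF \<psi>i, symmetric]) (use s in auto)
    also have "\<dots> = (LINT r|?M. \<sigma> * (indicator (B \<inter> {t..s}) r / measure ?M B - indicator (A \<inter> {t..s}) r / measure ?M A))"
      by (rule Bochner_Integration.integral_cong) (auto simp: \<psi>_def indicator_def)
    also have "\<dots> = \<sigma> * (measure ?M (B \<inter> {t..s}) / measure ?M B - measure ?M (A \<inter> {t..s}) / measure ?M A)"
      using CM by (subst integral_mult_right_zero, subst Bochner_Integration.integral_diff)
        (simp_all add: emeasure_eq_measure sp)
    finally show "\<phi> s = \<sigma> * (measure ?M (B \<inter> {t..s}) / measure ?M B - measure ?M (A \<inter> {t..s}) / measure ?M A)" .
  qed
  \<comment> \<open>A difference of two fractions in [0, 1]. This bound, free of the sizes of A and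
    B, is what makes the momentum estimate independent of the interval.\<close>
  have \<phi>1: "\<bar>\<phi> s\<bar> \<le> 1" if s: "s \<in> {t..T}" for s
  proof -
    have "0 \<le> measure ?M (C \<inter> {t..s}) / measure ?M C \<and> measure ?M (C \<inter> {t..s}) / measure ?M C \<le> 1" if "C \<in> sets ?M" for C
      using finite_measure_mono[OF _ that, of "C \<inter> {t..s}"]
      by (cases "measure ?M C = 0") (auto simp: divide_le_eq_1 zero_less_measure_iff)
    from this[OF A(1)] this[OF B(1)]
    have "\<bar>measure ?M (B \<inter> {t..s}) / measure ?M B - measure ?M (A \<inter> {t..s}) / measure ?M A\<bar> \<le> 1"
      by linarith
    then show ?thesis by (simp add: \<phi>[OF s] abs_mult \<sigma>)
  qed
  have "A \<inter> {t..\<beta>} = A" "B \<inter> {t..\<beta>} = B" using A(2) B(2) \<alpha>\<beta> by auto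
  then have \<phi>\<beta>: "\<phi> \<beta> = \<sigma> * (measure ?M B / measure ?M B - 1)"
    using A(3) \<alpha>\<beta> by (simp add: \<phi>)
  have nonempty: "\<beta> = T" if "measure ?M B = 0" using alt that by auto
  define b where "b = 1 / measure ?M A + 1 / measure ?M B"
  have \<psi>b: "\<bar>\<psi> s\<bar> \<le> b" for s
  proof -
    have "0 \<le> 1 / measure ?M A" "0 \<le> 1 / measure ?M B" by simp_all
    moreover from this have "\<bar>1 / measure ?M B - 1 / measure ?M A\<bar> \<le> b" unfolding b_def by linarith
    ultimately show ?thesis by (auto simp: \<psi>_def b_def abs_mult \<sigma> indicator_def)
  qed
  have \<psi>0: "\<psi> s = 0" if "s \<notin> {\<alpha><..<\<beta>}" for s
    using that A(2) B(2) by (auto simp: \<psi>_def indicator_def)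
  have fin: "integral {t..\<beta>} \<psi> = 0" if "\<beta> < T"
    using \<phi>\<beta> nonempty that by (cases "measure ?M B = 0") (auto simp: \<phi>_def)
  note FV = first_variation[OF opt_trajectory t(1) \<alpha>\<beta> edge _ \<psi>b \<psi>0 fin \<phi>_def u_def v_def opt]
  have \<psi>m: "\<psi> \<in> borel_measurable ?M" using \<psi>i by simp
  define F where "F = (\<lambda>s. indicator {\<alpha>..\<beta>} s * (dyl i (u s) (v s) s * \<phi> s + dal i (u s) (v s) s * \<psi> s))"
  have Fi: "integrable ?M F"
    unfolding F_def by (rule FV(1)) (use \<psi>m in auto)
  have F0: "0 \<le> (LINT s|?M. F s) + (if \<beta> = T then dg i (u T) * \<phi> T else 0)"
    unfolding F_def by (rule FV(2)) (use \<psi>m in auto)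
  \<comment> \<open>Pointwise majorant of the integrand: its first part integrates to at most K(E +
    T), the others to exact multiples of the normalised measures.\<close>
  define H where "H = (\<lambda>s. K * (indicator (- {0}) (y s) * \<bar>v s\<bar> powr p + 1) +
      (m * (indicator B s / measure ?M B) - (m + K * (E + T) + 1) * (indicator A s / measure ?M A)))"
  have Ei': "integrable ?M (\<lambda>s. indicator (- {0}) (y s) * \<bar>v s\<bar> powr p)" using Ei by (simp add: v_def)
  have H1: "integrable ?M (\<lambda>s. K * (indicator (- {0}) (y s) * \<bar>v s\<bar> powr p + 1))"
    using Ei' by (intro integrable_mult_right Bochner_Integration.integrable_add) auto
  have H2: "integrable ?M (\<lambda>s. m * (indicator B s / measure ?M B))"
    and H3: "integrable ?M (\<lambda>s. (m + K * (E + T) + 1) * (indicator A s / measure ?M A))"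
    using ind by (intro integrable_mult_right integrable_divide; simp)+
  have "(LINT s|?M. F s) \<le> (LINT s|?M. H s)"
  proof (rule integral_mono[OF Fi])
    show "integrable ?M H" unfolding H_def
      using H1 H2 H3 by (intro Bochner_Integration.integrable_add Bochner_Integration.integrable_diff)
    fix s assume "s \<in> space ?M"
    then have s: "s \<in> {t..T}" by simp
    show "F s \<le> H s"
    proof (cases "s \<in> {\<alpha>..\<beta>}")
      case True
      have "dyl i (u s) (v s) s * \<phi> s \<le> \<bar>dyl i (u s) (v s) s\<bar> * \<bar>\<phi> s\<bar>"
        by (metis abs_ge_self abs_mult)
      also have "\<dots> \<le> (K * (\<bar>v s\<bar> powr p + 1)) * 1"
        by (intro mult_mono K(2)[OF True] \<phi>1[OF s]) (use K(1) in auto)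
      finally have 1: "dyl i (u s) (v s) s * \<phi> s \<le> K * (indicator (- {0}) (y s) * \<bar>v s\<bar> powr p + 1)"
        using edge[OF True] by simp
      define d where "d = \<sigma> * dal i (u s) (v s) s"
      have "d * (indicator B s / measure ?M B) \<le> m * (indicator B s / measure ?M B)"
        using alt by (cases "s \<in> B") (auto simp: d_def intro!: divide_right_mono)
      moreover have "(m + K * (E + T) + 1) * (indicator A s / measure ?M A) \<le> d * (indicator A s / measure ?M A)"
        using large[of s] by (cases "s \<in> A") (auto simp: d_def intro!: divide_right_mono)
      moreover have "dal i (u s) (v s) s * \<psi> s = d * (indicator B s / measure ?M B) - d * (indicator A s / measure ?M A)"
        by (simp add: \<psi>_def d_def algebra_simps)
      ultimately show ?thesis using 1 True by (simp add: F_def H_def)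
    next
      case False
      then have "indicator A s = (0::real)" "indicator B s = (0::real)" using A(2) B(2) by (auto simp: indicator_def)
      then show ?thesis using False K(1) by (simp add: F_def H_def)
    qed
  qed
  also have "(LINT s|?M. H s) = K * ((LINT s|?M. indicator (- {0}) (y s) * \<bar>v s\<bar> powr p) + (T - t)) +
      (m * (measure ?M B / measure ?M B) - (m + K * (E + T) + 1))"
  proof -
    have sp: "measure ?M (space ?M) = T - t" using t by (simp add: measure_restrict_space)
    have AB: "A \<inter> {t<..<T} = A" "B \<inter> {t<..<T} = B"
      using sets.sets_into_space[OF A(1)] sets.sets_into_space[OF B(1)] by auto
    have "(LINT s|?M. H s) = (LINT s|?M. K * (indicator (- {0}) (y s) * \<bar>v s\<bar> powr p + 1)) +
       ((LINT s|?M. m * (indicator B s / measure ?M B)) - (LINT s|?M. (m + K * (E + T) + 1) * (indicator A s / measure ?M A)))"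
      unfolding H_def using H1 H2 H3 by (simp add: Bochner_Integration.integral_add Bochner_Integration.integral_diff)
    moreover have "(LINT s|?M. K * (indicator (- {0}) (y s) * \<bar>v s\<bar> powr p + 1)) =
       K * ((LINT s|?M. indicator (- {0}) (y s) * \<bar>v s\<bar> powr p) + (T - t))"
      using Ei' sp by (subst integral_mult_right_zero, subst Bochner_Integration.integral_add) auto
    moreover have "(LINT s|?M. m * (indicator B s / measure ?M B)) = m * (measure ?M B / measure ?M B)"
      using B(1) by (simp add: emeasure_eq_measure AB)
    moreover have "(LINT s|?M. (m + K * (E + T) + 1) * (indicator A s / measure ?M A)) = m + K * (E + T) + 1"
      using A(1,3) by (simp add: emeasure_eq_measure AB)
    ultimately show ?thesis by simp
  qed
  also have "\<dots> \<le> K * (E + T) + (m * (measure ?M B / measure ?M B) - (m + K * (E + T) + 1))"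
    using K(1) E t by (intro add_right_mono mult_left_mono) (auto simp: v_def)
  finally have le: "(LINT s|?M. F s) \<le> m * (measure ?M B / measure ?M B) - m - 1" by simp
  from alt show False
  proof
    assume "0 < measure ?M B \<and> (\<forall>s\<in>B. \<sigma> * dal i (u s) (v s) s \<le> m)"
    then show False using le F0 \<phi>\<beta> by (auto split: if_splits)
  next
    assume B0: "B = {} \<and> \<beta> = T \<and> \<bar>dg i (u T)\<bar> \<le> m"
    have "dg i (u T) * \<phi> T \<le> \<bar>dg i (u T)\<bar> * \<bar>\<phi> T\<bar>" by (metis abs_ge_self abs_mult)
    also have "\<dots> \<le> m * 1" using B0 \<phi>1[of T] t m by (intro mult_mono) auto
    finally show False using B0 le F0 by auto
  qed
qed

text \<open>The set where the bound fails, and the set where the momentum is at most m, keep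
  positive measure after the open interval is shrunk, so the test pair applies on a smaller
  interval.\<close>

lemma momentum_AE_le:
  assumes ab: "t \<le> a" "a < b" "b \<le> T"
    and edge: "\<And>s. s \<in> {a<..<b} \<Longrightarrow> y s \<in> edge i - {0}"
    and \<sigma>: "\<bar>\<sigma>\<bar> = 1"
    and K: "0 \<le> K" "\<And>s. s \<in> {a..b} \<Longrightarrow> \<bar>dyl i (u s) (v s) s\<bar> \<le> K * (\<bar>v s\<bar> powr p + 1)"
    and m: "0 \<le> m"
    and alt: "\<not> (AE s in lebesgue_on {t<..<T}. s \<in> {a<..<b} \<longrightarrow> \<not> \<sigma> * dal i (u s) (v s) s \<le> m) \<or>
      b = T \<and> y T \<in> edge i - {0} \<and> \<bar>dg i (u T)\<bar> \<le> m"
  shows "AE s in lebesgue_on {t<..<T}. s \<in> {a<..<b} \<longrightarrow> \<sigma> * dal i (u s) (v s) s \<le> m + K * (E + T) + 1"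
proof (rule ccontr)
  let ?M = "lebesgue_on {t<..<T}"
  interpret finite_measure ?M by (rule finite_measure_lebesgue_on) simp
  let ?P = "\<lambda>s. \<sigma> * dal i (u s) (v s) s"
  let ?m = "m + K * (E + T) + 1"
  let ?I = "\<lambda>n::nat. {a + 1 / (real n + 1)<..<b - 1 / (real n + 1)}"
  assume neg: "\<not> (AE s in ?M. s \<in> {a<..<b} \<longrightarrow> ?P s \<le> ?m)"
  have uc: "continuous_on {t..T} u"
    using opt_trajectory by (auto simp: u_def trajectories_def intro: continuous_intros)
  have um[measurable]: "u \<in> borel_measurable ?M"
    using integrable_lebesgue_on_continuous[OF uc] by simp
  have vm[measurable]: "v \<in> borel_measurable ?M"
    using trajectory_speed_Lp[OF opt_trajectory t(2)] by (simp add: v_def Lp_def)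
  have idm[measurable]: "(\<lambda>s. s) \<in> borel_measurable ?M"
    using integrable_lebesgue_on_continuous[of t T "\<lambda>s. s"] by (auto intro: continuous_intros)
  have u0: "0 \<le> u s" for s by (simp add: u_def)
  have Pm[measurable]: "?P \<in> borel_measurable ?M"
    using borel_measurable_continuous_on_slab[OF dal_cont, of u ?M v "\<lambda>s. s" i] T t u0 by simp
  have int_sets: "S \<inter> {c<..<d} \<in> sets ?M" if "S \<in> sets ?M" for S c d
  proof -
    have "S \<inter> ({t<..<T} \<inter> {c<..<d}) \<in> sets ?M"
      by (rule sets.Int[OF that]) (auto simp: sets_restrict_space_iff)
    moreover have "S \<subseteq> {t<..<T}" using sets.sets_into_space[OF that] by simp
    moreover have "S \<inter> ({t<..<T} \<inter> {c<..<d}) = S \<inter> {c<..<d}" using calculation(2) by auto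
    ultimately show ?thesis by metis
  qed
  have pos: "0 < measure ?M {s \<in> space ?M. s \<in> {a<..<b} \<and> Q s}"
    if "\<not> (AE s in ?M. s \<in> {a<..<b} \<longrightarrow> \<not> Q s)" and "{s \<in> space ?M. s \<in> {a<..<b} \<and> Q s} \<in> sets ?M" for Q
  proof (rule ccontr)
    assume "\<not> 0 < measure ?M {s \<in> space ?M. s \<in> {a<..<b} \<and> Q s}"
    then have "{s \<in> space ?M. s \<in> {a<..<b} \<and> Q s} \<in> null_sets ?M"
      using that(2) by (auto simp: emeasure_eq_measure measure_le_0_iff not_less)
    then have "AE s in ?M. s \<in> {a<..<b} \<longrightarrow> \<not> Q s"
      by (intro AE_I'[of "{s \<in> space ?M. s \<in> {a<..<b} \<and> Q s}"]) auto
    then show False using that(1) by simp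
  qed
  define A where "A = {s \<in> space ?M. s \<in> {a<..<b} \<and> \<not> ?P s \<le> ?m}"
  have AM: "A \<in> sets ?M" unfolding A_def by measurable
  have A: "0 < measure ?M A" unfolding A_def by (rule pos) (use neg AM in \<open>auto simp: A_def\<close>)
  have evA: "\<forall>\<^sub>F n in sequentially. 0 < measure ?M (A \<inter> ?I n)"
    by (rule measure_Int_shrinking_interval_pos[OF AM _ A]) (auto simp: A_def)
  have ne: "a + 1 / (real n + 1) < b - 1 / (real n + 1)" if "0 < measure ?M (S \<inter> ?I n)" for S n
    using that by (cases "?I n = {}") auto
  have h: "0 < 1 / (real n + 1)" for n by simp
  have ah: "a < s" if "a + 1 / (real n + 1) \<le> s" for s n using that h[of n] by linarith
  have bh: "s < b" if "s \<le> b - 1 / (real n + 1)" for s n using that h[of n] by linarith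
  from alt show False
  proof
    assume B0: "\<not> (AE s in ?M. s \<in> {a<..<b} \<longrightarrow> \<not> ?P s \<le> m)"
    define B where "B = {s \<in> space ?M. s \<in> {a<..<b} \<and> ?P s \<le> m}"
    have BM: "B \<in> sets ?M" unfolding B_def by measurable
    have B: "0 < measure ?M B" unfolding B_def by (rule pos) (use B0 BM in \<open>auto simp: B_def\<close>)
    have "\<forall>\<^sub>F n in sequentially. 0 < measure ?M (B \<inter> ?I n)"
      by (rule measure_Int_shrinking_interval_pos[OF BM _ B]) (auto simp: B_def)
    with evA have "\<forall>\<^sub>F n in sequentially. 0 < measure ?M (A \<inter> ?I n) \<and> 0 < measure ?M (B \<inter> ?I n)"
      by (rule eventually_conj)
    then obtain n where n: "0 < measure ?M (A \<inter> ?I n)" "0 < measure ?M (B \<inter> ?I n)"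
      using eventually_happens[of _ sequentially] by auto
    show False
    proof (rule momentum_test_pair[where \<alpha> = "a + 1 / (real n + 1)" and \<beta> = "b - 1 / (real n + 1)"
          and A = "A \<inter> ?I n" and B = "B \<inter> ?I n" and i = i and \<sigma> = \<sigma> and K = K and m = m])
      show "t \<le> a + 1 / (real n + 1)" "b - 1 / (real n + 1) \<le> T" using ab h[of n] by linarith+
      show "a + 1 / (real n + 1) \<le> b - 1 / (real n + 1)" using ne[OF n(1)] by simp
      show "y s \<in> edge i - {0}" if "s \<in> {a + 1 / (real n + 1)..b - 1 / (real n + 1)}" for s
        by (rule edge) (use that ah[of n s] bh[of s n] in auto)
      show "\<bar>dyl i (u s) (v s) s\<bar> \<le> K * (\<bar>v s\<bar> powr p + 1)"
        if "s \<in> {a + 1 / (real n + 1)..b - 1 / (real n + 1)}" for s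
        by (rule K(2)) (use that ah[of n s] bh[of s n] in auto)
      show "0 < measure ?M (B \<inter> ?I n) \<and> (\<forall>s\<in>B \<inter> ?I n. ?P s \<le> m) \<or> B \<inter> ?I n = {} \<and> b - 1 / (real n + 1) = T \<and> \<bar>dg i (u T)\<bar> \<le> m"
        using n(2) by (auto simp: B_def)
      show "?m \<le> ?P s" if "s \<in> A \<inter> ?I n" for s using that by (auto simp: A_def)
    qed (use n \<sigma> K(1) m int_sets[OF AM] int_sets[OF BM] in auto)
  next
    assume bT: "b = T \<and> y T \<in> edge i - {0} \<and> \<bar>dg i (u T)\<bar> \<le> m"
    obtain n where n: "0 < measure ?M (A \<inter> ?I n)"
      using evA eventually_happens[of _ sequentially] by auto
    \<comment> \<open>At a free end only the left end point is moved inwards: \<open>y T\<close>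
      itself is off the vertex, and the variation has to reach T.\<close>
    let ?A = "A \<inter> {a + 1 / (real n + 1)<..<T}"
    have AAM: "?A \<in> sets ?M" by (rule int_sets[OF AM])
    have "measure ?M (A \<inter> ?I n) \<le> measure ?M ?A"
      by (rule finite_measure_mono[OF _ AAM]) (use bT bh[of _ n] in force)
    then have AA: "0 < measure ?M ?A" using n by simp
    show False
    proof (rule momentum_test_pair[where \<alpha> = "a + 1 / (real n + 1)" and \<beta> = T
          and A = ?A and B = "{}" and i = i and \<sigma> = \<sigma> and K = K and m = m])
      show "t \<le> a + 1 / (real n + 1)" using ab h[of n] by linarith
      show "a + 1 / (real n + 1) \<le> T" using ne[OF n] h[of n] bT by linarith
      show "y s \<in> edge i - {0}" if "s \<in> {a + 1 / (real n + 1)..T}" for s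
        using edge[of s] bT that ah[of n s] by (cases "s = T") auto
      show "\<bar>dyl i (u s) (v s) s\<bar> \<le> K * (\<bar>v s\<bar> powr p + 1)"
        if "s \<in> {a + 1 / (real n + 1)..T}" for s
        by (rule K(2)) (use that ah[of n s] bT in auto)
      show "?m \<le> ?P s" if "s \<in> ?A" for s using that by (auto simp: A_def)
    qed (use AAM AA \<sigma> K(1) m bT in auto)
  qed
qed

section \<open>Increments of the radial coordinate\<close>

lemma speed_integrable: "integrable (lebesgue_on {t<..<T}) v"
  unfolding v_def by (rule Lp_imp_integrable[OF trajectory_speed_Lp[OF opt_trajectory t(2)]]) (use p in simp)

lemma radius_increment:
  assumes "t \<le> a" "a \<le> b" "b \<le> T"
  shows "u b - u a = integral {a..b} v"
proof -
  have "v integrable_on {t..b}"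
    by (rule integral_lebesgue_on_indicator(2)[OF speed_integrable]) (use assms in auto)
  from Henstock_Kurzweil_Integration.integral_combine[OF assms(1,2) this] show ?thesis
    using trajectory_norm[OF opt_trajectory t(2), of a] trajectory_norm[OF opt_trajectory t(2), of b] assms
    by (simp add: u_def v_def)
qed

text \<open>Pointwise Young inequality, integrated. With weight 1 it bounds the radius; with a small
  weight it bounds from below the time needed to reach the vertex.\<close>

lemma integral_speed_le:
  assumes ab: "t \<le> a" "a \<le> b" "b \<le> T" and pos: "\<And>s. s \<in> {a<..<b} \<Longrightarrow> 0 < u s" and \<eta>: "0 < \<eta>"
  shows "\<bar>integral {a..b} v\<bar> \<le> \<eta> * E + (1 / \<eta>) powr (1 / (p - 1)) * (b - a)"
proof -
  let ?M = "lebesgue_on {t<..<T}"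
  define C where "C = (1 / \<eta>) powr (1 / (p - 1))"
  define f where "f = (\<lambda>s. indicator (- {0}) (y s) * \<bar>v s\<bar> powr p)"
  have f: "integrable ?M f" "(LINT s|?M. f s) \<le> E" using Ei E by (simp_all add: f_def v_def)
  have fi: "f integrable_on {a..b}" by (rule integral_lebesgue_on_indicator(2)[OF f(1) ab])
  have vi: "v integrable_on {a..b}" by (rule integral_lebesgue_on_indicator(2)[OF speed_integrable ab])
  have gi: "(\<lambda>s. \<eta> * f s + C) integrable_on {a..b}"
    by (intro Henstock_Kurzweil_Integration.integrable_add integrable_on_mult_right fi) auto
  have "norm (integral {a<..<b} v) \<le> integral {a<..<b} (\<lambda>s. \<eta> * f s + C)"
  proof (rule integral_norm_bound_integral)
    show "v integrable_on {a<..<b}" "(\<lambda>s. \<eta> * f s + C) integrable_on {a<..<b}"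
      using vi gi by (simp_all add: integrable_on_open_interval_real)
    fix s assume s: "s \<in> {a<..<b}"
    then have "f s = \<bar>v s\<bar> powr p" using pos[OF s] by (simp add: f_def u_def)
    then show "norm (v s) \<le> \<eta> * f s + C" using young_powr[OF \<eta> p, of "v s"] by (simp add: C_def)
  qed
  also have "integral {a<..<b} (\<lambda>s. \<eta> * f s + C) = \<eta> * integral {a..b} f + C * (b - a)"
    using integral_unique[OF has_integral_add[OF has_integral_mult_right[OF integrable_integral[OF fi], of \<eta>]
      has_integral_const_real[of C a b]]] ab
    by (simp add: integral_open_interval_real mult.commute)
  also have "integral {a..b} f \<le> E"
  proof -
    have S: "{a..b} \<inter> {t<..<T} \<in> sets ?M" by (auto simp: sets_restrict_space_iff)
    have "integral {a..b} f = (LINT s|?M. indicator {a..b} s *\<^sub>R f s)"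
      by (rule integral_lebesgue_on_indicator(1)[OF f(1) ab, symmetric])
    also have "\<dots> \<le> (LINT s|?M. f s)"
    proof (rule integral_mono[OF _ f(1)])
      show "integrable ?M (\<lambda>s. indicator {a..b} s *\<^sub>R f s)"
        using integrable_mult_indicator[OF S f(1)]
        by (rule Bochner_Integration.integrable_cong[THEN iffD1, rotated 2]) (auto simp: indicator_def)
      show "indicator {a..b} s *\<^sub>R f s \<le> f s" for s by (auto simp: indicator_def f_def)
    qed
    finally show ?thesis using f(2) by simp
  qed
  finally show ?thesis using \<eta> by (simp add: integral_open_interval_real C_def mult_left_mono)
qed

end

text \<open>All constants are fixed before an optimal trajectory is chosen, so one V serves all
  optimal trajectories from x at time t.\<close>

lemma optimal_radius_lipschitz:
  fixes x :: "real ^ 'n"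
  assumes x: "x \<in> junction" and t: "0 \<le> t" "t \<le> T"
  obtains V where "0 \<le> V"
    "\<And>y s r. y \<in> opt t x \<Longrightarrow> t \<le> s \<Longrightarrow> s \<le> r \<Longrightarrow> r \<le> T \<Longrightarrow> \<bar>norm (y r) - norm (y s)\<bar> \<le> V * (r - s)"
proof -
  let ?M = "lebesgue_on {t<..<T}"
  obtain E where E0: "0 \<le> E" and
    Ei: "\<And>y. y \<in> opt t x \<Longrightarrow> integrable ?M (\<lambda>s. indicator (- {0}) (y s) * \<bar>speed t y s\<bar> powr p)" and
    E: "\<And>y. y \<in> opt t x \<Longrightarrow> (LINT s|?M. indicator (- {0}) (y s) * \<bar>speed t y s\<bar> powr p) \<le> E"
    using energy_bound[OF x t] by blast
  \<comment> \<open>A component starts at x or at the vertex, so its initial radius is at most |x|;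
    the increment bound with weight 1 adds at most E + T.\<close>
  define R where "R = norm x + E + T"
  obtain K where K: "0 \<le> K"
    "\<And>i y a s. y \<in> {0..R} \<Longrightarrow> s \<in> {0..T} \<Longrightarrow> \<bar>dyl i y a s\<bar> \<le> K * (\<bar>a\<bar> powr p + 1)"
    "\<And>i y a s. y \<in> {0..R} \<Longrightarrow> s \<in> {0..T} \<Longrightarrow> \<bar>dal i y a s\<bar> \<le> K * (\<bar>a\<bar> powr (p - 1) + 1)"
    using l_growth[of R] by metis
  have "\<exists>G. \<forall>y\<in>{0..R}. \<bar>dg i y\<bar> \<le> G" for i
  proof -
    have "compact (dg i ` {0..R})"
      by (intro compact_continuous_image continuous_on_subset[OF dg_cont]) auto
    then show ?thesis unfolding compact_eq_bounded_closed bounded_real by blast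
  qed
  then obtain G' where G': "\<And>i y. y \<in> {0..R} \<Longrightarrow> \<bar>dg i y\<bar> \<le> G' i" by metis
  define G where "G = (\<Sum>i\<in>UNIV. \<bar>G' i\<bar>)"
  have G: "\<bar>dg i y\<bar> \<le> G" if "y \<in> {0..R}" for i y
  proof -
    have "\<bar>G' i\<bar> \<le> G" unfolding G_def by (rule member_le_sum) auto
    then show ?thesis using G'[OF that, of i] by linarith
  qed
  have G0: "0 \<le> G" by (simp add: G_def sum_nonneg)
  \<comment> \<open>Chosen so that \<open>\<eta> * E\<close> is at most |x| / 2: going from x to the
    vertex then forces the remaining half to be paid by the elapsed time, and W is the resulting
    bound for the mean speed. For x = 0 the conventions for division and powers give W = 0,
    consistent with components that start at the vertex.\<close>
  define \<eta> where "\<eta> = norm x / (2 * (E + 1))"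
  define W where "W = 2 * (1 / \<eta>) powr (1 / (p - 1))"
  have W0: "0 \<le> W" by (simp add: W_def)
  \<comment> \<open>Bounds both the momentum at the speeds W + 1 and -(W + 1) and the slopes of the
    terminal costs.\<close>
  define m where "m = K * ((W + 1) powr (p - 1) + 1) + G"
  have m0: "0 \<le> m" using K(1) G0 by (simp add: m_def)
  obtain V where V0: "0 \<le> V" and
    V: "\<And>i y a s. y \<in> {0..R} \<Longrightarrow> s \<in> {0..T} \<Longrightarrow> \<bar>dal i y a s\<bar> \<le> m + K * (E + T) + 1 \<Longrightarrow> \<bar>a\<bar> \<le> V"
    using velocity_bound[of R "m + K * (E + T) + 1"] by blast
  have main: "\<bar>norm (y r) - norm (y s)\<bar> \<le> V * (r - s)"
    if y: "y \<in> opt t x" and sr: "t \<le> s" "s < r" "r \<le> T" and pos: "\<And>q. q \<in> {s<..<r} \<Longrightarrow> 0 < norm (y q)"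
    for y s r
  proof -
    define u where "u = (\<lambda>s. norm (y s))"
    define v where "v = speed t y"
    note ctx = y t E0 Ei[OF y] E[OF y] u_def v_def
    have tr: "y \<in> trajectories p T t x" using y by (simp add: optimal_trajectories_def)
    have yc: "continuous_on {t..T} y" and J: "\<And>s. s \<in> {t..T} \<Longrightarrow> y s \<in> junction" and yt: "y t = x"
      using tr by (simp_all add: trajectories_def)
    have uc: "continuous_on {t..T} u" unfolding u_def by (intro continuous_intros yc)
    have u0: "0 \<le> u s" for s by (simp add: u_def)
    obtain a b where ab: "t \<le> a" "a \<le> s" "r \<le> b" "b \<le> T" and
      posab: "\<And>q. q \<in> {a<..<b} \<Longrightarrow> 0 < u q" and ua: "a = t \<or> u a = 0" and ub: "b = T \<or> u b = 0"
      using maximal_positive_interval[OF uc u0 sr, of thesis] pos unfolding u_def by blast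
    have less: "a < b" using ab sr by linarith
    have incr: "u d - u c = integral {c..d} v" if "t \<le> c" "c \<le> d" "d \<le> T" for c d
      by (rule radius_increment[OF ctx that])
    have ua_le: "u a \<le> norm x" using ua yt by (auto simp: u_def)
    have uR: "u q \<in> {0..R}" if q: "q \<in> {a..b}" for q
    proof -
      have "\<bar>integral {a..q} v\<bar> \<le> 1 * E + (1 / 1) powr (1 / (p - 1)) * (q - a)"
        by (rule integral_speed_le[OF ctx]) (use q ab posab in auto)
      then have "u q - u a \<le> E + (q - a)" using incr[of a q] q ab by simp
      then show ?thesis using u0[of q] ua_le q ab t by (simp add: R_def)
    qed
    obtain i where edge: "\<And>q. q \<in> {a<..<b} \<Longrightarrow> y q \<in> edge i - {0}" and
      edge_b: "y b \<noteq> 0 \<Longrightarrow> y b \<in> edge i - {0}"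
    proof (rule same_edge_on_open_interval[OF _ _ _ less, of y])
      show "continuous_on {a..b} y" by (rule continuous_on_subset[OF yc]) (use ab in auto)
      show "y q \<in> junction" if "q \<in> {a..b}" for q using J[of q] that ab by auto
      show "y q \<noteq> 0" if "q \<in> {a<..<b}" for q using posab[OF that] by (auto simp: u_def)
    qed blast
    have Ky: "\<bar>dyl i (u q) (v q) q\<bar> \<le> K * (\<bar>v q\<bar> powr p + 1)" if "q \<in> {a..b}" for q
      by (rule K(2)[OF uR[OF that]]) (use that ab t in auto)
    have vi: "integrable ?M v" by (rule speed_integrable[OF ctx])
    have mom: "AE q in ?M. q \<in> {a<..<b} \<longrightarrow> \<sigma> * dal i (u q) (v q) q \<le> m + K * (E + T) + 1" if \<sigma>: "\<bar>\<sigma>\<bar> = 1" for \<sigma>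
    proof (rule momentum_AE_le[OF ctx ab(1) less ab(4) edge \<sigma> K(1) Ky m0])
      show "\<not> (AE q in ?M. q \<in> {a<..<b} \<longrightarrow> \<not> \<sigma> * dal i (u q) (v q) q \<le> m) \<or>
        b = T \<and> y T \<in> edge i - {0} \<and> \<bar>dg i (u T)\<bar> \<le> m"
      proof (cases "u b = 0")
        case False
        then have "b = T" "y T \<in> edge i - {0}" using ub edge_b by (auto simp: u_def)
        moreover have "\<bar>dg i (u T)\<bar> \<le> m"
          using G[OF uR[of b], of i] \<open>b = T\<close> less K(1) by (auto simp: m_def intro: add_increasing)
        ultimately show ?thesis by blast
      next
        case True
        \<comment> \<open>Between two zeros the increment is 0; otherwise the component starts at x,
          where the choice of \<open>\<eta>\<close> applies.\<close>
        have mean: "\<bar>u b - u a\<bar> \<le> W * (b - a)"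
        proof (cases "u a = 0")
          case True
          then show ?thesis using \<open>u b = 0\<close> W0 less by simp
        next
          case False
          then have a: "a = t" "u a = norm x" "0 < norm x" using ua yt by (auto simp: u_def)
          then have \<eta>: "0 < \<eta>" using E0 by (simp add: \<eta>_def)
          have "\<bar>integral {a..b} v\<bar> \<le> \<eta> * E + (1 / \<eta>) powr (1 / (p - 1)) * (b - a)"
            by (rule integral_speed_le[OF ctx _ _ _ _ \<eta>]) (use ab less posab in auto)
          then have "norm x \<le> \<eta> * E + W / 2 * (b - a)"
            using incr[of a b] ab less a \<open>u b = 0\<close> by (simp add: W_def)
          moreover have "\<eta> * E \<le> norm x / 2" using E0 by (simp add: \<eta>_def field_simps)
          ultimately have "norm x \<le> W * (b - a)" by (simp add: field_simps)
          then show ?thesis using a \<open>u b = 0\<close> by simp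
        qed
        have "\<not> (AE q in ?M. q \<in> {a<..<b} \<longrightarrow> \<not> \<sigma> * dal i (u q) (v q) q \<le> m)"
        proof
          \<comment> \<open>If the momentum exceeded m almost everywhere, monotonicity would force
            the signed speed to be at least W + 1, and the increment would exceed its bound W(b -
            a).\<close>
          assume ae: "AE q in ?M. q \<in> {a<..<b} \<longrightarrow> \<not> \<sigma> * dal i (u q) (v q) q \<le> m"
          have "AE q in ?M. q \<in> {a<..<b} \<longrightarrow> - (\<sigma> * v q) \<le> - (W + 1)"
            using ae
          proof eventually_elim
            case (elim q)
            show ?case
            proof (intro impI, rule ccontr)
              assume q: "q \<in> {a<..<b}" and "\<not> - (\<sigma> * v q) \<le> - (W + 1)"
              then have lt: "\<sigma> * v q \<le> W + 1" by simp
              have qT: "q \<in> {0..T}" "u q \<in> {0..R}" using q ab t uR[of q] by auto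
              have "\<bar>dal i (u q) a q\<bar> \<le> m" if "\<bar>a\<bar> = W + 1" for a
                using K(3)[OF qT(2,1), of i a] that G0 by (simp add: m_def)
              then have M: "\<bar>dal i (u q) (W + 1) q\<bar> \<le> m" "\<bar>dal i (u q) (- (W + 1)) q\<bar> \<le> m"
                using W0 by (simp_all only: abs_minus_cancel)
              consider "\<sigma> = 1" | "\<sigma> = - 1" using \<sigma> by (auto simp: abs_if split: if_splits)
              then have "\<sigma> * dal i (u q) (v q) q \<le> m"
              proof cases
                case 1
                then show ?thesis using dal_mono[OF u0[of q] qT(1), of "v q" "W + 1" i] lt M(1) by (simp add: abs_le_iff)
              next
                case 2
                then show ?thesis using dal_mono[OF u0[of q] qT(1), of "- (W + 1)" "v q" i] lt M(2) by auto
              qed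
              then show False using elim q by simp
            qed
          qed
          then have "integral {a..b} (\<lambda>q. - (\<sigma> * v q)) \<le> - (W + 1) * (b - a)"
            by (intro integral_le_of_AE_le) (use vi ab less in auto)
          also have "integral {a..b} (\<lambda>q. - (\<sigma> * v q)) = - (\<sigma> * (u b - u a))"
            using incr[of a b] ab less by simp
          finally have "(W + 1) * (b - a) \<le> \<sigma> * (u b - u a)" by (simp add: algebra_simps)
          also have "\<dots> \<le> \<bar>\<sigma> * (u b - u a)\<bar>" by simp
          also have "\<dots> \<le> W * (b - a)" using mean \<sigma> by (simp add: abs_mult)
          finally show False using less by (simp add: algebra_simps)
        qed
        then show ?thesis by blast
      qed
    qed
    have vV: "AE q in ?M. q \<in> {a<..<b} \<longrightarrow> \<bar>v q\<bar> \<le> V"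
      using mom[of 1, simplified] mom[of "- 1", simplified]
    proof eventually_elim
      case (elim q)
      show ?case
      proof
        assume q: "q \<in> {a<..<b}"
        have "q \<in> {0..T}" using q ab t by auto
        then show "\<bar>v q\<bar> \<le> V" using V[OF uR[of q]] elim q by (auto simp: abs_le_iff)
      qed
    qed
    have "integral {s..r} v \<le> V * (r - s)"
      by (rule integral_le_of_AE_le[OF vi]) (use vV ab sr in \<open>auto elim!: eventually_mono\<close>)
    moreover have "integral {s..r} (\<lambda>q. - v q) \<le> V * (r - s)"
      by (rule integral_le_of_AE_le[of t T]) (use vi vV ab sr in \<open>auto elim!: eventually_mono\<close>)
    ultimately show ?thesis using incr[of s r] sr by (simp add: u_def abs_le_iff)
  qed
  have "\<bar>norm (y r) - norm (y s)\<bar> \<le> V * (r - s)"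
    if y: "y \<in> opt t x" and sr: "t \<le> s" "s \<le> r" "r \<le> T" for y s r
  proof (rule lipschitz_from_positive_parts[of t T "\<lambda>s. norm (y s)"])
    show "continuous_on {t..T} (\<lambda>s. norm (y s))"
      using y by (auto simp: optimal_trajectories_def trajectories_def intro: continuous_intros)
    show "\<bar>norm (y r) - norm (y s)\<bar> \<le> V * (r - s)"
      if "t \<le> s" "s < r" "r \<le> T" "\<And>x. x \<in> {s<..<r} \<Longrightarrow> 0 < norm (y x)" for s r
      using main[OF y that] .
  qed (use V0 sr in auto)
  then show ?thesis by (rule that[OF V0])
qed

text \<open>The whole path is Lipschitz with constant V, so for each unit vector e the integrals of
  V minus the e-component of the weak derivative are nonnegative, and so is this function almost
  everywhere.\<close>

lemma optimal_velocity_bounded: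
  fixes x :: "real ^ 'n"
  assumes x: "x \<in> junction" and t: "0 \<le> t" "t \<le> T"
  obtains B where "0 < B"
    "\<And>y. y \<in> opt t x \<Longrightarrow> weak_deriv t T y \<in> borel_measurable (lebesgue_on {t<..<T})"
    "\<And>y. y \<in> opt t x \<Longrightarrow> Linf_norm t T (weak_deriv t T y) \<le> ennreal B"
proof -
  let ?M = "lebesgue_on {t<..<T}"
  interpret finite_measure ?M by (rule finite_measure_lebesgue_on) simp
  obtain V where V: "0 \<le> V"
    "\<And>y s r. y \<in> opt t x \<Longrightarrow> t \<le> s \<Longrightarrow> s \<le> r \<Longrightarrow> r \<le> T \<Longrightarrow> \<bar>norm (y r) - norm (y s)\<bar> \<le> V * (r - s)"
    using optimal_radius_lipschitz[OF x t] by blast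
  \<comment> \<open>The norm is bounded by the sum of the coordinates, hence the dimension; the 1
    makes the constant positive.\<close>
  define B where "B = V * DIM(real ^ 'n) + 1"
  have B: "0 < B" using V(1) by (simp add: B_def add_nonneg_pos)
  have m: "weak_deriv t T y \<in> borel_measurable ?M" and b: "Linf_norm t T (weak_deriv t T y) \<le> ennreal B"
    if y: "y \<in> opt t x" for y
  proof -
    define w where "w = weak_deriv t T y"
    have tr: "y \<in> trajectories p T t x" using y by (simp add: optimal_trajectories_def)
    have yc: "continuous_on {t..T} y" and J: "\<And>s. s \<in> {t..T} \<Longrightarrow> y s \<in> junction" and yt: "y t = x"
      using tr by (simp_all add: trajectories_def)
    obtain w' where w': "w' \<in> Lp p t T" "\<And>s. s \<in> {t..T} \<Longrightarrow> y s = x + integral {t..s} w'"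
      using trajectory_velocity[OF tr] by blast
    have w'i: "integrable ?M w'" by (rule Lp_imp_integrable[OF w'(1)]) (use p in simp)
    have w: "integrable ?M w" "\<And>s. s \<in> {t..T} \<Longrightarrow> y s = y t + integral {t..s} w"
      unfolding w_def using weak_deriv_indefinite_integral(1,3)[OF w'i, of y] w'(2) yt by auto
    then show wm: "weak_deriv t T y \<in> borel_measurable ?M" by (simp add: w_def)
    have comp: "AE s in ?M. 0 \<le> V - w s \<bullet> e" if e: "norm e = 1" for e
    proof (rule AE_nonneg_of_integrals)
      show "integrable ?M (\<lambda>s. V - w s \<bullet> e)"
        using w(1) by (intro Bochner_Integration.integrable_diff integrable_inner_left) auto
      fix s r assume sr: "t \<le> s" "s \<le> r" "r \<le> T"
      have "w integrable_on {t..r}"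
        by (rule integral_lebesgue_on_indicator(2)[OF w(1)]) (use sr in auto)
      from Henstock_Kurzweil_Integration.integral_combine[OF sr(1,2) this]
      have eq: "integral {s..r} w = y r - y s" using w(2)[of s] w(2)[of r] sr by (simp add: algebra_simps)
      have wi: "w integrable_on {s..r}" by (rule integral_lebesgue_on_indicator(2)[OF w(1) sr])
      have "((\<lambda>s. w s \<bullet> e) has_integral (y r - y s) \<bullet> e) {s..r}"
        using has_integral_linear[OF integrable_integral[OF wi] bounded_linear_inner_left[of e]]
        by (simp add: o_def eq)
      from has_integral_diff[OF has_integral_const_real[of V s r] this]
      have "integral {s..r} (\<lambda>s. V - w s \<bullet> e) = V * (r - s) - (y r - y s) \<bullet> e"
        using sr by (simp add: integral_unique mult.commute)
      moreover have "(y r - y s) \<bullet> e \<le> norm (y r - y s) * norm e" by (rule norm_cauchy_schwarz)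
      moreover have "norm (y r - y s) \<le> V * (r - s)"
        by (rule norm_diff_junction_le[OF yc J V(2)[OF y] sr])
      ultimately show "0 \<le> integral {s..r} (\<lambda>s. V - w s \<bullet> e)" using e by simp
    qed
    have "AE s in ?M. \<forall>e\<in>Basis. 0 \<le> V - w s \<bullet> e \<and> 0 \<le> V - w s \<bullet> (- e)"
      by (intro AE_finite_allI finite_Basis AE_conjI comp) auto
    then have "AE s in ?M. ennreal (norm (w s)) \<le> ennreal B"
    proof eventually_elim
      case (elim s)
      have "norm (w s) \<le> (\<Sum>e\<in>Basis. \<bar>w s \<bullet> e\<bar>)" by (rule norm_le_l1)
      also have "\<dots> \<le> (\<Sum>e\<in>(Basis :: (real ^ 'n) set). V)"
        by (intro sum_mono) (use elim in \<open>auto simp: abs_le_iff\<close>)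
      also have "\<dots> \<le> B" by (simp add: B_def mult.commute)
      finally show ?case by (rule ennreal_leI)
    qed
    moreover have "(\<lambda>s. ennreal (norm (w s))) \<in> borel_measurable ?M"
      using w(1) by measurable
    ultimately show "Linf_norm t T (weak_deriv t T y) \<le> ennreal B"
      unfolding Linf_norm_def w_def by (intro esssup_I)
  qed
  show ?thesis by (rule that[OF B m b])
qed

end

section \<open>A bound in terms of the distance to the vertex and the remaining time\<close>

theorem theorem2p18:
  fixes l :: "'n::finite \<Rightarrow> real \<Rightarrow> real \<Rightarrow> real \<Rightarrow> real"
    and dyl dal :: "'n \<Rightarrow> real \<Rightarrow> real \<Rightarrow> real \<Rightarrow> real"
    and lstar :: "real \<Rightarrow> real"
    and g :: "'n \<Rightarrow> real \<Rightarrow> real"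
    and gstar T p :: real
  assumes N: "1 < CARD('n)"
    and T: "0 < T" and p: "1 < p"
    and g_cont: "\<And>i. continuous_on {0..} (g i)"
    and g_bdd: "\<And>i. bounded (g i ` {0..})"
    and lstar_cont: "continuous_on {0..T} lstar"
    and l_cont: "\<And>i. continuous_on ({0..} \<times> UNIV \<times> {0..T}) (\<lambda>(y, a, s). l i y a s)"
    and l_deriv: "\<And>i y a s. 0 \<le> y \<Longrightarrow> s \<in> {0..T} \<Longrightarrow>
        ((\<lambda>(y, a). l i y a s) has_derivative (\<lambda>(h, k). dyl i y a s * h + dal i y a s * k))
          (at (y, a) within {0..} \<times> UNIV)"
    and dyl_cont: "\<And>i. continuous_on ({0..} \<times> UNIV \<times> {0..T}) (\<lambda>(y, a, s). dyl i y a s)"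
    and dal_cont: "\<And>i. continuous_on ({0..} \<times> UNIV \<times> {0..T}) (\<lambda>(y, a, s). dal i y a s)"
    and H1: "\<And>i. \<exists>C0>0. (\<forall>y\<ge>0. \<forall>a. \<forall>s\<in>{0..T}. C0 * (\<bar>a\<bar> powr p - 1) \<le> l i y a s) \<and>
                        (\<forall>s\<in>{0..T}. - C0 \<le> lstar s)"
    and H2: "\<And>i r. 0 < r \<Longrightarrow> \<exists>\<omega>. modulus_of_continuity \<omega> \<and>
        (\<forall>y\<in>{0..r}. \<forall>a. \<forall>t1\<in>{0..T}. \<forall>t2\<in>{0..T}.
           \<bar>l i y a t1 - l i y a t2\<bar> \<le> (1 + \<bar>a\<bar> powr p) * \<omega> \<bar>t1 - t2\<bar>)"
    and H3: "\<And>i r. 0 < r \<Longrightarrow> \<exists>c\<ge>0. \<forall>y\<in>{0..r}. \<forall>a. \<forall>s\<in>{0..T}.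
        \<bar>dyl i y a s\<bar> \<le> c * (\<bar>a\<bar> powr p + 1) \<and>
        \<bar>dal i y a s\<bar> \<le> c * (\<bar>a\<bar> powr (p - 1) + 1)"
    and H4: "\<And>i y s. 0 \<le> y \<Longrightarrow> s \<in> {0..T} \<Longrightarrow> strictly_convex (\<lambda>a. l i y a s)"
    and g_C1: "\<And>i. C1_halfline (g i)"
  shows "(\<forall>x \<in> (junction :: (real ^ 'n) set). \<forall>t \<in> {0..T}.
            \<forall>y \<in> optimal_trajectories l lstar g gstar p T t x.
              weak_deriv t T y \<in> Linf t T) \<and>
         (\<exists>V :: real \<Rightarrow> real \<Rightarrow> real. (\<forall>r d. 0 < V r d) \<and>
            (\<forall>x \<in> (junction :: (real ^ 'n) set). \<forall>t \<in> {0..T}.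
               \<forall>y \<in> optimal_trajectories l lstar g gstar p T t x.
                 Linf_norm t T (weak_deriv t T y) \<le> ennreal (V (norm x) (T - t))))"
proof -
  have "\<forall>i. \<exists>f'. (\<forall>y\<ge>0. (g i has_real_derivative f' y) (at y within {0..})) \<and> continuous_on {0..} f'"
    using g_C1 by (simp add: C1_halfline_def)
  then obtain dg where dg: "\<And>i y. 0 \<le> y \<Longrightarrow> (g i has_real_derivative dg i y) (at y within {0..})"
    "\<And>i. continuous_on {0..} (dg i)"
    by metis
  interpret junction_problem l dyl dal lstar g dg gstar T p
    by (rule junction_problem.intro[OF T p g_bdd lstar_cont l_cont l_deriv dyl_cont dal_cont H1 H3 H4 dg])
  \<comment> \<open>Outside the admissible pairs any positive number will do, which makes B a total
    function.\<close>
  have "\<exists>B>0. x \<in> junction \<longrightarrow> t \<in> {0..T} \<longrightarrow> (\<forall>y\<in>opt t x.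
      weak_deriv t T y \<in> borel_measurable (lebesgue_on {t<..<T}) \<and>
      Linf_norm t T (weak_deriv t T y) \<le> ennreal B)" for x :: "real ^ 'n" and t
  proof (cases "x \<in> junction \<and> t \<in> {0..T}")
    case True
    then obtain B where "0 < B"
      "\<And>y. y \<in> opt t x \<Longrightarrow> weak_deriv t T y \<in> borel_measurable (lebesgue_on {t<..<T})"
      "\<And>y. y \<in> opt t x \<Longrightarrow> Linf_norm t T (weak_deriv t T y) \<le> ennreal B"
      using optimal_velocity_bounded[of x t] by auto
    then show ?thesis by blast
  qed (auto intro: exI[of _ 1])
  then obtain B where B0: "\<And>x t. 0 < B x t" and
    B: "\<And>x t y. x \<in> (junction :: (real ^ 'n) set) \<Longrightarrow> t \<in> {0..T} \<Longrightarrow> y \<in> opt t x \<Longrightarrow>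
      weak_deriv t T y \<in> borel_measurable (lebesgue_on {t<..<T}) \<and>
      Linf_norm t T (weak_deriv t T y) \<le> ennreal (B x t)"
    by metis
  \<comment> \<open>The points of the junction with norm r are the vectors r times a basis vector,
    one per edge, and the starting time is T - d. Summing the positive bounds over the edges removes
    the dependence on the edge.\<close>
  define V where "V = (\<lambda>r d. \<Sum>i\<in>UNIV. B (r *\<^sub>R axis (i :: 'n) 1) (T - d))"
  have "0 < V r d" for r d
    unfolding V_def by (rule sum_pos) (use B0 in auto)
  moreover have "Linf_norm t T (weak_deriv t T y) \<le> ennreal (V (norm x) (T - t))"
    if "x \<in> (junction :: (real ^ 'n) set)" "t \<in> {0..T}" "y \<in> opt t x" for x t y
  proof -
    have "x \<in> junction" by (rule that(1))
    then obtain i where "x \<in> edge i" by (auto simp: junction_def)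
    then have "B x t = B (norm x *\<^sub>R axis i 1) (T - (T - t))" using edge_eq[of x i] by simp
    also have "\<dots> \<le> V (norm x) (T - t)"
      unfolding V_def by (rule member_le_sum[of i]) (use B0 in \<open>auto intro: less_imp_le\<close>)
    finally show ?thesis using B[OF that] by (meson ennreal_leI order_trans)
  qed
  moreover have "weak_deriv t T y \<in> Linf t T"
    if "x \<in> (junction :: (real ^ 'n) set)" "t \<in> {0..T}" "y \<in> opt t x" for x t y
    using B[OF that] ennreal_less_top[of "B x t"] by (auto simp: Linf_def intro: le_less_trans)
  ultimately show ?thesis by blast
qed

end
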